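(* Over $\mathsf{RCA}_0$ the following are equivalent: (1) every infinite traceable graph either contains arbitrarily long finite chordless paths or contains a subgraph isomorphic to $A$; (2) every infinite traceable graph containing no chordless 4-path contains a subgraph isomorphic to $K_{\omega,\omega}$; (3) $\mathsf{ACA}_0$.
   Context: Within second-order arithmetic: a graph is a pair $G=(V,E)$ with $V\subseteq\mathbb{N}$ and $E$ a symmetric irreflexive binary relation on $V$. An $n$-path is a sequence of distinct vertices $v_0,\dots,v_{n-1}$ with $E(v_i,v_{i+1})$ for all $i\le n-2$; it is chordless if $E(v_i,v_j)$ holds if and only if $|i-j|=1$. $G$ contains arbitrarily long chordless paths if for each $n$ it contains a chordless $n$-path. An infinite graph is traceable if there is a bijection $T:\mathbb{N}\to V$ with $E(T(i),T(i+1))$ for all $i$. $K_{\omega,\omega}$ has vertices $a_n,b_n$ ($n\in\mathbb{N}$) with edges between $a_n$ and $b_m$ for all $n,m$; $A$ has vertices $a_n,b_n$ ($n\in\mathbb{N}$) with edges between $a_n$ and $b_m$ exactly when $n\le m$. $G$ contains a subgraph isomorphic to $H$ if there is an injective $g:V_H\to V_G$ such that adjacent vertices of $H$ map to adjacent vertices of $G$ (additional edges in $G$ allowed). *)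

theory Defs
  imports Main
begin

text \<open>
  Subsystems of second-order arithmetic follow Simpson's "Subsystems of Second Order Arithmetic".
  Number variables and set variables are both named by strings, but live in separate name spaces.
\<close>

section \<open>The language of second-order arithmetic\<close>

datatype tm =
    Var string
  | Zero (\<open>\<^bold>0\<close>)
  | One (\<open>\<^bold>1\<close>)
  | Add tm tm (infixl \<open>\<^bold>+\<close> 65)
  | Mul tm tm (infixl \<open>\<^bold>*\<close> 70)

datatype fm =
    Eq tm tm (infix \<open>\<^bold>=\<close> 50)
  | Less tm tm (infix \<open>\<^bold><\<close> 50)
  | Mem tm string (infix \<open>\<^bold>\<in>\<close> 50)
  | Neg fm (\<open>\<^bold>\<not> _\<close> [40] 40)
  | Conj fm fm (infixr \<open>\<^bold>\<and>\<close> 35)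
  | Disj fm fm (infixr \<open>\<^bold>\<or>\<close> 30)
  | Imp fm fm (infixr \<open>\<^bold>\<longrightarrow>\<close> 25)
  | Iff fm fm (infixr \<open>\<^bold>\<longleftrightarrow>\<close> 25)
  | All string fm (\<open>\<^bold>\<forall>_\<^bold>./ _\<close> [1000, 10] 10)
  | Ex string fm (\<open>\<^bold>\<exists>_\<^bold>./ _\<close> [1000, 10] 10)
  | AllSet string fm (\<open>\<^bold>\<forall>\<^sub>S_\<^bold>./ _\<close> [1000, 10] 10)
  | ExSet string fm (\<open>\<^bold>\<exists>\<^sub>S_\<^bold>./ _\<close> [1000, 10] 10)

primrec tm_vars :: "tm \<Rightarrow> string set" where
  "tm_vars (Var x) = {x}"
| "tm_vars \<^bold>0 = {}"
| "tm_vars \<^bold>1 = {}"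
| "tm_vars (s \<^bold>+ t) = tm_vars s \<union> tm_vars t"
| "tm_vars (s \<^bold>* t) = tm_vars s \<union> tm_vars t"

primrec free_set_vars :: "fm \<Rightarrow> string set" where
  "free_set_vars (s \<^bold>= t) = {}"
| "free_set_vars (s \<^bold>< t) = {}"
| "free_set_vars (t \<^bold>\<in> X) = {X}"
| "free_set_vars (\<^bold>\<not> p) = free_set_vars p"
| "free_set_vars (p \<^bold>\<and> q) = free_set_vars p \<union> free_set_vars q"
| "free_set_vars (p \<^bold>\<or> q) = free_set_vars p \<union> free_set_vars q"
| "free_set_vars (p \<^bold>\<longrightarrow> q) = free_set_vars p \<union> free_set_vars q"
| "free_set_vars (p \<^bold>\<longleftrightarrow> q) = free_set_vars p \<union> free_set_vars q"
| "free_set_vars (\<^bold>\<forall>x\<^bold>. p) = free_set_vars p"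
| "free_set_vars (\<^bold>\<exists>x\<^bold>. p) = free_set_vars p"
| "free_set_vars (\<^bold>\<forall>\<^sub>SX\<^bold>. p) = free_set_vars p - {X}"
| "free_set_vars (\<^bold>\<exists>\<^sub>SX\<^bold>. p) = free_set_vars p - {X}"

primrec tm_subst :: "string \<Rightarrow> tm \<Rightarrow> tm \<Rightarrow> tm" where
  "tm_subst x t (Var y) = (if y = x then t else Var y)"
| "tm_subst x t \<^bold>0 = \<^bold>0"
| "tm_subst x t \<^bold>1 = \<^bold>1"
| "tm_subst x t (r \<^bold>+ s) = tm_subst x t r \<^bold>+ tm_subst x t s"
| "tm_subst x t (r \<^bold>* s) = tm_subst x t r \<^bold>* tm_subst x t s"

text \<open>
  Replacement of the free occurrences of a number variable \<open>x\<close> by \<open>t\<close>, without renaming of bound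
  variables. It is only used for terms \<open>t\<close> with no variable other than \<open>x\<close>, where no capture
  can occur.
\<close>

primrec fm_subst :: "string \<Rightarrow> tm \<Rightarrow> fm \<Rightarrow> fm" where
  "fm_subst x t (r \<^bold>= s) = (tm_subst x t r \<^bold>= tm_subst x t s)"
| "fm_subst x t (r \<^bold>< s) = (tm_subst x t r \<^bold>< tm_subst x t s)"
| "fm_subst x t (r \<^bold>\<in> X) = (tm_subst x t r \<^bold>\<in> X)"
| "fm_subst x t (\<^bold>\<not> p) = (\<^bold>\<not> fm_subst x t p)"
| "fm_subst x t (p \<^bold>\<and> q) = (fm_subst x t p \<^bold>\<and> fm_subst x t q)"
| "fm_subst x t (p \<^bold>\<or> q) = (fm_subst x t p \<^bold>\<or> fm_subst x t q)"
| "fm_subst x t (p \<^bold>\<longrightarrow> q) = (fm_subst x t p \<^bold>\<longrightarrow> fm_subst x t q)"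
| "fm_subst x t (p \<^bold>\<longleftrightarrow> q) = (fm_subst x t p \<^bold>\<longleftrightarrow> fm_subst x t q)"
| "fm_subst x t (\<^bold>\<forall>y\<^bold>. p) = (\<^bold>\<forall>y\<^bold>. if y = x then p else fm_subst x t p)"
| "fm_subst x t (\<^bold>\<exists>y\<^bold>. p) = (\<^bold>\<exists>y\<^bold>. if y = x then p else fm_subst x t p)"
| "fm_subst x t (\<^bold>\<forall>\<^sub>SX\<^bold>. p) = (\<^bold>\<forall>\<^sub>SX\<^bold>. fm_subst x t p)"
| "fm_subst x t (\<^bold>\<exists>\<^sub>SX\<^bold>. p) = (\<^bold>\<exists>\<^sub>SX\<^bold>. fm_subst x t p)"

inductive Sigma00 :: "fm \<Rightarrow> bool" where
  "Sigma00 (s \<^bold>= t)"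
| "Sigma00 (s \<^bold>< t)"
| "Sigma00 (t \<^bold>\<in> X)"
| "Sigma00 p \<Longrightarrow> Sigma00 (\<^bold>\<not> p)"
| "Sigma00 p \<Longrightarrow> Sigma00 q \<Longrightarrow> Sigma00 (p \<^bold>\<and> q)"
| "Sigma00 p \<Longrightarrow> Sigma00 q \<Longrightarrow> Sigma00 (p \<^bold>\<or> q)"
| "Sigma00 p \<Longrightarrow> Sigma00 q \<Longrightarrow> Sigma00 (p \<^bold>\<longrightarrow> q)"
| "Sigma00 p \<Longrightarrow> Sigma00 q \<Longrightarrow> Sigma00 (p \<^bold>\<longleftrightarrow> q)"
| "Sigma00 p \<Longrightarrow> x \<notin> tm_vars t \<Longrightarrow> Sigma00 (\<^bold>\<forall>x\<^bold>. Var x \<^bold>< t \<^bold>\<longrightarrow> p)"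
| "Sigma00 p \<Longrightarrow> x \<notin> tm_vars t \<Longrightarrow> Sigma00 (\<^bold>\<exists>x\<^bold>. Var x \<^bold>< t \<^bold>\<and> p)"

definition Sigma01 :: "fm \<Rightarrow> bool" where
  "Sigma01 p \<longleftrightarrow> (\<exists>x q. Sigma00 q \<and> p = (\<^bold>\<exists>x\<^bold>. q))"

definition Pi01 :: "fm \<Rightarrow> bool" where
  "Pi01 p \<longleftrightarrow> (\<exists>x q. Sigma00 q \<and> p = (\<^bold>\<forall>x\<^bold>. q))"

primrec arithmetical :: "fm \<Rightarrow> bool" where
  "arithmetical (s \<^bold>= t) \<longleftrightarrow> True"
| "arithmetical (s \<^bold>< t) \<longleftrightarrow> True"
| "arithmetical (t \<^bold>\<in> X) \<longleftrightarrow> True"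
| "arithmetical (\<^bold>\<not> p) \<longleftrightarrow> arithmetical p"
| "arithmetical (p \<^bold>\<and> q) \<longleftrightarrow> arithmetical p \<and> arithmetical q"
| "arithmetical (p \<^bold>\<or> q) \<longleftrightarrow> arithmetical p \<and> arithmetical q"
| "arithmetical (p \<^bold>\<longrightarrow> q) \<longleftrightarrow> arithmetical p \<and> arithmetical q"
| "arithmetical (p \<^bold>\<longleftrightarrow> q) \<longleftrightarrow> arithmetical p \<and> arithmetical q"
| "arithmetical (\<^bold>\<forall>x\<^bold>. p) \<longleftrightarrow> arithmetical p"
| "arithmetical (\<^bold>\<exists>x\<^bold>. p) \<longleftrightarrow> arithmetical p"
| "arithmetical (\<^bold>\<forall>\<^sub>SX\<^bold>. p) \<longleftrightarrow> False"
| "arithmetical (\<^bold>\<exists>\<^sub>SX\<^bold>. p) \<longleftrightarrow> False"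

section \<open>Structures and satisfaction\<close>

text \<open>
  The first-order part of a structure is the whole type \<open>'a\<close>; set variables range over \<open>Sets\<close>.
  Equality is interpreted as identity.
\<close>

record 'a l2_structure =
  zero_of :: 'a
  one_of :: 'a
  add_of :: "'a \<Rightarrow> 'a \<Rightarrow> 'a"
  mul_of :: "'a \<Rightarrow> 'a \<Rightarrow> 'a"
  less_of :: "'a \<Rightarrow> 'a \<Rightarrow> bool"
  Sets :: "'a set set"

primrec tm_val :: "'a l2_structure \<Rightarrow> (string \<Rightarrow> 'a) \<Rightarrow> tm \<Rightarrow> 'a" where
  "tm_val M e (Var x) = e x"
| "tm_val M e \<^bold>0 = zero_of M"
| "tm_val M e \<^bold>1 = one_of M"
| "tm_val M e (s \<^bold>+ t) = add_of M (tm_val M e s) (tm_val M e t)"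
| "tm_val M e (s \<^bold>* t) = mul_of M (tm_val M e s) (tm_val M e t)"

primrec sat :: "'a l2_structure \<Rightarrow> (string \<Rightarrow> 'a) \<Rightarrow> (string \<Rightarrow> 'a set) \<Rightarrow> fm \<Rightarrow> bool" where
  "sat M e s (t \<^bold>= u) \<longleftrightarrow> tm_val M e t = tm_val M e u"
| "sat M e s (t \<^bold>< u) \<longleftrightarrow> less_of M (tm_val M e t) (tm_val M e u)"
| "sat M e s (t \<^bold>\<in> X) \<longleftrightarrow> tm_val M e t \<in> s X"
| "sat M e s (\<^bold>\<not> p) \<longleftrightarrow> \<not> sat M e s p"
| "sat M e s (p \<^bold>\<and> q) \<longleftrightarrow> sat M e s p \<and> sat M e s q"
| "sat M e s (p \<^bold>\<or> q) \<longleftrightarrow> sat M e s p \<or> sat M e s q"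
| "sat M e s (p \<^bold>\<longrightarrow> q) \<longleftrightarrow> (sat M e s p \<longrightarrow> sat M e s q)"
| "sat M e s (p \<^bold>\<longleftrightarrow> q) \<longleftrightarrow> (sat M e s p \<longleftrightarrow> sat M e s q)"
| "sat M e s (\<^bold>\<forall>x\<^bold>. p) \<longleftrightarrow> (\<forall>a. sat M (e(x := a)) s p)"
| "sat M e s (\<^bold>\<exists>x\<^bold>. p) \<longleftrightarrow> (\<exists>a. sat M (e(x := a)) s p)"
| "sat M e s (\<^bold>\<forall>\<^sub>SX\<^bold>. p) \<longleftrightarrow> (\<forall>A\<in>Sets M. sat M e (s(X := A)) p)"
| "sat M e s (\<^bold>\<exists>\<^sub>SX\<^bold>. p) \<longleftrightarrow> (\<exists>A\<in>Sets M. sat M e (s(X := A)) p)"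

text \<open>A formula with free variables holds in a structure if its universal closure does.\<close>

definition holds :: "'a l2_structure \<Rightarrow> fm \<Rightarrow> bool" (infix \<open>\<Turnstile>\<close> 50) where
  "M \<Turnstile> p \<longleftrightarrow> (\<forall>e s. range s \<subseteq> Sets M \<longrightarrow> sat M e s p)"

text \<open>
  The set domain of a structure has to be nonempty: otherwise there is no assignment to the set
  variables, and every formula would hold vacuously.
\<close>

definition model_of :: "'a l2_structure \<Rightarrow> fm set \<Rightarrow> bool" (infix \<open>\<Turnstile>\<^sub>T\<close> 50) where
  "M \<Turnstile>\<^sub>T T \<longleftrightarrow> Sets M \<noteq> {} \<and> (\<forall>p\<in>T. M \<Turnstile> p)"

section \<open>The theories RCA0 and ACA0\<close>

definition basic_axioms :: "fm set" where
  "basic_axioms =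
    (let m = Var ''m''; n = Var ''n'' in
     {\<^bold>\<not> n \<^bold>+ \<^bold>1 \<^bold>= \<^bold>0,
      m \<^bold>+ \<^bold>1 \<^bold>= n \<^bold>+ \<^bold>1 \<^bold>\<longrightarrow> m \<^bold>= n,
      m \<^bold>+ \<^bold>0 \<^bold>= m,
      m \<^bold>+ (n \<^bold>+ \<^bold>1) \<^bold>= (m \<^bold>+ n) \<^bold>+ \<^bold>1,
      m \<^bold>* \<^bold>0 \<^bold>= \<^bold>0,
      m \<^bold>* (n \<^bold>+ \<^bold>1) \<^bold>= (m \<^bold>* n) \<^bold>+ m,
      \<^bold>\<not> m \<^bold>< \<^bold>0,
      m \<^bold>< n \<^bold>+ \<^bold>1 \<^bold>\<longleftrightarrow> m \<^bold>< n \<^bold>\<or> m \<^bold>= n})"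

definition Sigma01_induction :: "fm set" where
  "Sigma01_induction =
    {fm_subst x \<^bold>0 p \<^bold>\<and> (\<^bold>\<forall>x\<^bold>. p \<^bold>\<longrightarrow> fm_subst x (Var x \<^bold>+ \<^bold>1) p) \<^bold>\<longrightarrow> (\<^bold>\<forall>x\<^bold>. p) | x p. Sigma01 p}"

definition Delta01_comprehension :: "fm set" where
  "Delta01_comprehension =
    {(\<^bold>\<forall>x\<^bold>. p \<^bold>\<longleftrightarrow> q) \<^bold>\<longrightarrow> (\<^bold>\<exists>\<^sub>SX\<^bold>. \<^bold>\<forall>x\<^bold>. Var x \<^bold>\<in> X \<^bold>\<longleftrightarrow> p) | x X p q.
      Sigma01 p \<and> Pi01 q \<and> X \<notin> free_set_vars p}"

definition set_induction :: fm where
  "set_induction =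
    (\<^bold>0 \<^bold>\<in> ''X'' \<^bold>\<and> (\<^bold>\<forall>''n''\<^bold>. Var ''n'' \<^bold>\<in> ''X'' \<^bold>\<longrightarrow> Var ''n'' \<^bold>+ \<^bold>1 \<^bold>\<in> ''X'')
      \<^bold>\<longrightarrow> (\<^bold>\<forall>''n''\<^bold>. Var ''n'' \<^bold>\<in> ''X''))"

definition arithmetical_comprehension :: "fm set" where
  "arithmetical_comprehension =
    {(\<^bold>\<exists>\<^sub>SX\<^bold>. \<^bold>\<forall>x\<^bold>. Var x \<^bold>\<in> X \<^bold>\<longleftrightarrow> p) | x X p. arithmetical p \<and> X \<notin> free_set_vars p}"

definition RCA0 :: "fm set" where
  "RCA0 = basic_axioms \<union> Sigma01_induction \<union> Delta01_comprehension"

definition ACA0 :: "fm set" where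
  "ACA0 = basic_axioms \<union> {set_induction} \<union> arithmetical_comprehension"

section \<open>Graphs in second-order arithmetic\<close>

text \<open>
  Binary relations and functions are sets of codes of pairs, where \<open>(i, j)\<close> is coded by
  \<open>(i + j)\<^sup>2 + i\<close>. In the formulas below the vertex set and the edge relation of the graph under
  consideration are the free set variables \<open>V\<close> and \<open>E\<close>.
\<close>

definition pair :: "tm \<Rightarrow> tm \<Rightarrow> tm" where
  "pair s t = (s \<^bold>+ t) \<^bold>* (s \<^bold>+ t) \<^bold>+ s"

definition graph_fm :: fm where
  "graph_fm =
    (let x = Var ''x''; y = Var ''y''; z = Var ''z'' in
     (\<^bold>\<forall>''z''\<^bold>. z \<^bold>\<in> ''E'' \<^bold>\<longrightarrow> (\<^bold>\<exists>''x''\<^bold>. \<^bold>\<exists>''y''\<^bold>. z \<^bold>= pair x y \<^bold>\<and> x \<^bold>\<in> ''V'' \<^bold>\<and> y \<^bold>\<in> ''V'')) \<^bold>\<and>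
     (\<^bold>\<forall>''x''\<^bold>. \<^bold>\<forall>''y''\<^bold>. pair x y \<^bold>\<in> ''E'' \<^bold>\<longrightarrow> pair y x \<^bold>\<in> ''E'') \<^bold>\<and>
     (\<^bold>\<forall>''x''\<^bold>. \<^bold>\<not> pair x x \<^bold>\<in> ''E''))"

text \<open>A set is finite if it is bounded.\<close>

definition infinite_fm :: fm where
  "infinite_fm = (\<^bold>\<not> (\<^bold>\<exists>''k''\<^bold>. \<^bold>\<forall>''x''\<^bold>. Var ''x'' \<^bold>\<in> ''V'' \<^bold>\<longrightarrow> Var ''x'' \<^bold>< Var ''k''))"

text \<open>There is a bijection \<open>T\<close> from the numbers to \<open>V\<close> with \<open>T(i)\<close> adjacent to \<open>T(i + 1)\<close>.\<close>

definition traceable_fm :: fm where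
  "traceable_fm =
    (let i = Var ''i''; j = Var ''j''; x = Var ''x''; y = Var ''y''; z = Var ''z'' in
     \<^bold>\<exists>\<^sub>S''T''\<^bold>.
      (\<^bold>\<forall>''z''\<^bold>. z \<^bold>\<in> ''T'' \<^bold>\<longrightarrow> (\<^bold>\<exists>''i''\<^bold>. \<^bold>\<exists>''x''\<^bold>. z \<^bold>= pair i x \<^bold>\<and> x \<^bold>\<in> ''V'')) \<^bold>\<and>
      (\<^bold>\<forall>''i''\<^bold>. \<^bold>\<exists>''x''\<^bold>. pair i x \<^bold>\<in> ''T'') \<^bold>\<and>
      (\<^bold>\<forall>''i''\<^bold>. \<^bold>\<forall>''x''\<^bold>. \<^bold>\<forall>''y''\<^bold>. pair i x \<^bold>\<in> ''T'' \<^bold>\<and> pair i y \<^bold>\<in> ''T'' \<^bold>\<longrightarrow> x \<^bold>= y) \<^bold>\<and>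
      (\<^bold>\<forall>''i''\<^bold>. \<^bold>\<forall>''j''\<^bold>. \<^bold>\<forall>''x''\<^bold>. pair i x \<^bold>\<in> ''T'' \<^bold>\<and> pair j x \<^bold>\<in> ''T'' \<^bold>\<longrightarrow> i \<^bold>= j) \<^bold>\<and>
      (\<^bold>\<forall>''x''\<^bold>. x \<^bold>\<in> ''V'' \<^bold>\<longrightarrow> (\<^bold>\<exists>''i''\<^bold>. pair i x \<^bold>\<in> ''T'')) \<^bold>\<and>
      (\<^bold>\<forall>''i''\<^bold>. \<^bold>\<forall>''x''\<^bold>. \<^bold>\<forall>''y''\<^bold>. pair i x \<^bold>\<in> ''T'' \<^bold>\<and> pair (i \<^bold>+ \<^bold>1) y \<^bold>\<in> ''T'' \<^bold>\<longrightarrow> pair x y \<^bold>\<in> ''E''))"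

text \<open>
  A finite sequence of length \<open>n\<close> is a finite set \<open>P\<close> of pairs that is a function with domain
  \<open>{i. i < n}\<close>. The term \<open>n\<close> must not contain the variables bound here.
\<close>

definition path_fm :: "tm \<Rightarrow> fm" where
  "path_fm n =
    (let i = Var ''i''; j = Var ''j''; k = Var ''k''; x = Var ''x''; y = Var ''y''; z = Var ''z'' in
     (\<^bold>\<exists>''k''\<^bold>. \<^bold>\<forall>''z''\<^bold>. z \<^bold>\<in> ''P'' \<^bold>\<longrightarrow> z \<^bold>< k) \<^bold>\<and>
     (\<^bold>\<forall>''z''\<^bold>. z \<^bold>\<in> ''P'' \<^bold>\<longrightarrow> (\<^bold>\<exists>''i''\<^bold>. \<^bold>\<exists>''x''\<^bold>. z \<^bold>= pair i x \<^bold>\<and> x \<^bold>\<in> ''V'')) \<^bold>\<and>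
     (\<^bold>\<forall>''i''\<^bold>. \<^bold>\<forall>''x''\<^bold>. \<^bold>\<forall>''y''\<^bold>. pair i x \<^bold>\<in> ''P'' \<^bold>\<and> pair i y \<^bold>\<in> ''P'' \<^bold>\<longrightarrow> x \<^bold>= y) \<^bold>\<and>
     (\<^bold>\<forall>''i''\<^bold>. i \<^bold>< n \<^bold>\<longleftrightarrow> (\<^bold>\<exists>''x''\<^bold>. pair i x \<^bold>\<in> ''P'')) \<^bold>\<and>
     (\<^bold>\<forall>''i''\<^bold>. \<^bold>\<forall>''j''\<^bold>. \<^bold>\<forall>''x''\<^bold>. pair i x \<^bold>\<in> ''P'' \<^bold>\<and> pair j x \<^bold>\<in> ''P'' \<^bold>\<longrightarrow> i \<^bold>= j) \<^bold>\<and>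
     (\<^bold>\<forall>''i''\<^bold>. \<^bold>\<forall>''x''\<^bold>. \<^bold>\<forall>''y''\<^bold>. pair i x \<^bold>\<in> ''P'' \<^bold>\<and> pair (i \<^bold>+ \<^bold>1) y \<^bold>\<in> ''P'' \<^bold>\<longrightarrow> pair x y \<^bold>\<in> ''E''))"

definition chordless_fm :: fm where
  "chordless_fm =
    (let i = Var ''i''; j = Var ''j''; x = Var ''x''; y = Var ''y'' in
     \<^bold>\<forall>''i''\<^bold>. \<^bold>\<forall>''j''\<^bold>. \<^bold>\<forall>''x''\<^bold>. \<^bold>\<forall>''y''\<^bold>. pair i x \<^bold>\<in> ''P'' \<^bold>\<and> pair j y \<^bold>\<in> ''P'' \<^bold>\<longrightarrow>
      (pair x y \<^bold>\<in> ''E'' \<^bold>\<longleftrightarrow> i \<^bold>= j \<^bold>+ \<^bold>1 \<^bold>\<or> j \<^bold>= i \<^bold>+ \<^bold>1))"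

definition has_chordless_path_fm :: "tm \<Rightarrow> fm" where
  "has_chordless_path_fm n = (\<^bold>\<exists>\<^sub>S''P''\<^bold>. path_fm n \<^bold>\<and> chordless_fm)"

text \<open>
  The graphs \<open>A\<close> and \<open>K\<^sub>\<omega>\<^sub>,\<^sub>\<omega>\<close>, with vertex set \<open>W\<close> and edge relation \<open>F\<close>: the vertex \<open>a\<^sub>n\<close> is
  the number \<open>2n\<close> and \<open>b\<^sub>n\<close> is \<open>2n + 1\<close>.
\<close>

definition is_A_fm :: fm where
  "is_A_fm =
    (let n = Var ''n''; m = Var ''m''; z = Var ''z''; a = n \<^bold>+ n; b = m \<^bold>+ m \<^bold>+ \<^bold>1 in
     (\<^bold>\<forall>''z''\<^bold>. z \<^bold>\<in> ''W'') \<^bold>\<and>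
     (\<^bold>\<forall>''z''\<^bold>. z \<^bold>\<in> ''F'' \<^bold>\<longleftrightarrow>
       (\<^bold>\<exists>''n''\<^bold>. \<^bold>\<exists>''m''\<^bold>. (n \<^bold>< m \<^bold>\<or> n \<^bold>= m) \<^bold>\<and> (z \<^bold>= pair a b \<^bold>\<or> z \<^bold>= pair b a))))"

definition is_K_fm :: fm where
  "is_K_fm =
    (let n = Var ''n''; m = Var ''m''; z = Var ''z''; a = n \<^bold>+ n; b = m \<^bold>+ m \<^bold>+ \<^bold>1 in
     (\<^bold>\<forall>''z''\<^bold>. z \<^bold>\<in> ''W'') \<^bold>\<and>
     (\<^bold>\<forall>''z''\<^bold>. z \<^bold>\<in> ''F'' \<^bold>\<longleftrightarrow> (\<^bold>\<exists>''n''\<^bold>. \<^bold>\<exists>''m''\<^bold>. z \<^bold>= pair a b \<^bold>\<or> z \<^bold>= pair b a)))"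

text \<open>The graph \<open>(V, E)\<close> contains a subgraph isomorphic to \<open>(W, F)\<close>.\<close>

definition subgraph_fm :: fm where
  "subgraph_fm =
    (let x = Var ''x''; y = Var ''y''; z = Var ''z''; u = Var ''u''; v = Var ''v'' in
     \<^bold>\<exists>\<^sub>S''G''\<^bold>.
      (\<^bold>\<forall>''z''\<^bold>. z \<^bold>\<in> ''G'' \<^bold>\<longrightarrow> (\<^bold>\<exists>''x''\<^bold>. \<^bold>\<exists>''u''\<^bold>. z \<^bold>= pair x u \<^bold>\<and> x \<^bold>\<in> ''W'' \<^bold>\<and> u \<^bold>\<in> ''V'')) \<^bold>\<and>
      (\<^bold>\<forall>''x''\<^bold>. x \<^bold>\<in> ''W'' \<^bold>\<longrightarrow> (\<^bold>\<exists>''u''\<^bold>. pair x u \<^bold>\<in> ''G'')) \<^bold>\<and>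
      (\<^bold>\<forall>''x''\<^bold>. \<^bold>\<forall>''u''\<^bold>. \<^bold>\<forall>''v''\<^bold>. pair x u \<^bold>\<in> ''G'' \<^bold>\<and> pair x v \<^bold>\<in> ''G'' \<^bold>\<longrightarrow> u \<^bold>= v) \<^bold>\<and>
      (\<^bold>\<forall>''x''\<^bold>. \<^bold>\<forall>''y''\<^bold>. \<^bold>\<forall>''u''\<^bold>. pair x u \<^bold>\<in> ''G'' \<^bold>\<and> pair y u \<^bold>\<in> ''G'' \<^bold>\<longrightarrow> x \<^bold>= y) \<^bold>\<and>
      (\<^bold>\<forall>''x''\<^bold>. \<^bold>\<forall>''y''\<^bold>. \<^bold>\<forall>''u''\<^bold>. \<^bold>\<forall>''v''\<^bold>. pair x y \<^bold>\<in> ''F'' \<^bold>\<and> pair x u \<^bold>\<in> ''G'' \<^bold>\<and> pair y v \<^bold>\<in> ''G''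
        \<^bold>\<longrightarrow> pair u v \<^bold>\<in> ''E''))"

definition contains_A_fm :: fm where
  "contains_A_fm = (\<^bold>\<exists>\<^sub>S''W''\<^bold>. \<^bold>\<exists>\<^sub>S''F''\<^bold>. is_A_fm \<^bold>\<and> subgraph_fm)"

definition contains_K_fm :: fm where
  "contains_K_fm = (\<^bold>\<exists>\<^sub>S''W''\<^bold>. \<^bold>\<exists>\<^sub>S''F''\<^bold>. is_K_fm \<^bold>\<and> subgraph_fm)"

definition long_paths_or_A :: fm where
  "long_paths_or_A =
    (\<^bold>\<forall>\<^sub>S''V''\<^bold>. \<^bold>\<forall>\<^sub>S''E''\<^bold>. graph_fm \<^bold>\<and> infinite_fm \<^bold>\<and> traceable_fm \<^bold>\<longrightarrow>
      (\<^bold>\<forall>''n''\<^bold>. has_chordless_path_fm (Var ''n'')) \<^bold>\<or> contains_A_fm)"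

definition no_4_path_implies_K :: fm where
  "no_4_path_implies_K =
    (\<^bold>\<forall>\<^sub>S''V''\<^bold>. \<^bold>\<forall>\<^sub>S''E''\<^bold>. graph_fm \<^bold>\<and> infinite_fm \<^bold>\<and> traceable_fm \<^bold>\<and>
      \<^bold>\<not> has_chordless_path_fm (\<^bold>1 \<^bold>+ \<^bold>1 \<^bold>+ \<^bold>1 \<^bold>+ \<^bold>1) \<^bold>\<longrightarrow> contains_K_fm)"

end

theory Submission
  imports Defs "HOL-Library.Countable"
begin

text \<open>
  All arguments take place inside an arbitrary, possibly nonstandard, model \<open>M\<close>. Definability is
  handled semantically: \<open>D0\<close> is the class of relations on \<open>M\<close> with a bounded definition, and once
  projections of sets in \<open>M\<close> are in \<open>M\<close>, this class is closed under unbounded quantifiers as well.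

  From the graph statements to arithmetical comprehension: to project \<open>Z\<close>, enumerate the projection
  and join two stages when the least value enumerated between them occurs at one of the two. This is
  the comparability graph of a tree order, hence without chordless 4-paths, and consecutive stages
  are adjacent. In a copy of \<open>A\<close> every \<open>a\<^sub>n\<close> has infinitely many neighbours, so it is a true stage,
  and true stages compute the projection.

  Conversely, let no chordless path have \<open>n\<close> vertices and number the vertices along the trace. Any
  interval contains a path with fewer than \<open>n\<close> edges between its end points \<open>x\<close> and \<open>y\<close>, say with
  vertices \<open>q x y b\<close>. Along a suitable cohesive set let \<open>x\<close> and then \<open>y\<close> tend to infinity. If for
  some \<open>b\<close> infinitely many vertices are in the limit adjacent to \<open>q x y b\<close>, finitely many of them
  always have a common neighbour, and \<open>A\<close> embeds. Otherwise one can string together paths such that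
  only consecutive ones are joined by edges; a shortest path through their union is chordless and
  too long. Finally a copy of \<open>A\<close>, thinned by the same limits, either contains \<open>K\<^sub>\<omega>\<^sub>,\<^sub>\<omega>\<close> or the
  chordless path \<open>a\<^sub>l, b\<^sub>l, a\<^sub>k, b\<^sub>k\<close> with \<open>k < l\<close>.
\<close>

text \<open>Induction in the model reaches only definable predicates, and a length such as
  \<open>n\<close> may be nonstandard. Counting is therefore replaced by definable induction,
  collection and least elements, and finite sequences and paths have to be coded by numbers. One
  graph serves both reversals: having no chordless 4-path, it refutes the first alternative of (1)
  at length four, and since \<open>A\<close> is a subgraph of the complete bipartite graph, only the
  edges of \<open>A\<close> have to be exploited. Giving idle stages their own number as value makes
  the values tend to infinity; hence a stage with infinitely many neighbours dominates the late ones
  instead of being dominated by them. In the converse, whether \<open>v\<close> is adjacent to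
  \<open>q x y b\<close> may change forever as the end points grow. Cohesive sets make all these
  limits exist at once. A link has two end points, so two successive limits occur: an old vertex is
  excluded from a new link partly when the left end is chosen and partly when the right end is. This
  is why only links that do not follow each other directly are kept apart.\<close>

section \<open>Renaming and substitution of variables in formulas\<close>

primrec tm_ren :: "(string \<Rightarrow> string) \<Rightarrow> tm \<Rightarrow> tm" where
  "tm_ren f (Var x) = Var (f x)"
| "tm_ren f \<^bold>0 = \<^bold>0"
| "tm_ren f \<^bold>1 = \<^bold>1"
| "tm_ren f (s \<^bold>+ t) = tm_ren f s \<^bold>+ tm_ren f t"
| "tm_ren f (s \<^bold>* t) = tm_ren f s \<^bold>* tm_ren f t"

text \<open>Bound variables are renamed along with the free ones, so an injective renaming cannot
  cause capture and satisfaction is transported by precomposing the assignments.\<close>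

primrec fm_ren :: "(string \<Rightarrow> string) \<Rightarrow> (string \<Rightarrow> string) \<Rightarrow> fm \<Rightarrow> fm" where
  "fm_ren f g (s \<^bold>= t) = (tm_ren f s \<^bold>= tm_ren f t)"
| "fm_ren f g (s \<^bold>< t) = (tm_ren f s \<^bold>< tm_ren f t)"
| "fm_ren f g (t \<^bold>\<in> X) = (tm_ren f t \<^bold>\<in> g X)"
| "fm_ren f g (\<^bold>\<not> p) = (\<^bold>\<not> fm_ren f g p)"
| "fm_ren f g (p \<^bold>\<and> q) = (fm_ren f g p \<^bold>\<and> fm_ren f g q)"
| "fm_ren f g (p \<^bold>\<or> q) = (fm_ren f g p \<^bold>\<or> fm_ren f g q)"
| "fm_ren f g (p \<^bold>\<longrightarrow> q) = (fm_ren f g p \<^bold>\<longrightarrow> fm_ren f g q)"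
| "fm_ren f g (p \<^bold>\<longleftrightarrow> q) = (fm_ren f g p \<^bold>\<longleftrightarrow> fm_ren f g q)"
| "fm_ren f g (\<^bold>\<forall>x\<^bold>. p) = All (f x) (fm_ren f g p)"
| "fm_ren f g (\<^bold>\<exists>x\<^bold>. p) = Ex (f x) (fm_ren f g p)"
| "fm_ren f g (\<^bold>\<forall>\<^sub>SX\<^bold>. p) = AllSet (g X) (fm_ren f g p)"
| "fm_ren f g (\<^bold>\<exists>\<^sub>SX\<^bold>. p) = ExSet (g X) (fm_ren f g p)"

lemma fun_upd_comp_inj: "inj f \<Longrightarrow> (e(f x := a)) \<circ> f = (e \<circ> f)(x := a)"
  by (auto simp: fun_eq_iff inj_eq)

lemma tm_val_ren: "tm_val M e (tm_ren f t) = tm_val M (e \<circ> f) t"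
  by (induction t) auto

lemma tm_vars_ren: "tm_vars (tm_ren f t) = f ` tm_vars t"
  by (induction t) auto

lemma sat_ren:
  "inj f \<Longrightarrow> inj g \<Longrightarrow> sat M e s (fm_ren f g p) = sat M (e \<circ> f) (s \<circ> g) p"
  by (induction p arbitrary: e s) (simp_all add: tm_val_ren fun_upd_comp_inj)

lemma Sigma00_ren: "Sigma00 p \<Longrightarrow> inj f \<Longrightarrow> Sigma00 (fm_ren f g p)"
  by (induction rule: Sigma00.induct) (auto intro!: Sigma00.intros simp: tm_vars_ren inj_image_mem_iff)

lemma tm_val_fun_upd: "x \<notin> tm_vars t \<Longrightarrow> tm_val M (e(x := a)) t = tm_val M e t"
  by (induction t) auto

lemma tm_val_subst: "tm_val M e (tm_subst x t r) = tm_val M (e(x := tm_val M e t)) r"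
  by (induction r) auto

lemma sat_subst:
  "tm_vars t \<subseteq> {x} \<Longrightarrow> sat M e s (fm_subst x t p) = sat M (e(x := tm_val M e t)) s p"
proof (induction p arbitrary: e s)
  case (All y p)
  show ?case
  proof (cases "y = x")
    case False
    then have "tm_val M (e(y := a)) t = tm_val M e t" for a
      using All.prems by (intro tm_val_fun_upd) auto
    with All False show ?thesis
      by (simp only: fm_subst.simps sat.simps if_False fun_upd_twist[OF False[symmetric]])
  qed (simp only: fm_subst.simps sat.simps if_True fun_upd_upd simp_thms)
next
  case (Ex y p)
  show ?case
  proof (cases "y = x")
    case False
    then have "tm_val M (e(y := a)) t = tm_val M e t" for a
      using Ex.prems by (intro tm_val_fun_upd) auto
    with Ex False show ?thesis
      by (simp only: fm_subst.simps sat.simps if_False fun_upd_twist[OF False[symmetric]])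
  qed (simp only: fm_subst.simps sat.simps if_True fun_upd_upd simp_thms)
qed (simp_all add: tm_val_subst)

lemma sat_set_fun_upd:
  "X \<notin> free_set_vars p \<Longrightarrow> sat M e (s(X := A)) p = sat M e s p"
proof (induction p arbitrary: e s)
  case (AllSet Y p)
  show ?case
  proof (cases "Y = X")
    case False
    with AllSet.prems have "X \<notin> free_set_vars p" by simp
    then have "sat M e (s(X := A, Y := B)) p = sat M e (s(Y := B)) p" for B
      by (subst fun_upd_twist[OF False[symmetric]]) (rule AllSet.IH)
    then show ?thesis by (simp only: sat.simps)
  qed (simp only: sat.simps fun_upd_upd)
next
  case (ExSet Y p)
  show ?case
  proof (cases "Y = X")
    case False
    with ExSet.prems have "X \<notin> free_set_vars p" by simp
    then have "sat M e (s(X := A, Y := B)) p = sat M e (s(Y := B)) p" for B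
      by (subst fun_upd_twist[OF False[symmetric]]) (rule ExSet.IH)
    then show ?thesis by (simp only: sat.simps)
  qed (simp only: sat.simps fun_upd_upd)
qed auto

lemma finite_free_set_vars: "finite (free_set_vars p)"
  by (induction p) auto

section \<open>Variable names for arguments and for parameters\<close>

definition vn :: "nat \<Rightarrow> string" where
  "vn i = CHR ''v'' # replicate i CHR ''x''"

lemma vn_inject [simp]: "vn i = vn j \<longleftrightarrow> i = j"
  by (metis vn_def length_replicate list.inject)

lemma Cons_eq_vn [simp]: "h \<noteq> CHR ''v'' \<Longrightarrow> h # x \<noteq> vn i" "h \<noteq> CHR ''v'' \<Longrightarrow> vn i \<noteq> h # x"
  by (auto simp: vn_def)

lemma Cons_notin_vn [simp]: "h \<noteq> CHR ''v'' \<Longrightarrow> h # x \<notin> range vn"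
  by auto

text \<open>Names in the range of \<open>vn\<close> are reserved for arguments, all others may carry
  parameters. Prefixing with different letters makes the parameters of two formulas disjoint while
  their arguments stay shared.\<close>

definition pre :: "char \<Rightarrow> string \<Rightarrow> string" where
  "pre h x = (if x \<in> range vn then x else h # x)"

lemma pre_vn [simp]: "pre h (vn i) = vn i"
  by (simp add: pre_def)

lemma inj_pre: "h \<noteq> CHR ''v'' \<Longrightarrow> inj (pre h)"
  by (auto simp: inj_def pre_def)

text \<open>Under a bounded quantifier the variable \<open>0\<close> becomes the bound one, and the others shift down.\<close>

definition preb :: "string \<Rightarrow> string" where
  "preb x = (if x = vn 0 then ''b'' else if x \<in> range vn then vn (inv vn x - 1) else CHR ''a'' # x)"

lemma inv_vn [simp]: "inv vn (vn i) = i"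
  by (rule inv_f_f) (simp add: inj_def)

lemma preb_vn [simp]: "preb (vn 0) = ''b''" "preb (vn (Suc i)) = vn i"
  by (auto simp: preb_def)

lemma preb_other: "x \<notin> range vn \<Longrightarrow> preb x = CHR ''a'' # x"
  by (auto simp: preb_def)

lemma inj_preb: "inj preb"
proof (rule injI)
  fix x y assume *: "preb x = preb y"
  have cases: "x = vn 0 \<or> (\<exists>i. x = vn (Suc i)) \<or> x \<notin> range vn" for x
    by (metis old.nat.exhaust rangeE)
  have "''b'' \<noteq> vn i" "CHR ''a'' # u \<noteq> vn i" "''b'' \<noteq> CHR ''a'' # u" for i u
    by auto
  with * cases[of x] cases[of y] show "x = y"
    by (metis list.inject preb_other preb_vn vn_inject)
qed

section \<open>Bounded definability\<close>

locale rca =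
  fixes M :: "'a l2_structure"
  assumes rca: "M \<Turnstile>\<^sub>T RCA0"
begin

abbreviation zr (\<open>\<zero>\<close>) where "\<zero> \<equiv> zero_of M"
abbreviation un (\<open>\<one>\<close>) where "\<one> \<equiv> one_of M"
abbreviation pl (infixl \<open>\<oplus>\<close> 65) where "a \<oplus> b \<equiv> add_of M a b"
abbreviation ti (infixl \<open>\<otimes>\<close> 70) where "a \<otimes> b \<equiv> mul_of M a b"
abbreviation sc where "sc a \<equiv> a \<oplus> \<one>"
abbreviation ls (infix \<open>\<prec>\<close> 50) where "a \<prec> b \<equiv> less_of M a b"

inductive T0 :: "((nat \<Rightarrow> 'a) \<Rightarrow> 'a) \<Rightarrow> bool" where
  T0_var: "T0 (\<lambda>e. e i)"
| T0_const: "T0 (\<lambda>e. c)"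
| T0_add: "T0 t \<Longrightarrow> T0 u \<Longrightarrow> T0 (\<lambda>e. t e \<oplus> u e)"
| T0_mul: "T0 t \<Longrightarrow> T0 u \<Longrightarrow> T0 (\<lambda>e. t e \<otimes> u e)"

text \<open>
  The relations with a bounded definition, with number and set parameters. An argument list is a
  function on \<open>nat\<close> (de Bruijn indices), so that \<open>intro\<close> can prove definability: below a quantifier
  the bound variable is \<open>e 0\<close>, and the old \<open>e\<close> becomes \<open>\<lambda>i. e (Suc i)\<close>.
\<close>

inductive D0 :: "((nat \<Rightarrow> 'a) \<Rightarrow> bool) \<Rightarrow> bool" where
  D0_eq: "T0 t \<Longrightarrow> T0 u \<Longrightarrow> D0 (\<lambda>e. t e = u e)"
| D0_less: "T0 t \<Longrightarrow> T0 u \<Longrightarrow> D0 (\<lambda>e. t e \<prec> u e)"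
| D0_mem: "T0 t \<Longrightarrow> A \<in> Sets M \<Longrightarrow> D0 (\<lambda>e. t e \<in> A)"
| D0_not: "D0 P \<Longrightarrow> D0 (\<lambda>e. \<not> P e)"
| D0_conj: "D0 P \<Longrightarrow> D0 Q \<Longrightarrow> D0 (\<lambda>e. P e \<and> Q e)"
| D0_disj: "D0 P \<Longrightarrow> D0 Q \<Longrightarrow> D0 (\<lambda>e. P e \<or> Q e)"
| D0_imp: "D0 P \<Longrightarrow> D0 Q \<Longrightarrow> D0 (\<lambda>e. P e \<longrightarrow> Q e)"
| D0_iff: "D0 P \<Longrightarrow> D0 Q \<Longrightarrow> D0 (\<lambda>e. P e \<longleftrightarrow> Q e)"
| D0_ball: "T0 t \<Longrightarrow> D0 (\<lambda>e. Q (e 0) (\<lambda>i. e (Suc i))) \<Longrightarrow> D0 (\<lambda>e. \<forall>a. a \<prec> t e \<longrightarrow> Q a e)"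
| D0_bex: "T0 t \<Longrightarrow> D0 (\<lambda>e. Q (e 0) (\<lambda>i. e (Suc i))) \<Longrightarrow> D0 (\<lambda>e. \<exists>a. a \<prec> t e \<and> Q a e)"

abbreviation Df1 :: "('a \<Rightarrow> bool) \<Rightarrow> bool" where "Df1 P \<equiv> D0 (\<lambda>e. P (e 0))"
abbreviation Df2 :: "('a \<Rightarrow> 'a \<Rightarrow> bool) \<Rightarrow> bool" where "Df2 R \<equiv> D0 (\<lambda>e. R (e 0) (e 1))"

subsection \<open>Realisation by formulas\<close>

definition rzt :: "tm \<Rightarrow> (string \<Rightarrow> 'a) \<Rightarrow> ((nat \<Rightarrow> 'a) \<Rightarrow> 'a) \<Rightarrow> bool" where
  "rzt u c t \<longleftrightarrow> (\<forall>e. (\<forall>x. x \<notin> range vn \<longrightarrow> e x = c x) \<longrightarrow> tm_val M e u = t (\<lambda>i. e (vn i)))"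

text \<open>Number parameters are the values that \<open>c\<close> gives to the names outside
  \<open>range vn\<close>, set parameters are the values of \<open>s\<close>; the arguments of
  \<open>Q\<close> enter through the reserved names.\<close>

definition rz :: "fm \<Rightarrow> (string \<Rightarrow> 'a set) \<Rightarrow> (string \<Rightarrow> 'a) \<Rightarrow> ((nat \<Rightarrow> 'a) \<Rightarrow> bool) \<Rightarrow> bool" where
  "rz p s c Q \<longleftrightarrow> (\<forall>e. (\<forall>x. x \<notin> range vn \<longrightarrow> e x = c x) \<longrightarrow> sat M e s p = Q (\<lambda>i. e (vn i)))"

definition mrg :: "(string \<Rightarrow> 'b) \<Rightarrow> (string \<Rightarrow> 'b) \<Rightarrow> string \<Rightarrow> 'b" where
  "mrg c d x = (if hd x = CHR ''a'' then c (tl x) else d (tl x))"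

lemma rzt_ren:
  assumes "rzt u c t" "h \<noteq> CHR ''v''" "\<And>x. c' (h # x) = c x"
  shows "rzt (tm_ren (pre h) u) c' t"
  unfolding rzt_def
proof (intro allI impI)
  fix e :: "string \<Rightarrow> 'a" assume e: "\<forall>x. x \<notin> range vn \<longrightarrow> e x = c' x"
  have "(e \<circ> pre h) x = c x" if "x \<notin> range vn" for x
    using assms(2,3) e that by (simp add: pre_def)
  then show "tm_val M e (tm_ren (pre h) u) = t (\<lambda>i. e (vn i))"
    using assms(1) by (auto simp: rzt_def tm_val_ren)
qed

lemma rz_ren:
  assumes "rz p s c Q" "h \<noteq> CHR ''v''" "\<And>x. c' (h # x) = c x" "\<And>X. s' (h # X) = s X"
  shows "rz (fm_ren (pre h) (Cons h) p) s' c' Q"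
  unfolding rz_def
proof (intro allI impI)
  fix e :: "string \<Rightarrow> 'a" assume e: "\<forall>x. x \<notin> range vn \<longrightarrow> e x = c' x"
  have "(e \<circ> pre h) x = c x" if "x \<notin> range vn" for x
    using assms(2,3) e that by (simp add: pre_def)
  moreover have "s' \<circ> Cons h = s" using assms(4) by auto
  ultimately show "sat M e s' (fm_ren (pre h) (Cons h) p) = Q (\<lambda>i. e (vn i))"
    using assms(1,2) by (auto simp: rz_def sat_ren inj_pre)
qed

lemma rzt_merge:
  assumes "rzt u c t" "rzt u' c' t'"
  obtains v v' d where "rzt v d t" "rzt v' d t'"
proof
  show "rzt (tm_ren (pre CHR ''a'') u) (mrg c c') t"
    using assms(1) by (rule rzt_ren) (auto simp: mrg_def)
  show "rzt (tm_ren (pre CHR ''c'') u') (mrg c c') t'"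
    using assms(2) by (rule rzt_ren) (auto simp: mrg_def)
qed

lemma T0_realised: "T0 t \<Longrightarrow> \<exists>u c. rzt u c t"
proof (induction rule: T0.induct)
  case (T0_var i)
  have "rzt (Var (vn i)) (\<lambda>_. \<zero>) (\<lambda>e. e i)" by (simp add: rzt_def)
  then show ?case by blast
next
  case (T0_const a)
  have "''c'' \<notin> range vn" by auto
  then have "rzt (Var ''c'') (\<lambda>_. a) (\<lambda>e. a)" by (simp add: rzt_def)
  then show ?case by blast
next
  case (T0_add t t')
  obtain u c u' c' where "rzt u c t" "rzt u' c' t'" using T0_add.IH by auto
  then obtain u u' d where "rzt u d t" "rzt u' d t'" by (rule rzt_merge)
  then have "rzt (u \<^bold>+ u') d (\<lambda>e. t e \<oplus> t' e)" by (simp add: rzt_def)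
  then show ?case by blast
next
  case (T0_mul t t')
  obtain u c u' c' where "rzt u c t" "rzt u' c' t'" using T0_mul.IH by auto
  then obtain u u' d where "rzt u d t" "rzt u' d t'" by (rule rzt_merge)
  then have "rzt (u \<^bold>* u') d (\<lambda>e. t e \<otimes> t' e)" by (simp add: rzt_def)
  then show ?case by blast
qed

lemma T0_realised2:
  assumes "T0 t" "T0 t'"
  obtains u u' d where "rzt u d t" "rzt u' d t'"
proof -
  obtain u c u' c' where "rzt u c t" "rzt u' c' t'" using assms[THEN T0_realised] by auto
  then show thesis by (rule rzt_merge) (rule that)
qed

lemma rz_merge:
  assumes "Sigma00 p" "rz p s c Q" "range s \<subseteq> Sets M" "Sigma00 p'" "rz p' s' c' Q'" "range s' \<subseteq> Sets M"
  obtains q q' r d where "Sigma00 q" "rz q r d Q" "Sigma00 q'" "rz q' r d Q'" "range r \<subseteq> Sets M"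
proof
  show "rz (fm_ren (pre CHR ''a'') (Cons CHR ''a'') p) (mrg s s') (mrg c c') Q"
    using assms(2) by (rule rz_ren) (auto simp: mrg_def)
  show "rz (fm_ren (pre CHR ''c'') (Cons CHR ''c'') p') (mrg s s') (mrg c c') Q'"
    using assms(5) by (rule rz_ren) (auto simp: mrg_def)
  show "range (mrg s s') \<subseteq> Sets M" using assms(3,6) by (auto simp: mrg_def)
qed (use assms in \<open>auto intro!: Sigma00_ren inj_pre\<close>)

text \<open>\<open>Sigma00\<close> forbids the bound variable in the bounding term. So
  \<open>preb\<close> moves index 0 to the name \<open>b\<close>, and the names in the bound are
  prefixed by \<open>c\<close>, hence different from \<open>b\<close>.\<close>

lemma rz_bound:
  assumes "Sigma00 p" "rz p s c (\<lambda>e. Q (e 0) (\<lambda>i. e (Suc i)))" "rzt u d t" "range s \<subseteq> Sets M"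
  obtains q v r k where "Sigma00 q" "rzt v k t" "''b'' \<notin> tm_vars v" "range r \<subseteq> Sets M"
    "\<And>e a. (\<forall>x. x \<notin> range vn \<longrightarrow> e x = k x) \<Longrightarrow> sat M (e(''b'' := a)) r q = Q a (\<lambda>i. e (vn i))"
proof
  define k where "k = mrg c d"
  define r where "r = mrg s s"
  define q where "q = fm_ren preb (Cons CHR ''a'') p"
  define v where "v = tm_ren (pre CHR ''c'') u"
  show "Sigma00 q" unfolding q_def using assms(1) by (auto intro!: Sigma00_ren inj_preb)
  show "rzt v k t" unfolding v_def k_def
    using assms(3) by (rule rzt_ren) (auto simp: mrg_def)
  show "''b'' \<notin> tm_vars v" by (auto simp: v_def tm_vars_ren pre_def)
  show "range r \<subseteq> Sets M" using assms(4) by (auto simp: r_def mrg_def)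
  fix e :: "string \<Rightarrow> 'a" and a assume e: "\<forall>x. x \<notin> range vn \<longrightarrow> e x = k x"
  have rs: "r \<circ> Cons CHR ''a'' = s" by (auto simp: r_def mrg_def)
  have "(e(''b'' := a) \<circ> preb) x = c x" if "x \<notin> range vn" for x
    using e that by (simp add: preb_other k_def mrg_def)
  moreover have "sat M (e(''b'' := a)) r q = sat M (e(''b'' := a) \<circ> preb) s p"
    unfolding q_def by (subst sat_ren) (simp_all add: inj_preb rs)
  ultimately show "sat M (e(''b'' := a)) r q = Q a (\<lambda>i. e (vn i))"
    using assms(2) by (simp add: rz_def)
qed

lemma Sets_nonempty: "Sets M \<noteq> {}"
  using rca by (simp add: model_of_def)

definition realised :: "((nat \<Rightarrow> 'a) \<Rightarrow> bool) \<Rightarrow> bool" where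
  "realised Q \<longleftrightarrow> (\<exists>p s c. Sigma00 p \<and> range s \<subseteq> Sets M \<and> rz p s c Q)"

lemma realisedI: "Sigma00 p \<and> range s \<subseteq> Sets M \<and> rz p s c Q \<Longrightarrow> realised Q"
  by (auto simp: realised_def)

lemma realised_merge:
  assumes "realised P" "realised Q"
  obtains p q s c where "Sigma00 p" "rz p s c P" "Sigma00 q" "rz q s c Q" "range s \<subseteq> Sets M"
proof -
  obtain p s c where p: "Sigma00 p" "rz p s c P" "range s \<subseteq> Sets M"
    using assms(1) by (auto simp: realised_def)
  obtain p' s' c' where p': "Sigma00 p'" "rz p' s' c' Q" "range s' \<subseteq> Sets M"
    using assms(2) by (auto simp: realised_def)
  show thesis by (rule rz_merge[OF p p']) (rule that)
qed

lemma realised_connective: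
  assumes "realised P" "realised Q"
    and F: "\<And>p q. Sigma00 p \<Longrightarrow> Sigma00 q \<Longrightarrow> Sigma00 (F p q)"
    "\<And>e s p q. sat M e s (F p q) = f (sat M e s p) (sat M e s q)"
  shows "realised (\<lambda>e. f (P e) (Q e))"
proof -
  obtain p q s c where "Sigma00 p" "rz p s c P" "Sigma00 q" "rz q s c Q" "range s \<subseteq> Sets M"
    using assms(1,2) by (rule realised_merge)
  then have "Sigma00 (F p q) \<and> range s \<subseteq> Sets M \<and> rz (F p q) s c (\<lambda>e. f (P e) (Q e))"
    by (simp add: rz_def F)
  then show ?thesis by (rule realisedI)
qed

lemma realised_atom:
  assumes "T0 t" "T0 t'" and F: "\<And>u u'. Sigma00 (F u u')"
    "\<And>e s u u'. sat M e s (F u u') = f (tm_val M e u) (tm_val M e u')"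
  shows "realised (\<lambda>e. f (t e) (t' e))"
proof -
  obtain S where "S \<in> Sets M" using Sets_nonempty by auto
  moreover obtain u u' d where "rzt u d t" "rzt u' d t'" using T0_realised2[OF assms(1,2)] .
  ultimately have "Sigma00 (F u u') \<and> range (\<lambda>_. S) \<subseteq> Sets M \<and> rz (F u u') (\<lambda>_. S) d (\<lambda>e. f (t e) (t' e))"
    by (auto simp: rz_def rzt_def F)
  then show ?thesis by (rule realisedI)
qed

lemma D0_realised: "D0 Q \<Longrightarrow> realised Q"
proof (induction rule: D0.induct)
  case (D0_eq t t')
  then show ?case by (rule realised_atom[where F = Eq and f = "(=)"]) (simp_all add: Sigma00.intros)
next
  case (D0_less t t')
  then show ?case by (rule realised_atom[where F = Less and f = "less_of M"]) (simp_all add: Sigma00.intros)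
next
  case (D0_mem t S)
  obtain u d where "rzt u d t" using D0_mem T0_realised by meson
  then have "Sigma00 (u \<^bold>\<in> ''X'') \<and> range (\<lambda>_. S) \<subseteq> Sets M \<and> rz (u \<^bold>\<in> ''X'') (\<lambda>_. S) d (\<lambda>e. t e \<in> S)"
    using D0_mem(2) by (auto simp: rz_def rzt_def intro: Sigma00.intros)
  then show ?case by (rule realisedI)
next
  case (D0_not P)
  then obtain p s c where "Sigma00 p" "range s \<subseteq> Sets M" "rz p s c P" by (auto simp: realised_def)
  then have "Sigma00 (\<^bold>\<not> p) \<and> range s \<subseteq> Sets M \<and> rz (\<^bold>\<not> p) s c (\<lambda>e. \<not> P e)"
    by (auto simp: rz_def intro: Sigma00.intros)
  then show ?case by (rule realisedI)
next
  case (D0_conj P Q)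
  show ?case
    by (rule realised_connective[OF D0_conj.IH, where F = Conj and f = "(\<and>)"]) (simp_all add: Sigma00.intros)
next
  case (D0_disj P Q)
  show ?case
    by (rule realised_connective[OF D0_disj.IH, where F = Disj and f = "(\<or>)"]) (simp_all add: Sigma00.intros)
next
  case (D0_imp P Q)
  show ?case
    by (rule realised_connective[OF D0_imp.IH, where F = Imp and f = "(\<longrightarrow>)"]) (simp_all add: Sigma00.intros)
next
  case (D0_iff P Q)
  show ?case
    by (rule realised_connective[OF D0_iff.IH, where F = Iff and f = "(\<longleftrightarrow>)"]) (simp_all add: Sigma00.intros)
next
  case (D0_ball t Q)
  obtain p s c where p: "Sigma00 p" "range s \<subseteq> Sets M" "rz p s c (\<lambda>e. Q (e 0) (\<lambda>i. e (Suc i)))"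
    using D0_ball.IH by (auto simp: realised_def)
  obtain u d where u: "rzt u d t" using D0_ball.hyps T0_realised by blast
  obtain q v r k where q: "Sigma00 q" "rzt v k t" "''b'' \<notin> tm_vars v" "range r \<subseteq> Sets M"
    "\<And>e a. (\<forall>x. x \<notin> range vn \<longrightarrow> e x = k x) \<Longrightarrow> sat M (e(''b'' := a)) r q = Q a (\<lambda>i. e (vn i))"
    by (rule rz_bound[OF p(1,3) u p(2)]) (rule that)
  from q(2,3,5) have "rz (\<^bold>\<forall>''b''\<^bold>. Var ''b'' \<^bold>< v \<^bold>\<longrightarrow> q) r k (\<lambda>e. \<forall>a. a \<prec> t e \<longrightarrow> Q a e)"
    by (auto simp: rz_def rzt_def tm_val_fun_upd)
  moreover have "Sigma00 (\<^bold>\<forall>''b''\<^bold>. Var ''b'' \<^bold>< v \<^bold>\<longrightarrow> q)"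
    using q(1,3) by (rule Sigma00.intros)
  ultimately show ?case using q(4) by (simp add: realisedI)
next
  case (D0_bex t Q)
  obtain p s c where p: "Sigma00 p" "range s \<subseteq> Sets M" "rz p s c (\<lambda>e. Q (e 0) (\<lambda>i. e (Suc i)))"
    using D0_bex.IH by (auto simp: realised_def)
  obtain u d where u: "rzt u d t" using D0_bex.hyps T0_realised by blast
  obtain q v r k where q: "Sigma00 q" "rzt v k t" "''b'' \<notin> tm_vars v" "range r \<subseteq> Sets M"
    "\<And>e a. (\<forall>x. x \<notin> range vn \<longrightarrow> e x = k x) \<Longrightarrow> sat M (e(''b'' := a)) r q = Q a (\<lambda>i. e (vn i))"
    by (rule rz_bound[OF p(1,3) u p(2)]) (rule that)
  from q(2,3,5) have "rz (\<^bold>\<exists>''b''\<^bold>. Var ''b'' \<^bold>< v \<^bold>\<and> q) r k (\<lambda>e. \<exists>a. a \<prec> t e \<and> Q a e)"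
    by (auto simp: rz_def rzt_def tm_val_fun_upd)
  moreover have "Sigma00 (\<^bold>\<exists>''b''\<^bold>. Var ''b'' \<^bold>< v \<^bold>\<and> q)"
    using q(1,3) by (rule Sigma00.intros)
  ultimately show ?case using q(4) by (simp add: realisedI)
qed

subsection \<open>Induction and comprehension\<close>

lemma axiom: "p \<in> RCA0 \<Longrightarrow> range s \<subseteq> Sets M \<Longrightarrow> sat M e s p"
  using rca by (auto simp: model_of_def holds_def)

definition env :: "(string \<Rightarrow> 'a) \<Rightarrow> 'a \<Rightarrow> 'a \<Rightarrow> string \<Rightarrow> 'a" where
  "env c a b x = (if x = vn 0 then a else if x = vn 1 then b else c x)"

lemma env_upd [simp]: "(env c a b)(vn 0 := a') = env c a' b" "(env c a b)(vn 1 := b') = env c a b'"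
  by (auto simp: env_def fun_eq_iff)

lemma env_vn [simp]: "env c a b (vn 0) = a" "env c a b (vn 1) = b" "x \<notin> range vn \<Longrightarrow> env c a b x = c x"
  by (auto simp: env_def)

lemma Sigma1_induct:
  assumes D: "Df2 R"
    and z: "\<exists>y. R \<zero> y" and step: "\<And>n. \<exists>y. R n y \<Longrightarrow> \<exists>y. R (sc n) y"
  shows "\<exists>y. R n y"
proof -
  obtain p s c where p: "Sigma00 p" "range s \<subseteq> Sets M" "rz p s c (\<lambda>e. R (e 0) (e 1))"
    using D0_realised[OF D] by (auto simp: realised_def)
  let ?q = "Ex (vn 1) p"
  have sat: "sat M (env c a b) s p = R a b" for a b
    using p(3) by (simp add: rz_def del: One_nat_def)
  have "(fm_subst (vn 0) \<^bold>0 ?q \<^bold>\<and> All (vn 0) (?q \<^bold>\<longrightarrow> fm_subst (vn 0) (Var (vn 0) \<^bold>+ \<^bold>1) ?q) \<^bold>\<longrightarrow> All (vn 0) ?q) \<in> RCA0"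
    using p(1) unfolding RCA0_def Sigma01_induction_def Sigma01_def by blast
  from axiom[OF this p(2), of "env c \<zero> \<zero>"] show ?thesis
    using z step by (simp add: sat_subst sat del: fm_subst.simps One_nat_def)
qed

lemma Delta1_comprehension:
  assumes D: "Df2 R" "Df2 R'"
    and eq: "\<And>x. (\<exists>y. R x y) \<longleftrightarrow> (\<forall>y. R' x y)"
  shows "{x. \<exists>y. R x y} \<in> Sets M"
proof -
  obtain p p' s c where p: "Sigma00 p" "rz p s c (\<lambda>e. R (e 0) (e 1))"
    "Sigma00 p'" "rz p' s c (\<lambda>e. R' (e 0) (e 1))" and s: "range s \<subseteq> Sets M"
    by (rule realised_merge[OF D[THEN D0_realised]])
  obtain X where X: "X \<notin> free_set_vars p"
    by (meson ex_new_if_finite finite_free_set_vars infinite_UNIV_listI)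
  let ?q = "Ex (vn 1) p" and ?q' = "All (vn 1) p'"
  have sat: "sat M (env c a b) s p = R a b" "sat M (env c a b) s p' = R' a b" for a b
    using p by (simp_all add: rz_def del: One_nat_def)
  have "(All (vn 0) (?q \<^bold>\<longleftrightarrow> ?q') \<^bold>\<longrightarrow> ExSet X (All (vn 0) (Var (vn 0) \<^bold>\<in> X \<^bold>\<longleftrightarrow> ?q))) \<in> RCA0"
    using p(1,3) X unfolding RCA0_def Delta01_comprehension_def Sigma01_def Pi01_def by fastforce
  from axiom[OF this s, of "env c \<zero> \<zero>"] obtain A where "A \<in> Sets M" "\<forall>x. x \<in> A \<longleftrightarrow> (\<exists>y. R x y)"
    using eq X by (auto simp: sat sat_set_fun_upd simp del: One_nat_def)
  moreover then have "{x. \<exists>y. R x y} = A" by auto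
  ultimately show ?thesis by simp
qed

end

section \<open>Arithmetic\<close>

context rca
begin

lemmas D0_intros = T0_var T0_const T0_add T0_mul D0_eq D0_less D0_mem D0_not D0_conj D0_disj D0_imp
  D0_iff D0_ball D0_bex

lemma D0_induct:
  assumes "Df1 P" "P \<zero>" "\<And>n. P n \<Longrightarrow> P (sc n)"
  shows "P n"
  using Sigma1_induct[of "\<lambda>n y. P n" n] assms by blast

lemma basic_axioms_sat: "\<forall>p\<in>basic_axioms. sat M ((\<lambda>_. m)(''n'' := n)) (\<lambda>_. SOME S. S \<in> Sets M) p"
  using Sets_nonempty by (intro ballI axiom) (auto simp: RCA0_def some_in_eq)

lemma basic:
  "sc n \<noteq> \<zero>" "sc m = sc n \<longleftrightarrow> m = n" "m \<oplus> \<zero> = m" "m \<oplus> sc n = sc (m \<oplus> n)"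
  "m \<otimes> \<zero> = \<zero>" "m \<otimes> sc n = m \<otimes> n \<oplus> m" "\<not> m \<prec> \<zero>" "m \<prec> sc n \<longleftrightarrow> m \<prec> n \<or> m = n"
  using basic_axioms_sat[of m n, unfolded basic_axioms_def Let_def, simplified] by blast+

lemma add_0_left': "\<zero> \<oplus> n = n"
  by (induct n rule: D0_induct) (intro D0_intros, simp_all add: basic)

lemma add_1_left': "sc m \<oplus> n = sc (m \<oplus> n)"
  by (induct n rule: D0_induct) (intro D0_intros, simp_all add: basic)

lemma add_commute': "m \<oplus> n = n \<oplus> m"
  by (induct n rule: D0_induct) (intro D0_intros, simp_all add: basic add_0_left' add_1_left')

lemma add_assoc': "(k \<oplus> m) \<oplus> n = k \<oplus> (m \<oplus> n)"
  by (induct n rule: D0_induct) (intro D0_intros, simp_all add: basic)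

lemma mult_0_left': "\<zero> \<otimes> n = \<zero>"
  by (induct n rule: D0_induct) (intro D0_intros, simp_all add: basic)

lemma mult_one_right': "n \<otimes> \<one> = n"
  using basic(6)[of n \<zero>] by (simp add: add_0_left' basic(5))

lemma mult_1_left': "sc m \<otimes> n = m \<otimes> n \<oplus> n"
proof (rule D0_induct[where P = "\<lambda>n. (sc m) \<otimes> n = m \<otimes> n \<oplus> n"])
  fix n assume "sc m \<otimes> n = m \<otimes> n \<oplus> n"
  then have "sc m \<otimes> sc n = sc ((m \<otimes> n \<oplus> n) \<oplus> m)" by (simp add: basic)
  also have "\<dots> = sc ((m \<otimes> n \<oplus> m) \<oplus> n)" by (metis add_assoc' add_commute')
  finally show "sc m \<otimes> sc n = m \<otimes> sc n \<oplus> sc n" by (simp add: basic)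
qed (intro D0_intros, simp_all add: basic)

lemma mult_commute': "m \<otimes> n = n \<otimes> m"
  by (induct n rule: D0_induct) (intro D0_intros, simp_all add: basic mult_0_left' mult_1_left')

lemma distrib_left': "k \<otimes> (m \<oplus> n) = k \<otimes> m \<oplus> k \<otimes> n"
  by (induct n rule: D0_induct) (intro D0_intros, simp_all add: basic add_assoc'[symmetric])

lemma mult_assoc': "(k \<otimes> m) \<otimes> n = k \<otimes> (m \<otimes> n)"
  by (induct n rule: D0_induct) (intro D0_intros, simp_all add: basic(3,5,6) distrib_left' mult_one_right')

lemma add_left_cancel': "k \<oplus> m = k \<oplus> n \<longleftrightarrow> m = n"
  by (induct k rule: D0_induct) (intro D0_intros, simp_all add: basic add_0_left' add_1_left')

text \<open>The axioms tie the order only to zero and successor; here it becomes the order of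
  addition. The forward direction is an induction on an existential statement, which
  \<open>Sigma1_induct\<close> allows without a bound on \<open>c\<close>.\<close>

lemma less_iff': "m \<prec> n \<longleftrightarrow> (\<exists>c. n = m \<oplus> sc c)"
proof
  have "\<exists>c. m \<prec> n \<longrightarrow> n = m \<oplus> sc c"
  proof (rule Sigma1_induct[where R = "\<lambda>n c. m \<prec> n \<longrightarrow> n = m \<oplus> sc c"])
    fix n assume "\<exists>c. m \<prec> n \<longrightarrow> n = m \<oplus> sc c"
    then obtain c where c: "m \<prec> n \<Longrightarrow> n = m \<oplus> sc c" by auto
    show "\<exists>c. m \<prec> sc n \<longrightarrow> sc n = m \<oplus> sc c"
    proof (cases "m \<prec> n")
      case True
      then have "sc n = m \<oplus> sc (sc c)" using c by (simp add: basic)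
      then show ?thesis by blast
    next
      case False
      then have "m \<prec> sc n \<longrightarrow> sc n = m \<oplus> sc \<zero>" by (auto simp: basic add_0_left')
      then show ?thesis by blast
    qed
  qed (intro D0_intros, simp add: basic)
  then show "m \<prec> n \<Longrightarrow> \<exists>c. n = m \<oplus> sc c" by blast
next
  have "m \<prec> m \<oplus> sc c" for c
    by (rule D0_induct[where P = "\<lambda>c. m \<prec> m \<oplus> sc c"])
       (intro D0_intros, simp_all add: basic add_0_left')
  then show "\<exists>c. n = m \<oplus> sc c \<Longrightarrow> m \<prec> n" by auto
qed

lemma less_irrefl': "\<not> n \<prec> n"
  by (metis less_iff' add_left_cancel' basic(1,3))

lemma less_trans': "k \<prec> m \<Longrightarrow> m \<prec> n \<Longrightarrow> k \<prec> n"
  by (metis less_iff' add_assoc' basic(4))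

lemma zero_less': "n = \<zero> \<or> \<zero> \<prec> n"
  by (rule D0_induct[where P = "\<lambda>n. n = \<zero> \<or> \<zero> \<prec> n"]) (intro D0_intros, auto simp: basic)

lemma less_linear': "m \<prec> n \<or> m = n \<or> n \<prec> m"
proof (rule D0_induct[where P = "\<lambda>m. m \<prec> n \<or> m = n \<or> n \<prec> m"])
  fix m assume "m \<prec> n \<or> m = n \<or> n \<prec> m"
  moreover have "sc m \<prec> n \<or> sc m = n" if "m \<prec> n"
  proof -
    obtain c where c: "n = m \<oplus> sc c" using \<open>m \<prec> n\<close> by (auto simp: less_iff')
    then have n: "n = sc m \<oplus> c" by (metis add_assoc' add_commute')
    show ?thesis
    proof (cases "c = \<zero>")
      case True with n show ?thesis by (simp add: basic)
    next
      case False
      then have "\<zero> \<prec> c" using zero_less' by blast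
      then obtain d where "c = sc d" by (auto simp: less_iff' add_0_left')
      with n show ?thesis by (auto simp: less_iff')
    qed
  qed
  ultimately show "sc m \<prec> n \<or> sc m = n \<or> n \<prec> sc m" by (auto simp: basic)
qed (intro D0_intros, use zero_less'[of n] in auto)

lemma add_less_cancel': "k \<oplus> m \<prec> k \<oplus> n \<longleftrightarrow> m \<prec> n"
  by (simp add: less_iff' add_assoc' add_left_cancel')

lemma mult_less': "\<zero> \<prec> k \<Longrightarrow> m \<prec> n \<Longrightarrow> k \<otimes> m \<prec> k \<otimes> n"
proof -
  assume "\<zero> \<prec> k" "m \<prec> n"
  then obtain c d where "k = sc d" "n = m \<oplus> sc c" by (auto simp: less_iff' add_0_left')
  then have "k \<otimes> n = k \<otimes> m \<oplus> sc (k \<otimes> c \<oplus> d)"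
    by (simp add: distrib_left' basic(6) mult_1_left' mult_one_right' add_assoc')
  then show ?thesis by (auto simp: less_iff')
qed

definition le (infix \<open>\<preceq>\<close> 50) where "m \<preceq> n \<longleftrightarrow> m \<prec> n \<or> m = n"

lemma le_iff': "m \<preceq> n \<longleftrightarrow> (\<exists>c. n = m \<oplus> c)"
  unfolding le_def less_iff'
  by (metis add_0_left' add_commute' basic(3) zero_less' less_iff')

text \<open>Truncated subtraction, the difference operation that \<open>linordered_semidom\<close>
  asks for.\<close>

definition mn (infixl \<open>\<ominus>\<close> 65) where "m \<ominus> n = (if n \<preceq> m then THE c. m = n \<oplus> c else \<zero>)"

lemma mn_eq: "(n \<oplus> c) \<ominus> n = c"
  by (auto simp: mn_def le_iff' add_left_cancel')

lemma mn_zero: "\<not> n \<preceq> m \<Longrightarrow> m \<ominus> n = \<zero>"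
  by (simp add: mn_def)

lemma less_le': "m \<prec> n \<longleftrightarrow> m \<preceq> n \<and> \<not> n \<preceq> m"
  unfolding le_def by (metis less_irrefl' less_trans')

lemma mn_mn: "a \<ominus> b \<ominus> c = a \<ominus> (b \<oplus> c)"
proof (cases "b \<preceq> a")
  case True
  then obtain x where x: "a = b \<oplus> x" by (auto simp: le_iff')
  have "c \<preceq> x \<longleftrightarrow> b \<oplus> c \<preceq> a"
    unfolding x by (auto simp: le_iff' add_assoc' add_left_cancel')
  then show ?thesis
    using True by (auto simp: mn_def x add_assoc' add_left_cancel')
next
  case False
  then have "\<not> b \<oplus> c \<preceq> a" by (auto simp: le_iff' add_assoc')
  moreover have "\<zero> \<ominus> c = \<zero>"
    by (cases "c = \<zero>") (use mn_eq[of \<zero> \<zero>] basic(7) in \<open>auto simp: basic mn_def le_def\<close>)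
  ultimately show ?thesis using False by (simp add: mn_zero)
qed

lemma mult_mn: "a \<otimes> (b \<ominus> c) = a \<otimes> b \<ominus> a \<otimes> c"
proof (cases "c \<preceq> b")
  case True
  then obtain x where x: "b = c \<oplus> x" by (auto simp: le_iff')
  show ?thesis by (simp add: x mn_eq distrib_left')
next
  case False
  then have *: "b \<prec> c" using less_linear' by (auto simp: le_def)
  show ?thesis
  proof (cases "a = \<zero>")
    case True
    then show ?thesis using mn_eq[of \<zero> \<zero>] by (simp add: mult_0_left' basic)
  next
    case False
    then have "a \<otimes> b \<prec> a \<otimes> c" using * mult_less' zero_less' by blast
    then show ?thesis using \<open>\<not> c \<preceq> b\<close> by (simp add: mn_zero less_le' basic)
  qed
qed

end

text \<open>Facts on ordered semirings become available, with prefix \<open>N\<close>, for all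
  elements of a possibly nonstandard model.\<close>

sublocale rca \<subseteq> N: linordered_semidom "(\<oplus>)" "(\<ominus>)" "(\<preceq>)" "(\<prec>)" "\<zero>" "(\<otimes>)" "\<one>"
proof unfold_locales
  fix a b c :: 'a
  show "a \<oplus> b \<oplus> c = a \<oplus> (b \<oplus> c)" by (rule add_assoc')
  show "a \<oplus> b = b \<oplus> a" by (rule add_commute')
  show "a \<otimes> b \<otimes> c = a \<otimes> (b \<otimes> c)" by (rule mult_assoc')
  show "a \<otimes> b = b \<otimes> a" by (rule mult_commute')
  show "(a \<oplus> b) \<otimes> c = a \<otimes> c \<oplus> b \<otimes> c" by (metis distrib_left' mult_commute')
  show "\<zero> \<oplus> a = a" by (rule add_0_left')
  show "\<one> \<otimes> a = a" by (metis mult_one_right' mult_commute')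
  show "\<zero> \<otimes> a = \<zero>" by (rule mult_0_left')
  show "a \<otimes> \<zero> = \<zero>" by (rule basic)
  show "\<zero> \<noteq> \<one>" by (metis add_0_left' basic(1))
  show "a \<oplus> b \<ominus> a = b" by (rule mn_eq)
  show "a \<ominus> b \<ominus> c = a \<ominus> (b \<oplus> c)" by (rule mn_mn)
  show "(a \<prec> b) = (a \<preceq> b \<and> \<not> b \<preceq> a)" by (rule less_le')
  show "a \<preceq> a" by (simp add: le_def)
  show "a \<preceq> b \<Longrightarrow> b \<preceq> c \<Longrightarrow> a \<preceq> c" unfolding le_def by (metis less_trans')
  show "a \<preceq> b \<Longrightarrow> b \<preceq> a \<Longrightarrow> a = b" unfolding le_def by (metis less_trans' less_irrefl')
  show "a \<preceq> b \<Longrightarrow> c \<oplus> a \<preceq> c \<oplus> b" by (auto simp: le_def add_less_cancel')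
  show "a \<preceq> b \<or> b \<preceq> a" using less_linear' by (auto simp: le_def)
  show "a \<prec> b \<Longrightarrow> \<zero> \<prec> c \<Longrightarrow> c \<otimes> a \<prec> c \<otimes> b" by (rule mult_less')
  show "a \<otimes> (b \<ominus> c) = a \<otimes> b \<ominus> a \<otimes> c" by (rule mult_mn)
  show "a \<otimes> (b \<oplus> c) = a \<otimes> b \<oplus> a \<otimes> c" by (rule distrib_left')
  show "\<zero> \<prec> \<one>" by (metis zero_less' add_0_left' basic(1))
  show "b \<preceq> a \<Longrightarrow> a \<ominus> b \<oplus> b = a" by (metis le_iff' mn_eq add_commute')
  show "a \<noteq> \<zero> \<Longrightarrow> b \<noteq> \<zero> \<Longrightarrow> a \<otimes> b \<noteq> \<zero>"
    using zero_less'[of a] zero_less'[of b] mult_less'[of a \<zero> b] by (auto simp: basic less_irrefl')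
qed

context rca
begin

lemma less_one_iff: "m \<prec> sc n \<longleftrightarrow> m \<preceq> n"
  by (simp add: basic(8) le_def)

lemma one_le_iff: "sc m \<preceq> n \<longleftrightarrow> m \<prec> n"
  by (metis N.not_less less_one_iff)

lemma not_less_zero [simp]: "\<not> m \<prec> \<zero>"
  by (rule basic)

lemma zero_le [simp]: "\<zero> \<preceq> m"
  using N.not_less by fastforce

lemma double_inject: "i \<oplus> i = j \<oplus> j \<Longrightarrow> i = j"
  using N.add_strict_mono[of i j i j] N.add_strict_mono[of j i j i] less_linear'[of i j] by auto

lemma even_neq_odd: "i \<oplus> i \<noteq> sc (j \<oplus> j)"
proof
  assume eq: "i \<oplus> i = sc (j \<oplus> j)"
  show False
  proof (cases "i \<preceq> j")
    case True
    then have "i \<oplus> i \<preceq> j \<oplus> j" by (intro N.add_mono)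
    then show False unfolding eq one_le_iff by simp
  next
    case False
    then have "sc j \<preceq> i" by (simp add: one_le_iff N.not_le)
    then have "sc j \<oplus> sc j \<preceq> i \<oplus> i" by (intro N.add_mono)
    moreover have "sc j \<oplus> sc j = sc (sc (j \<oplus> j))" by (simp add: ac_simps)
    ultimately show False unfolding eq one_le_iff by simp
  qed
qed

section \<open>Coding of bounded sets\<close>

lemma T0_subst: "T0 t \<Longrightarrow> (\<And>i. T0 (\<lambda>e. f e i)) \<Longrightarrow> T0 (\<lambda>e. t (f e))"
  by (induction rule: T0.induct) (auto intro: T0.intros)

lemma T0_shift: "T0 t \<Longrightarrow> T0 (\<lambda>e. t (\<lambda>i. e (Suc i)))"
  by (rule T0_subst, assumption, rule T0_var)

lemma T0_case: "T0 t \<Longrightarrow> (\<And>j. T0 (\<lambda>e. f e j)) \<Longrightarrow> T0 (\<lambda>e. case i of 0 \<Rightarrow> t e | Suc j \<Rightarrow> f e j)"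
  by (cases i) auto

lemma D0_subst: "D0 Q \<Longrightarrow> (\<And>i. T0 (\<lambda>e. f e i)) \<Longrightarrow> D0 (\<lambda>e. Q (f e))"
proof (induction arbitrary: f rule: D0.induct)
  case (D0_ball t Q)
  \<comment> \<open>The substitution lifted under the binder: index 0 stays, the substituted terms
    are shifted past it.\<close>
  let ?f = "\<lambda>e i. case i of 0 \<Rightarrow> e 0 | Suc j \<Rightarrow> f (\<lambda>i. e (Suc i)) j"
  have "T0 (\<lambda>e. ?f e i)" for i
    by (intro T0_case T0_var T0_shift D0_ball.prems)
  from D0_ball.IH[of ?f, OF this] show ?case
    by (intro D0.D0_ball T0_subst[OF D0_ball.hyps(1)] D0_ball.prems) simp
next
  case (D0_bex t Q)
  let ?f = "\<lambda>e i. case i of 0 \<Rightarrow> e 0 | Suc j \<Rightarrow> f (\<lambda>i. e (Suc i)) j"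
  have "T0 (\<lambda>e. ?f e i)" for i
    by (intro T0_case T0_var T0_shift D0_bex.prems)
  from D0_bex.IH[of ?f, OF this] show ?case
    by (intro D0.D0_bex T0_subst[OF D0_bex.hyps(1)] D0_bex.prems) simp
qed (auto intro!: D0.intros intro: T0_subst)

lemma T0_if: "T0 t \<Longrightarrow> T0 u \<Longrightarrow> T0 (\<lambda>e. if b then t e else u e)"
  by (cases b) auto

lemma D0_app2: "Df2 P \<Longrightarrow> T0 t \<Longrightarrow> T0 u \<Longrightarrow> D0 (\<lambda>e. P (t e) (u e))"
  using D0_subst[of "\<lambda>e. P (e 0) (e 1)" "\<lambda>e i. if i = 0 then t e else u e"] by (simp add: T0_if)

lemma D0_app3:
  "D0 (\<lambda>e. P (e 0) (e 1) (e 2)) \<Longrightarrow> T0 t \<Longrightarrow> T0 u \<Longrightarrow> T0 v \<Longrightarrow> D0 (\<lambda>e. P (t e) (u e) (v e))"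
  using D0_subst[of "\<lambda>e. P (e 0) (e 1) (e 2)" "\<lambda>e i. if i = 0 then t e else if i = 1 then u e else v e"]
  by (simp add: T0_if)

lemma D0_le: "T0 t \<Longrightarrow> T0 u \<Longrightarrow> D0 (\<lambda>e. t e \<preceq> u e)"
  unfolding le_def by (intro D0_intros)

definition pr :: "'a \<Rightarrow> 'a \<Rightarrow> 'a" where
  "pr i j = (i \<oplus> j) \<otimes> (i \<oplus> j) \<oplus> i"

lemma T0_pr: "T0 t \<Longrightarrow> T0 u \<Longrightarrow> T0 (\<lambda>e. pr (t e) (u e))"
  unfolding pr_def by (intro D0_intros)

lemma tm_val_pair: "tm_val M e (pair s t) = pr (tm_val M e s) (tm_val M e t)"
  by (simp add: pair_def pr_def)

text \<open>Codes are ordered by the sum \<open>s\<close> of the components first, because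
  \<open>s * s + i\<close> with \<open>i\<close> at most \<open>s\<close> stays below the next
  square. Injectivity of \<open>pr\<close> follows.\<close>

lemma pr_less: assumes "i \<oplus> j \<prec> i' \<oplus> j'" shows "pr i j \<prec> pr i' j'"
proof -
  let ?s = "i \<oplus> j" and ?t = "i' \<oplus> j'"
  have "i \<preceq> ?s" by (auto simp: le_iff')
  then have "pr i j \<preceq> ?s \<otimes> ?s \<oplus> ?s" unfolding pr_def by (rule N.add_left_mono)
  also have "\<dots> \<prec> (sc ?s) \<otimes> (sc ?s)"
  proof -
    have "sc s \<otimes> sc s = (s \<otimes> s \<oplus> s) \<oplus> sc s" for s
      by (simp add: basic(6) mult_1_left' add_assoc')
    then show ?thesis by (auto simp: less_iff' simp del: N.add.assoc)
  qed
  also have "\<dots> \<preceq> ?t \<otimes> ?t"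
    using assms by (intro N.mult_mono) (auto simp: one_le_iff)
  also have "\<dots> \<preceq> pr i' j'" unfolding pr_def by (auto simp: le_iff')
  finally show ?thesis .
qed

lemma pr_inject [simp]: "pr i j = pr i' j' \<longleftrightarrow> i = i' \<and> j = j'"
proof
  assume *: "pr i j = pr i' j'"
  have "i \<oplus> j = i' \<oplus> j'"
    using pr_less[of i j i' j'] pr_less[of i' j' i j] * by (metis N.less_irrefl N.linorder_cases)
  moreover with * have "i = i'" by (simp add: pr_def)
  ultimately show "i = i' \<and> j = j'" by simp
qed auto

lemma pr_mono: "j \<prec> j' \<Longrightarrow> pr i j \<prec> pr i j'"
  by (rule pr_less) simp

lemma le_square: "n \<preceq> n \<otimes> n"
proof (cases "n = \<zero>")
  case False
  then have "\<one> \<preceq> n" using zero_less'[of n] one_le_iff[of \<zero> n] by simp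
  then show ?thesis using N.mult_left_mono[of \<one> n n] by simp
qed simp

lemma le_pr1: "i \<preceq> pr i j"
  unfolding pr_def by (metis le_iff' add_commute')

lemma le_pr2: "j \<preceq> pr i j"
proof -
  have "j \<preceq> i \<oplus> j" by (metis le_iff' add_commute')
  also have "\<dots> \<preceq> (i \<oplus> j) \<otimes> (i \<oplus> j)" by (rule le_square)
  also have "\<dots> \<preceq> pr i j" unfolding pr_def by (auto simp: le_iff')
  finally show ?thesis .
qed

lemma D0_ex_le: "T0 t \<Longrightarrow> D0 (\<lambda>e. Q (e 0) (\<lambda>i. e (Suc i))) \<Longrightarrow> D0 (\<lambda>e. \<exists>a. a \<preceq> t e \<and> Q a e)"
  unfolding less_one_iff[symmetric] by (intro D0_intros)

lemma D0_all_le: "T0 t \<Longrightarrow> D0 (\<lambda>e. Q (e 0) (\<lambda>i. e (Suc i))) \<Longrightarrow> D0 (\<lambda>e. \<forall>a. a \<preceq> t e \<longrightarrow> Q a e)"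
  unfolding less_one_iff[symmetric] by (intro D0_intros)

lemma D0_triv: "D0 (\<lambda>e. b)"
proof -
  have "D0 (\<lambda>e. \<zero> = \<zero>)" "D0 (\<lambda>e. \<not> \<zero> = \<zero>)" by (intro D0_intros)+
  then show ?thesis by (cases b) simp_all
qed

lemmas D0_ints = D0_intros D0_le T0_pr D0_ex_le D0_all_le

lemma D0_comprehension: "Df1 P \<Longrightarrow> {x. P x} \<in> Sets M"
  using Delta1_comprehension[of "\<lambda>x y. P x" "\<lambda>x y. P x"] by simp

section \<open>Collection and least elements\<close>

lemma collect_step:
  assumes "\<exists>b. \<forall>i. i \<prec> n \<longrightarrow> (\<exists>y. y \<prec> b \<and> Q i y)" "\<exists>y. Q n y"
  shows "\<exists>b. \<forall>i. i \<prec> sc n \<longrightarrow> (\<exists>y. y \<prec> b \<and> Q i y)"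
proof -
  obtain b y where b: "\<And>i. i \<prec> n \<Longrightarrow> \<exists>y. y \<prec> b \<and> Q i y" and y: "Q n y" using assms by blast
  have less: "y \<prec> b \<oplus> sc y" by (metis add_commute' less_one_iff le_iff' basic(4))
  have "b \<preceq> b \<oplus> sc y" by (auto simp: le_iff')
  then have "\<exists>z. z \<prec> b \<oplus> sc y \<and> Q i z" if "i \<prec> sc n" for i
    using b[of i] y less \<open>i \<prec> sc n\<close> N.less_le_trans unfolding basic(8) by blast
  then show ?thesis by blast
qed

text \<open>Without a minimum, all \<open>m\<close> below any given number fail \<open>S\<close>, by
  induction. Asking for one common bound \<open>b\<close> on the counterexamples keeps the induction
  statement existential over a bounded matrix.\<close>

lemma Pi1_least:
  assumes D: "Df2 S" and n: "\<And>y. S n y"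
  obtains c where "\<And>y. S c y" "\<And>d. d \<prec> c \<Longrightarrow> \<exists>y. \<not> S d y"
proof (rule ccontr)
  assume nt: "\<not> thesis"
  note least = that
  have *: "\<exists>y. \<not> S c y" if "\<And>d. d \<prec> c \<Longrightarrow> \<exists>y. \<not> S d y" for c using nt least that by blast
  have "\<exists>b. \<forall>m. m \<prec> sc n \<longrightarrow> (\<exists>y. y \<prec> b \<and> \<not> S m y)"
  proof (rule Sigma1_induct[where R = "\<lambda>n b. \<forall>m. m \<prec> n \<longrightarrow> (\<exists>y. y \<prec> b \<and> \<not> S m y)"])
    fix n assume "\<exists>b. \<forall>m. m \<prec> n \<longrightarrow> (\<exists>y. y \<prec> b \<and> \<not> S m y)"
    moreover from this have "\<exists>y. \<not> S n y" using * by blast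
    ultimately show "\<exists>b. \<forall>m. m \<prec> sc n \<longrightarrow> (\<exists>y. y \<prec> b \<and> \<not> S m y)"
      by (rule collect_step)
  qed (intro D0_ints D0_app2[OF D], simp)
  then show False using n by (auto simp: basic(8))
qed

lemma D0_least:
  assumes "Df1 P" "P n"
  obtains c where "P c" "\<And>d. d \<prec> c \<Longrightarrow> \<not> P d"
  by (rule Pi1_least[of "\<lambda>c y. P c" n]) (use assms in auto)

lemma Sigma1_collection:
  assumes D: "Df2 R" and R: "\<And>i. i \<prec> k \<Longrightarrow> \<exists>y. R i y"
  obtains b where "\<And>i. i \<prec> k \<Longrightarrow> \<exists>y. y \<prec> b \<and> R i y"
proof -
  \<comment> \<open>The guard \<open>i \<prec> k\<close> inside makes the induction step valid for
    numbers beyond \<open>k\<close> as well.\<close>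
  have "\<exists>b. \<forall>i. i \<prec> k \<longrightarrow> (\<exists>y. y \<prec> b \<and> (i \<prec> k \<longrightarrow> R i y))"
  proof (rule Sigma1_induct[where R = "\<lambda>n b. \<forall>i. i \<prec> n \<longrightarrow> (\<exists>y. y \<prec> b \<and> (i \<prec> k \<longrightarrow> R i y))"])
    fix n assume "\<exists>b. \<forall>i. i \<prec> n \<longrightarrow> (\<exists>y. y \<prec> b \<and> (i \<prec> k \<longrightarrow> R i y))"
    then show "\<exists>b. \<forall>i. i \<prec> sc n \<longrightarrow> (\<exists>y. y \<prec> b \<and> (i \<prec> k \<longrightarrow> R i y))"
      by (rule collect_step) (use R in blast)
  qed (intro D0_ints D0_app2[OF D], simp)
  then show thesis using that by blast
qed

section \<open>Divisibility codes for bounded sets\<close>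

text \<open>The moduli of Goedel's beta function: they are pairwise coprime for indices below
  \<open>k\<close> if \<open>m\<close> is a common multiple of 1, ..., \<open>k\<close>.\<close>

definition mdl :: "'a \<Rightarrow> 'a \<Rightarrow> 'a" where
  "mdl m i = sc i \<otimes> m \<oplus> \<one>"

text \<open>Membership is divisibility by the modulus; the bound on \<open>q\<close> keeps it a
  bounded formula and is removed in \<open>El_iff\<close>.\<close>

definition El :: "'a \<Rightarrow> 'a \<Rightarrow> 'a \<Rightarrow> bool" where
  "El c m i \<longleftrightarrow> (\<exists>q. q \<preceq> c \<and> c = q \<otimes> mdl m i)"

lemma El_D0: "D0 (\<lambda>e. El (e 0) (e 1) (e 2))"
  unfolding El_def mdl_def by (intro D0_ints)

lemma mdl_pos [simp]: "\<zero> \<prec> mdl m i"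
  by (simp add: mdl_def less_one_iff)

lemma El_iff: "El c m i \<longleftrightarrow> (\<exists>q. c = q \<otimes> mdl m i)"
proof -
  have "q \<preceq> q \<otimes> mdl m i" for q
    using N.mult_left_mono[of \<one> "mdl m i" q] by (simp add: mdl_def le_iff' exI[of _ "sc i \<otimes> m"] add_commute')
  then show ?thesis by (auto simp: El_def)
qed

text \<open>Divisibility read off an equation without subtraction, the form in which
  \<open>mdl_coprime\<close> arrives at it.\<close>

lemma mult_cancel_exists:
  assumes "c \<oplus> u \<otimes> a = v \<otimes> a" "\<zero> \<prec> a"
  shows "\<exists>w. c = w \<otimes> a"
proof -
  have "u \<otimes> a \<preceq> v \<otimes> a" using assms(1) by (metis le_iff' add_commute')
  then have "u \<preceq> v" using N.mult_strict_right_mono[OF _ assms(2), of v u] by (meson N.not_less)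
  then obtain w where "v = w \<oplus> u" by (metis le_iff' add_commute')
  with assms(1) have "c = w \<otimes> a" by (simp add: N.distrib_right)
  then show ?thesis ..
qed

text \<open>The terms containing \<open>m\<close> cancel in the difference of
  \<open>sc j * mdl m i\<close> and \<open>sc i * mdl m j\<close>, which leaves \<open>sc d\<close>,
  a divisor of \<open>m\<close>; the factor \<open>p\<close> enlarges it to
  \<open>m\<close>.\<close>

lemma mdl_diff:
  assumes d: "j = i \<oplus> sc d" and m: "m = p \<otimes> sc d"
  shows "p \<otimes> (sc j \<otimes> mdl m i) = p \<otimes> (sc i \<otimes> mdl m j) \<oplus> m"
proof -
  have "sc j \<otimes> (sc i \<otimes> x \<oplus> \<one>) = sc i \<otimes> (sc j \<otimes> x \<oplus> \<one>) \<oplus> sc d" for x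
    unfolding d by (simp only: N.distrib_left N.distrib_right N.mult_1_left N.mult_1_right ac_simps)
  from this[of m] have "sc j \<otimes> mdl m i = sc i \<otimes> mdl m j \<oplus> sc d" by (simp only: mdl_def)
  then have "p \<otimes> (sc j \<otimes> mdl m i) = p \<otimes> (sc i \<otimes> mdl m j \<oplus> sc d)" by (rule arg_cong)
  also have "\<dots> = p \<otimes> (sc i \<otimes> mdl m j) \<oplus> m"
    unfolding distrib_left'[of p _ "sc d"] m[symmetric] by (rule refl)
  finally show ?thesis .
qed

text \<open>Bezout without subtraction. By \<open>mdl_diff\<close>, \<open>m\<close> is a
  combination of both moduli, and 1 is the difference of \<open>mdl m i\<close> and
  \<open>sc i * m\<close>. Multiplied by \<open>c\<close>, every term other than \<open>c\<close> is
  a multiple of \<open>mdl m i\<close>. The cases differ in the side of the equation on which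
  \<open>m\<close> appears.\<close>

lemma mdl_coprime:
  assumes m: "\<And>i. i \<prec> k \<Longrightarrow> \<exists>q. m = q \<otimes> sc i"
    and ij: "i \<prec> k" "j \<prec> k" "i \<noteq> j" and q: "c \<otimes> mdl m j = q \<otimes> mdl m i"
  shows "\<exists>w. c = w \<otimes> mdl m i"
proof -
  define a where "a = mdl m i"
  define b where "b = mdl m j"
  define I where "I = sc i"
  define J where "J = sc j"
  have a: "a = I \<otimes> m \<oplus> \<one>" and b: "b = J \<otimes> m \<oplus> \<one>" by (simp_all add: a_def b_def I_def J_def mdl_def)
  have bc: "c \<otimes> b = q \<otimes> a" using q by (simp add: a_def b_def)
  consider "i \<prec> j" | "j \<prec> i" using ij(3) less_linear' by blast
  then have "\<exists>u v. c \<oplus> u \<otimes> a = v \<otimes> a"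
  proof cases
    case 1
    then obtain d where d: "j = i \<oplus> sc d" by (auto simp: less_iff')
    then have "d \<prec> k" using ij(2) by (metis add_commute' le_iff' N.le_less_trans one_le_iff N.less_imp_le)
    then obtain p where p: "m = p \<otimes> sc d" using m by blast
    have "p \<otimes> (J \<otimes> a) = p \<otimes> (I \<otimes> b) \<oplus> m"
      unfolding a_def b_def I_def J_def by (rule mdl_diff[OF d p])
    then have "I \<otimes> (p \<otimes> (J \<otimes> a)) \<oplus> \<one> = I \<otimes> (p \<otimes> (I \<otimes> b)) \<oplus> a" by (simp only: a N.distrib_left N.add.assoc)
    then have "c \<otimes> (I \<otimes> (p \<otimes> (J \<otimes> a)) \<oplus> \<one>) = c \<otimes> (I \<otimes> (p \<otimes> (I \<otimes> b)) \<oplus> a)" by simp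
    then have "c \<oplus> (c \<otimes> I \<otimes> p \<otimes> J) \<otimes> a = (I \<otimes> p \<otimes> I) \<otimes> (c \<otimes> b) \<oplus> c \<otimes> a"
      by (simp only: N.distrib_left N.mult_1_right ac_simps)
    also have "\<dots> = (I \<otimes> p \<otimes> I \<otimes> q \<oplus> c) \<otimes> a" by (simp only: bc, simp only: N.distrib_left N.distrib_right ac_simps)
    finally show ?thesis by blast
  next
    case 2
    then obtain d where d: "i = j \<oplus> sc d" by (auto simp: less_iff')
    then have "d \<prec> k" using ij(1) by (metis add_commute' le_iff' N.le_less_trans one_le_iff N.less_imp_le)
    then obtain p where p: "m = p \<otimes> sc d" using m by blast
    have "p \<otimes> (I \<otimes> b) = p \<otimes> (J \<otimes> a) \<oplus> m"
      unfolding a_def b_def I_def J_def by (rule mdl_diff[OF d p])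
    then have "I \<otimes> (p \<otimes> (I \<otimes> b)) \<oplus> \<one> = I \<otimes> (p \<otimes> (J \<otimes> a)) \<oplus> a" by (simp only: a N.distrib_left N.add.assoc)
    then have "c \<otimes> (I \<otimes> (p \<otimes> (I \<otimes> b)) \<oplus> \<one>) = c \<otimes> (I \<otimes> (p \<otimes> (J \<otimes> a)) \<oplus> a)" by simp
    then have "c \<oplus> (I \<otimes> p \<otimes> I) \<otimes> (c \<otimes> b) = (c \<otimes> I \<otimes> p \<otimes> J \<oplus> c) \<otimes> a"
      by (simp only: N.distrib_left N.distrib_right N.mult_1_right ac_simps)
    then have "c \<oplus> (I \<otimes> p \<otimes> I \<otimes> q) \<otimes> a = (c \<otimes> I \<otimes> p \<otimes> J \<oplus> c) \<otimes> a" by (simp only: bc, simp only: ac_simps)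
    then show ?thesis by blast
  qed
  then show ?thesis using mult_cancel_exists[of c _ a] by (auto simp: a_def)
qed

text \<open>Takes the place of the factorial. The quotients are bounded by \<open>m\<close> to keep
  the matrix of the induction statement bounded.\<close>

lemma common_multiple: "\<exists>m. \<zero> \<prec> m \<and> (\<forall>i. i \<prec> k \<longrightarrow> (\<exists>q. m = q \<otimes> sc i))"
proof -
  have "\<exists>m. \<zero> \<prec> m \<and> (\<forall>i. i \<prec> k \<longrightarrow> (\<exists>q. q \<preceq> m \<and> m = q \<otimes> sc i))"
  proof (rule Sigma1_induct[where R = "\<lambda>k m. \<zero> \<prec> m \<and> (\<forall>i. i \<prec> k \<longrightarrow> (\<exists>q. q \<preceq> m \<and> m = q \<otimes> sc i))"])
    have "\<zero> \<prec> \<one> \<and> (\<forall>i. i \<prec> \<zero> \<longrightarrow> (\<exists>q. q \<preceq> \<one> \<and> \<one> = q \<otimes> sc i))" by simp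
    then show "\<exists>m. \<zero> \<prec> m \<and> (\<forall>i. i \<prec> \<zero> \<longrightarrow> (\<exists>q. q \<preceq> m \<and> m = q \<otimes> sc i))" by blast
  next
    fix k assume "\<exists>m. \<zero> \<prec> m \<and> (\<forall>i. i \<prec> k \<longrightarrow> (\<exists>q. q \<preceq> m \<and> m = q \<otimes> sc i))"
    then obtain m where m: "\<zero> \<prec> m" "\<And>i. i \<prec> k \<Longrightarrow> \<exists>q. m = q \<otimes> sc i" by blast
    let ?m = "m \<otimes> sc k"
    have k1: "\<zero> \<prec> sc n" for n by (simp add: less_one_iff)
    have le: "q \<preceq> q \<otimes> sc n" for q n by (simp add: N.distrib_left)
    have "\<exists>q. q \<preceq> ?m \<and> ?m = q \<otimes> sc i" if "i \<prec> sc k" for i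
    proof -
      have "\<exists>q. ?m = q \<otimes> sc i"
      proof (cases "i = k")
        case False
        then obtain q where q: "m = q \<otimes> sc i" using m(2)[of i] \<open>i \<prec> sc k\<close> by (auto simp: basic(8))
        have "?m = (q \<otimes> sc k) \<otimes> sc i" by (simp only: q ac_simps)
        then show ?thesis ..
      qed blast
      then show ?thesis using le by metis
    qed
    then show "\<exists>m. \<zero> \<prec> m \<and> (\<forall>i. i \<prec> sc k \<longrightarrow> (\<exists>q. q \<preceq> m \<and> m = q \<otimes> sc i))"
      using N.mult_pos_pos[OF m(1) k1] by blast
  qed (intro D0_ints)
  then show ?thesis by blast
qed

text \<open>
  The code is the least positive \<open>c\<close> divisible by \<open>mdl m i\<close> for all \<open>i\<close> in the set: by coprimality
  any other modulus could be divided out of \<open>c\<close>.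
\<close>

lemma bounded_coding:
  assumes D: "Df2 R"
  shows "\<exists>c m. \<forall>i. i \<prec> k \<longrightarrow> (El c m i \<longleftrightarrow> (\<exists>y. R i y))"
proof -
  obtain m where m: "\<zero> \<prec> m" "\<And>i. i \<prec> k \<Longrightarrow> \<exists>q. m = q \<otimes> sc i" using common_multiple by blast
  \<comment> \<open>The product of all moduli is a candidate, so that the least-number argument has
    something to start from.\<close>
  have "\<exists>c. \<zero> \<prec> c \<and> (\<forall>i. i \<prec> k \<longrightarrow> El c m i)"
  proof (rule Sigma1_induct[where R = "\<lambda>k c. \<zero> \<prec> c \<and> (\<forall>i. i \<prec> k \<longrightarrow> El c m i)"])
    show "\<exists>c. \<zero> \<prec> c \<and> (\<forall>i. i \<prec> \<zero> \<longrightarrow> El c m i)" using m(1) by auto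
    fix k assume "\<exists>c. \<zero> \<prec> c \<and> (\<forall>i. i \<prec> k \<longrightarrow> El c m i)"
    then obtain c where c: "\<zero> \<prec> c" "\<And>i. i \<prec> k \<Longrightarrow> El c m i" by blast
    have "El (c \<otimes> mdl m k) m i" if i: "i \<prec> sc k" for i
    proof (cases "i = k")
      case False
      then obtain q where "c = q \<otimes> mdl m i" using c(2) i by (auto simp: basic(8) El_iff)
      then have "c \<otimes> mdl m k = (q \<otimes> mdl m k) \<otimes> mdl m i" by (simp only: ac_simps)
      then show ?thesis by (auto simp: El_iff)
    qed (auto simp: El_iff)
    then show "\<exists>c. \<zero> \<prec> c \<and> (\<forall>i. i \<prec> sc k \<longrightarrow> El c m i)"
      using N.mult_pos_pos[OF c(1) mdl_pos] by blast
  qed (intro D0_ints D0_app3[OF El_D0])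
  then obtain C where C: "\<zero> \<prec> C" "\<And>i. i \<prec> k \<Longrightarrow> El C m i" by blast
  \<comment> \<open>The witness \<open>y\<close> is the second argument: "divisible by the modulus
    of every member of the set" is then a universal property of \<open>c\<close>, to which
    \<open>Pi1_least\<close> applies.\<close>
  let ?S = "\<lambda>c y. \<zero> \<prec> c \<and> (\<forall>i. i \<prec> k \<longrightarrow> R i y \<longrightarrow> El c m i)"
  have "Df2 ?S" by (intro D0_ints D0_app3[OF El_D0] D0_app2[OF D])
  moreover have "?S C y" for y using C by blast
  ultimately obtain c where c: "\<And>y. ?S c y" "\<And>d. d \<prec> c \<Longrightarrow> \<exists>y. \<not> ?S d y"
    by (rule Pi1_least[of ?S]) (rule that)
  have "\<exists>y. R i y" if i: "i \<prec> k" "El c m i" for i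
  proof (rule ccontr)
    assume nR: "\<nexists>y. R i y"
    obtain q where q: "c = q \<otimes> mdl m i" using i by (auto simp: El_iff)
    then have "\<zero> \<prec> q" using c(1) zero_less'[of q] by auto
    \<comment> \<open>Positivity of \<open>m\<close> makes the modulus exceed 1, so the quotient
      \<open>q\<close> is strictly smaller than \<open>c\<close>.\<close>
    have "\<one> \<prec> mdl m i" using m(1) by (simp add: mdl_def less_one_iff N.mult_pos_pos)
    then have "q \<prec> c" using N.mult_strict_left_mono[OF _ \<open>\<zero> \<prec> q\<close>] q by fastforce
    moreover have "El q m j" if "j \<prec> k" "R j y" for j y
    proof -
      have "El c m j" using c(1)[of y] that by blast
      then obtain p where "q \<otimes> mdl m i = p \<otimes> mdl m j" using q by (auto simp: El_iff)
      moreover have "j \<noteq> i" using nR that by blast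
      ultimately show ?thesis using mdl_coprime[OF m(2) \<open>j \<prec> k\<close> i(1)] by (auto simp: El_iff)
    qed
    ultimately show False using c(2)[of q] \<open>\<zero> \<prec> q\<close> by blast
  qed
  then show ?thesis using c(1) by blast
qed

text \<open>The unbounded set need not exist in the model, but each initial segment has a code of
  two numbers, and membership in a code is a bounded condition.\<close>

lemma bounded_Sigma1_comprehension:
  assumes D: "Df2 R"
  shows "{i. i \<prec> k \<and> (\<exists>y. R i y)} \<in> Sets M"
proof -
  obtain c m where "\<forall>i. i \<prec> k \<longrightarrow> (El c m i \<longleftrightarrow> (\<exists>y. R i y))" using bounded_coding[OF D] by blast
  then have "{i. i \<prec> k \<and> (\<exists>y. R i y)} = {i. i \<prec> k \<and> El c m i}" by auto
  also have "\<dots> \<in> Sets M" by (intro D0_comprehension D0_ints D0_app3[OF El_D0])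
  finally show ?thesis .
qed

end

context rca
begin

section \<open>Projections and arithmetical comprehension\<close>

definition cons :: "'b \<Rightarrow> (nat \<Rightarrow> 'b) \<Rightarrow> nat \<Rightarrow> 'b" where
  "cons a e i = (case i of 0 \<Rightarrow> a | Suc j \<Rightarrow> e j)"

lemma cons_simps [simp]: "cons a e 0 = a" "cons a e (Suc i) = e i"
  by (simp_all add: cons_def)

text \<open>Relations in \<open>D0\<close> depend on finitely many arguments only, which is what
  allows all arguments to be packed into one number.\<close>

definition dep :: "nat \<Rightarrow> ((nat \<Rightarrow> 'c) \<Rightarrow> 'b) \<Rightarrow> bool" where
  "dep n Q \<longleftrightarrow> (\<forall>e e'. (\<forall>i<n. e i = e' i) \<longrightarrow> Q e = Q e')"

lemma dep_comb: "dep n P \<Longrightarrow> dep m Q \<Longrightarrow> dep (max n m) (\<lambda>e. f (P e) (Q e))"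
  unfolding dep_def by (metis max_less_iff_conj less_max_iff_disj)

lemma dep_quantifier:
  fixes Q :: "'c \<Rightarrow> (nat \<Rightarrow> 'c) \<Rightarrow> bool"
  assumes t: "dep m t" and Q: "dep n (\<lambda>e. Q (e 0) (\<lambda>i. e (Suc i)))"
  shows "dep (max m n) (\<lambda>e. F (t e) (\<lambda>a. Q a e))"
  unfolding dep_def
proof (intro allI impI)
  fix e e' :: "nat \<Rightarrow> 'c" assume *: "\<forall>i<max m n. e i = e' i"
  have "Q a e = Q a e'" for a
  proof -
    have "\<forall>i<n. cons a e i = cons a e' i"
      using * by (auto simp: cons_def split: nat.split)
    then show ?thesis using Q[unfolded dep_def, rule_format, of "cons a e" "cons a e'"] by simp
  qed
  moreover have "t e = t e'" using t * by (auto simp: dep_def)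
  ultimately show "F (t e) (\<lambda>a. Q a e) = F (t e') (\<lambda>a. Q a e')" by simp
qed

lemma T0_dep: "T0 t \<Longrightarrow> \<exists>n. dep n t"
proof (induction rule: T0.induct)
  case (T0_var i)
  have "dep (Suc i) (\<lambda>e. e i)" by (auto simp: dep_def)
  then show ?case ..
qed (auto intro: dep_comb simp: dep_def[of _ "\<lambda>_. _"])

lemma D0_dep: "D0 Q \<Longrightarrow> \<exists>n. dep n Q"
proof (induction rule: D0.induct)
  case (D0_eq t u) then show ?case using dep_comb[of _ t _ u "(=)"] T0_dep by blast
next
  case (D0_less t u) then show ?case using dep_comb[of _ t _ u "(\<prec>)"] T0_dep by blast
next
  case (D0_mem t A)
  then obtain n where "dep n t" using T0_dep by blast
  then have "dep n (\<lambda>e. t e \<in> A)" by (auto simp: dep_def) metis+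
  then show ?case ..
next
  case (D0_not P) then show ?case by (auto simp: dep_def)
next
  case (D0_conj P Q) then show ?case using dep_comb[of _ P _ Q "(\<and>)"] by blast
next
  case (D0_disj P Q) then show ?case using dep_comb[of _ P _ Q "(\<or>)"] by blast
next
  case (D0_imp P Q) then show ?case using dep_comb[of _ P _ Q "(\<longrightarrow>)"] by blast
next
  case (D0_iff P Q) then show ?case using dep_comb[of _ P _ Q "(\<longleftrightarrow>)"] by blast
next
  case (D0_ball t Q)
  then obtain m n where "dep m t" "dep n (\<lambda>e. Q (e 0) (\<lambda>i. e (Suc i)))" using T0_dep by blast
  from dep_quantifier[OF this, of "\<lambda>b P. \<forall>a. a \<prec> b \<longrightarrow> P a"] show ?case by blast
next
  case (D0_bex t Q)
  then obtain m n where "dep m t" "dep n (\<lambda>e. Q (e 0) (\<lambda>i. e (Suc i)))" using T0_dep by blast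
  from dep_quantifier[OF this, of "\<lambda>b P. \<exists>a. a \<prec> b \<and> P a"] show ?case by blast
qed

lemma T0_cons: "T0 t \<Longrightarrow> (\<And>j. T0 (\<lambda>e. f e j)) \<Longrightarrow> T0 (\<lambda>e. cons (t e) (f e) i)"
  by (cases i) auto

primrec code :: "nat \<Rightarrow> (nat \<Rightarrow> 'a) \<Rightarrow> 'a" where
  "code 0 e = e 0"
| "code (Suc n) e = code n (cons (pr (e 0) (e 1)) (\<lambda>i. e (Suc (Suc i))))"

lemma T0_code: "T0 (code n)"
proof (induction n)
  case 0
  show ?case using T0_var[of 0] by (simp add: code_def)
next
  case (Suc n)
  show ?case unfolding code.simps by (rule T0_subst[OF Suc]) (intro T0_cons T0_pr T0_var)
qed

text \<open>Arguments 0 and 1 are merged into their pair. The pair bounds both components, so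
  unpacking costs bounded quantifiers only; after \<open>n\<close> merges a set of pairs remains,
  ready to be projected.\<close>

lemma D0_coded:
  assumes "D0 (\<lambda>e. Q (e 0) (\<lambda>i. e (Suc i)))" "\<And>a. dep (Suc n) (Q a)"
  shows "\<exists>Z\<in>Sets M. \<forall>a e. Q a e \<longleftrightarrow> pr (code n e) a \<in> Z"
  using assms
proof (induction n arbitrary: Q)
  case 0
  let ?P = "\<lambda>w. \<exists>b. b \<preceq> w \<and> (\<exists>a. a \<preceq> w \<and> w = pr b a \<and> Q a (\<lambda>_. b))"
  have D: "D0 (\<lambda>e. Q (e 0) (\<lambda>_. e (Suc 0)))"
    using D0_subst[OF "0.prems"(1), of "\<lambda>e. cons (e 0) (\<lambda>_. e (Suc 0))"] by (simp add: T0_cons T0_var)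
  have "{w. ?P w} \<in> Sets M" by (rule D0_comprehension) (intro D0_ints, rule D)
  moreover have "Q a e \<longleftrightarrow> pr (code 0 e) a \<in> {w. ?P w}" for a e
  proof -
    have "Q a e = Q a (\<lambda>_. e 0)" using "0.prems"(2)[of a, unfolded dep_def, rule_format, of e "\<lambda>_. e 0"] by simp
    then show ?thesis using le_pr1[of "e 0" a] le_pr2[of a "e 0"] by auto
  qed
  ultimately show ?case by blast
next
  case (Suc n)
  let ?Q = "\<lambda>a e. \<exists>b. b \<preceq> e 0 \<and> (\<exists>c. c \<preceq> e 0 \<and> e 0 = pr b c \<and> Q a (cons b (cons c (\<lambda>i. e (Suc i)))))"
  have "D0 (\<lambda>e. Q (e 2) (cons (e 1) (cons (e 0) (\<lambda>i. e (Suc (Suc (Suc (Suc i))))))))"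
    using D0_subst[OF Suc.prems(1), of "\<lambda>e. cons (e 2) (cons (e 1) (cons (e 0) (\<lambda>i. e (Suc (Suc (Suc (Suc i)))))))"]
    by (simp add: T0_cons T0_var del: One_nat_def)
  then have D: "D0 (\<lambda>e. Q (e (Suc (Suc 0))) (cons (e (Suc 0)) (cons (e 0) (\<lambda>i. e (Suc (Suc (Suc (Suc i))))))))"
    by (simp add: numeral_2_eq_2)
  have D: "D0 (\<lambda>e. ?Q (e 0) (\<lambda>i. e (Suc i)))" by (intro D0_ints, rule D)
  have dp: "dep (Suc n) (?Q a)" for a
  proof -
    have "Q a (cons b (cons c (\<lambda>i. e (Suc i)))) = Q a (cons b (cons c (\<lambda>i. e' (Suc i))))"
      if "\<forall>i<Suc n. e i = e' i" for b c e e'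
    proof -
      have "\<forall>i<Suc (Suc n). cons b (cons c (\<lambda>i. e (Suc i))) i = cons b (cons c (\<lambda>i. e' (Suc i))) i"
        using that by (auto simp: cons_def split: nat.split)
      then show ?thesis using Suc.prems(2)[of a, unfolded dep_def, rule_format] by blast
    qed
    then show ?thesis unfolding dep_def by (metis zero_less_Suc)
  qed
  obtain Z where Z: "Z \<in> Sets M" "\<And>a e. ?Q a e \<longleftrightarrow> pr (code n e) a \<in> Z"
    using Suc.IH[of ?Q, OF D dp] by blast
  have "Q a e \<longleftrightarrow> pr (code (Suc n) e) a \<in> Z" for a e
  proof -
    have "cons (e 0) (cons (e 1) (\<lambda>i. e (Suc (Suc i)))) = e"
      by (auto simp: fun_eq_iff cons_def split: nat.split)
    then have "Q a e \<longleftrightarrow> ?Q a (cons (pr (e 0) (e 1)) (\<lambda>i. e (Suc (Suc i))))"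
      using le_pr1[of "e 0" "e 1"] le_pr2[of "e 1" "e 0"] by auto
    then show ?thesis by (simp only: Z code.simps)
  qed
  then show ?case using Z(1) by blast
qed

text \<open>Existential comprehension in semantic form, equivalent to \<open>ACA0\<close> here by
  \<open>proj_closed_imp_ACA0\<close> and \<open>ACA0_imp_proj_closed\<close>.\<close>

definition proj_closed :: bool where
  "proj_closed \<longleftrightarrow> (\<forall>Z\<in>Sets M. {x. \<exists>y. pr x y \<in> Z} \<in> Sets M)"

text \<open>With the arguments packed, the quantifier becomes the projection of a set of the model,
  and that projection is again an admissible set parameter of a bounded definition.\<close>

lemma D0_ex:
  assumes pc: proj_closed and D: "D0 (\<lambda>e. Q (e 0) (\<lambda>i. e (Suc i)))"
  shows "D0 (\<lambda>e. \<exists>a. Q a e)"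
proof -
  obtain n where n: "dep n (\<lambda>e. Q (e 0) (\<lambda>i. e (Suc i)))" using D0_dep[OF D] by blast
  have "dep (Suc n) (Q a)" for a
  proof -
    have "Q a e = Q a e'" if "\<forall>i<Suc n. e i = e' i" for e e'
    proof -
      have "\<forall>i<n. cons a e i = cons a e' i" using that by (auto simp: cons_def split: nat.split)
      then show ?thesis using n[unfolded dep_def, rule_format, of "cons a e" "cons a e'"] by simp
    qed
    then show ?thesis by (auto simp: dep_def)
  qed
  then obtain Z where Z: "Z \<in> Sets M" "\<And>a e. Q a e \<longleftrightarrow> pr (code n e) a \<in> Z"
    using D0_coded[of Q n, OF D] by metis
  have Z': "{x. \<exists>y. pr x y \<in> Z} \<in> Sets M" using pc Z(1) by (simp add: proj_closed_def)
  have eq: "(\<lambda>e. \<exists>a. Q a e) = (\<lambda>e. code n e \<in> {x. \<exists>y. pr x y \<in> Z})" by (simp add: Z)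
  show ?thesis unfolding eq by (rule D0_mem[OF T0_code Z'])
qed

lemma D0_all:
  assumes pc: proj_closed and D: "D0 (\<lambda>e. Q (e 0) (\<lambda>i. e (Suc i)))"
  shows "D0 (\<lambda>e. \<forall>a. Q a e)"
proof -
  have "D0 (\<lambda>e. \<not> (\<exists>a. \<not> Q a e))"
    by (intro D0_not D0_ex[OF pc, of "\<lambda>a e. \<not> Q a e"] D)
  then show ?thesis by simp
qed

lemma string_enum: "\<exists>f :: string \<Rightarrow> nat. inj f"
proof -
  have "inj (of_char :: char \<Rightarrow> nat)" by (rule injI) (simp add: of_char_eq_iff)
  then have "inj (to_nat \<circ> map (of_char :: char \<Rightarrow> nat))" by (intro inj_compose inj_mapI) auto
  then show ?thesis by blast
qed

lemma T0_tm_val: "T0 (\<lambda>e. tm_val M (\<lambda>x. e (nm x)) t)"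
  by (induction t) (auto intro: T0.intros)

text \<open>The injection \<open>nm\<close> turns variable names into argument indices; a quantifier
  over \<open>x\<close> redirects index \<open>nm x\<close> to the newly bound index 0.\<close>

lemma D0_arithmetical:
  assumes pc: proj_closed and nm: "inj nm" and s: "range s \<subseteq> Sets M"
  shows "arithmetical p \<Longrightarrow> D0 (\<lambda>e. sat M (\<lambda>x. e (nm x)) s p)"
proof -
  have shift: "D0 (\<lambda>e. sat M ((\<lambda>y. e (Suc (nm y)))(x := e 0)) s p)"
    if p: "D0 (\<lambda>e. sat M (\<lambda>x. e (nm x)) s p)" for x p
  proof -
    let ?f = "\<lambda>e i. if i = nm x then e 0 else e (Suc i)"
    have "D0 (\<lambda>e. sat M (\<lambda>y. ?f e (nm y)) s p)"
      by (rule D0_subst[OF p, of ?f]) (intro T0_if T0_var)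
    also have "(\<lambda>e. sat M (\<lambda>y. ?f e (nm y)) s p) = (\<lambda>e. sat M ((\<lambda>y. e (Suc (nm y)))(x := e 0)) s p)"
      using nm by (intro ext arg_cong[of _ _ "\<lambda>e. sat M e s p"]) (auto simp: inj_eq)
    finally show ?thesis .
  qed
  show "arithmetical p \<Longrightarrow> D0 (\<lambda>e. sat M (\<lambda>x. e (nm x)) s p)"
  proof (induction p)
  case (All x p)
  then show ?case unfolding sat.simps by (intro D0_all[OF pc] shift) simp
next
  case (Ex x p)
  then show ?case unfolding sat.simps by (intro D0_ex[OF pc] shift) simp
  qed (use s in \<open>auto intro!: D0.intros T0_tm_val\<close>)
qed

lemma proj_closed_imp_ACA0:
  assumes pc: proj_closed
  shows "M \<Turnstile>\<^sub>T ACA0"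
  unfolding model_of_def
proof (intro conjI ballI)
  fix p assume "p \<in> ACA0"
  then consider "p \<in> basic_axioms" | "p = set_induction" | "p \<in> arithmetical_comprehension"
    by (auto simp: ACA0_def)
  then show "M \<Turnstile> p"
  proof cases
    case 1
    then show ?thesis using rca by (auto simp: model_of_def RCA0_def)
  next
    case 2
    have ind: "b \<in> A" if "A \<in> Sets M" "\<zero> \<in> A" "\<forall>a. a \<in> A \<longrightarrow> sc a \<in> A" for A b
    proof (rule D0_induct[of "\<lambda>n. n \<in> A"])
      show "D0 (\<lambda>e. e 0 \<in> A)" by (intro D0_mem T0_var that)
    qed (use that in simp_all)
    show ?thesis unfolding 2 holds_def
    proof (intro allI impI)
      fix e :: "string \<Rightarrow> 'a" and s :: "string \<Rightarrow> 'a set" assume "range s \<subseteq> Sets M"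
      then have "s ''X'' \<in> Sets M" by auto
      from ind[OF this] show "sat M e s set_induction"
        by (simp only: set_induction_def sat.simps tm_val.simps fun_upd_same) blast
    qed
  next
    case 3
    then obtain x X q where q: "p = ExSet X (All x (Var x \<^bold>\<in> X \<^bold>\<longleftrightarrow> q))" "arithmetical q" "X \<notin> free_set_vars q"
      by (auto simp: arithmetical_comprehension_def)
    show ?thesis unfolding holds_def
    proof (intro allI impI)
      fix e :: "string \<Rightarrow> 'a" and s :: "string \<Rightarrow> 'a set" assume s: "range s \<subseteq> Sets M"
      obtain nm :: "string \<Rightarrow> nat" where nm: "inj nm" using string_enum by blast
      let ?f = "\<lambda>E i. if i = nm x then E 0 else e (inv nm i)"
      have "D0 (\<lambda>E. sat M (\<lambda>y. ?f E (nm y)) s q)"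
        by (intro D0_subst[of "\<lambda>e. sat M (\<lambda>x. e (nm x)) s q" ?f] T0_if T0_var T0_const D0_arithmetical pc nm s q)
      also have "(\<lambda>E. sat M (\<lambda>y. ?f E (nm y)) s q) = (\<lambda>E. sat M (e(x := E 0)) s q)"
        using nm by (intro ext arg_cong[of _ _ "\<lambda>e. sat M e s q"]) (auto simp: inj_eq)
      finally have "{a. sat M (e(x := a)) s q} \<in> Sets M" by (rule D0_comprehension)
      then show "sat M e s p" unfolding q sat.simps
        by (rule bexI[rotated]) (simp add: sat_set_fun_upd q(3))
    qed
  qed
qed (rule Sets_nonempty)

lemma ACA0_imp_proj_closed:
  assumes "M \<Turnstile>\<^sub>T ACA0"
  shows proj_closed
  unfolding proj_closed_def
proof
  fix Z assume Z: "Z \<in> Sets M"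
  let ?p = "Ex ''y'' (pair (Var ''x'') (Var ''y'') \<^bold>\<in> ''Z'')"
  have "ExSet ''X'' (All ''x'' (Var ''x'' \<^bold>\<in> ''X'' \<^bold>\<longleftrightarrow> ?p)) \<in> arithmetical_comprehension"
    unfolding arithmetical_comprehension_def by force
  then have "M \<Turnstile> ExSet ''X'' (All ''x'' (Var ''x'' \<^bold>\<in> ''X'' \<^bold>\<longleftrightarrow> ?p))"
    using assms by (auto simp: model_of_def ACA0_def)
  from this[unfolded holds_def, rule_format, of "\<lambda>_. Z" "\<lambda>_. \<zero>"] Z
  have "\<exists>A\<in>Sets M. \<forall>x. x \<in> A \<longleftrightarrow> (\<exists>y. pr x y \<in> Z)"
    by (simp add: tm_val_pair)
  then obtain A where "A \<in> Sets M" "\<forall>x. x \<in> A \<longleftrightarrow> (\<exists>y. pr x y \<in> Z)" ..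
  moreover then have "{x. \<exists>y. pr x y \<in> Z} = A" by auto
  ultimately show "{x. \<exists>y. pr x y \<in> Z} \<in> Sets M" by simp
qed

end

context rca
begin

section \<open>Graphs\<close>

definition graph_on :: "'a set \<Rightarrow> 'a set \<Rightarrow> bool" where
  "graph_on V E \<longleftrightarrow> (\<forall>z. z \<in> E \<longrightarrow> (\<exists>x y. z = pr x y \<and> x \<in> V \<and> y \<in> V)) \<and>
     (\<forall>x y. pr x y \<in> E \<longrightarrow> pr y x \<in> E) \<and> (\<forall>x. pr x x \<notin> E)"

definition unbounded :: "'a set \<Rightarrow> bool" where
  "unbounded V \<longleftrightarrow> \<not> (\<exists>k. \<forall>x. x \<in> V \<longrightarrow> x \<prec> k)"

definition traces :: "'a set \<Rightarrow> 'a set \<Rightarrow> 'a set \<Rightarrow> bool" where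
  "traces V E T \<longleftrightarrow>
     (\<forall>z. z \<in> T \<longrightarrow> (\<exists>i x. z = pr i x \<and> x \<in> V)) \<and>
     (\<forall>i. \<exists>x. pr i x \<in> T) \<and>
     (\<forall>i x y. pr i x \<in> T \<and> pr i y \<in> T \<longrightarrow> x = y) \<and>
     (\<forall>i j x. pr i x \<in> T \<and> pr j x \<in> T \<longrightarrow> i = j) \<and>
     (\<forall>x. x \<in> V \<longrightarrow> (\<exists>i. pr i x \<in> T)) \<and>
     (\<forall>i x y. pr i x \<in> T \<and> pr (sc i) y \<in> T \<longrightarrow> pr x y \<in> E)"

definition chordless_path :: "'a \<Rightarrow> 'a set \<Rightarrow> 'a set \<Rightarrow> 'a set \<Rightarrow> bool" where
  "chordless_path n V E P \<longleftrightarrow>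
     ((\<exists>k. \<forall>z. z \<in> P \<longrightarrow> z \<prec> k) \<and>
     (\<forall>z. z \<in> P \<longrightarrow> (\<exists>i x. z = pr i x \<and> x \<in> V)) \<and>
     (\<forall>i x y. pr i x \<in> P \<and> pr i y \<in> P \<longrightarrow> x = y) \<and>
     (\<forall>i. i \<prec> n \<longleftrightarrow> (\<exists>x. pr i x \<in> P)) \<and>
     (\<forall>i j x. pr i x \<in> P \<and> pr j x \<in> P \<longrightarrow> i = j) \<and>
     (\<forall>i x y. pr i x \<in> P \<and> pr (sc i) y \<in> P \<longrightarrow> pr x y \<in> E)) \<and>
     (\<forall>i j x y. pr i x \<in> P \<and> pr j y \<in> P \<longrightarrow> (pr x y \<in> E \<longleftrightarrow> i = sc j \<or> j = sc i))"

definition is_A :: "'a set \<Rightarrow> 'a set \<Rightarrow> bool" where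
  "is_A W F \<longleftrightarrow> (\<forall>z. z \<in> W) \<and> (\<forall>z. z \<in> F \<longleftrightarrow> (\<exists>n m. (n \<prec> m \<or> n = m) \<and>
     (z = pr (n \<oplus> n) (sc (m \<oplus> m)) \<or> z = pr (sc (m \<oplus> m)) (n \<oplus> n))))"

definition is_K :: "'a set \<Rightarrow> 'a set \<Rightarrow> bool" where
  "is_K W F \<longleftrightarrow> (\<forall>z. z \<in> W) \<and> (\<forall>z. z \<in> F \<longleftrightarrow> (\<exists>n m.
     z = pr (n \<oplus> n) (sc (m \<oplus> m)) \<or> z = pr (sc (m \<oplus> m)) (n \<oplus> n)))"

definition embeds :: "'a set \<Rightarrow> 'a set \<Rightarrow> 'a set \<Rightarrow> 'a set \<Rightarrow> 'a set \<Rightarrow> bool" where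
  "embeds V E W F G \<longleftrightarrow>
     (\<forall>z. z \<in> G \<longrightarrow> (\<exists>x u. z = pr x u \<and> x \<in> W \<and> u \<in> V)) \<and>
     (\<forall>x. x \<in> W \<longrightarrow> (\<exists>u. pr x u \<in> G)) \<and>
     (\<forall>x u v. pr x u \<in> G \<and> pr x v \<in> G \<longrightarrow> u = v) \<and>
     (\<forall>x y u. pr x u \<in> G \<and> pr y u \<in> G \<longrightarrow> x = y) \<and>
     (\<forall>x y u v. pr x y \<in> F \<and> pr x u \<in> G \<and> pr y v \<in> G \<longrightarrow> pr u v \<in> E)"

definition has_A :: "'a set \<Rightarrow> 'a set \<Rightarrow> bool" where
  "has_A V E \<longleftrightarrow> (\<exists>W\<in>Sets M. \<exists>F\<in>Sets M. is_A W F \<and> (\<exists>G\<in>Sets M. embeds V E W F G))"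

definition has_K :: "'a set \<Rightarrow> 'a set \<Rightarrow> bool" where
  "has_K V E \<longleftrightarrow> (\<exists>W\<in>Sets M. \<exists>F\<in>Sets M. is_K W F \<and> (\<exists>G\<in>Sets M. embeds V E W F G))"

definition has_chordless :: "'a \<Rightarrow> 'a set \<Rightarrow> 'a set \<Rightarrow> bool" where
  "has_chordless n V E \<longleftrightarrow> (\<exists>P\<in>Sets M. chordless_path n V E P)"

definition traceable :: "'a set \<Rightarrow> 'a set \<Rightarrow> bool" where
  "traceable V E \<longleftrightarrow> graph_on V E \<and> unbounded V \<and> (\<exists>T\<in>Sets M. traces V E T)"

lemma sat_graph_fm: "sat M e s graph_fm \<longleftrightarrow> graph_on (s ''V'') (s ''E'')"
  by (simp add: graph_fm_def graph_on_def Let_def tm_val_pair)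

lemma sat_infinite_fm: "sat M e s infinite_fm \<longleftrightarrow> unbounded (s ''V'')"
  by (simp add: infinite_fm_def unbounded_def)

lemma sat_traceable_fm: "sat M e s traceable_fm \<longleftrightarrow> (\<exists>T\<in>Sets M. traces (s ''V'') (s ''E'') T)"
  by (simp add: traceable_fm_def traces_def Let_def tm_val_pair)

lemma sat_has_chordless_path_fm:
  assumes "tm_vars n \<inter> {''i'', ''j'', ''k'', ''x'', ''y'', ''z''} = {}"
  shows "sat M e s (has_chordless_path_fm n) \<longleftrightarrow> has_chordless (tm_val M e n) (s ''V'') (s ''E'')"
proof -
  have "tm_val M (e(x := a)) n = tm_val M e n"
    if "x \<in> {''i'', ''j'', ''k'', ''x'', ''y'', ''z''}" for x e a
    using assms that by (intro tm_val_fun_upd) blast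
  then show ?thesis
    by (simp add: has_chordless_path_fm_def path_fm_def chordless_fm_def has_chordless_def
        chordless_path_def Let_def tm_val_pair)
qed

lemma sat_contains_A_fm: "sat M e s contains_A_fm \<longleftrightarrow> has_A (s ''V'') (s ''E'')"
  by (simp add: contains_A_fm_def is_A_fm_def subgraph_fm_def has_A_def is_A_def embeds_def Let_def
      tm_val_pair)

lemma sat_contains_K_fm: "sat M e s contains_K_fm \<longleftrightarrow> has_K (s ''V'') (s ''E'')"
  by (simp add: contains_K_fm_def is_K_fm_def subgraph_fm_def has_K_def is_K_def embeds_def Let_def
      tm_val_pair)

lemma holds_closed:
  assumes "\<And>e s. sat M e s p = b"
  shows "M \<Turnstile> p \<longleftrightarrow> b"
proof -
  obtain S where "S \<in> Sets M" using Sets_nonempty by auto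
  then have "range (\<lambda>_ :: string. S) \<subseteq> Sets M" by auto
  then show ?thesis unfolding holds_def assms by (iprover intro: iffI)
qed

lemma holds_long_paths_or_A: "M \<Turnstile> long_paths_or_A \<longleftrightarrow>
    (\<forall>V\<in>Sets M. \<forall>E\<in>Sets M. traceable V E \<longrightarrow> (\<forall>n. has_chordless n V E) \<or> has_A V E)"
  by (rule holds_closed)
     (simp add: long_paths_or_A_def sat_graph_fm sat_infinite_fm sat_traceable_fm sat_contains_A_fm
      sat_has_chordless_path_fm traceable_def)

abbreviation "four \<equiv> sc (sc (sc \<one>))"

lemma holds_no_4_path_implies_K: "M \<Turnstile> no_4_path_implies_K \<longleftrightarrow>
    (\<forall>V\<in>Sets M. \<forall>E\<in>Sets M. traceable V E \<and> \<not> has_chordless four V E \<longrightarrow> has_K V E)"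
  by (rule holds_closed)
     (simp add: no_4_path_implies_K_def sat_graph_fm sat_infinite_fm sat_traceable_fm sat_contains_K_fm
      sat_has_chordless_path_fm traceable_def)

text \<open>What the reversal uses of an embedded copy of \<open>A\<close> or of \<open>K\<^sub>\<omega>\<^sub>,\<^sub>\<omega>\<close>.\<close>

definition half_graph :: "'a set \<Rightarrow> ('a \<Rightarrow> 'a) \<Rightarrow> bool" where
  "half_graph E g \<longleftrightarrow> inj g \<and> (\<exists>G\<in>Sets M. \<forall>x u. pr x u \<in> G \<longleftrightarrow> u = g x) \<and>
     (\<forall>n m. n \<preceq> m \<longrightarrow> pr (g (n \<oplus> n)) (g (sc (m \<oplus> m))) \<in> E)"

text \<open>The assumption on \<open>F\<close> asks for the edges of \<open>A\<close>, which the
  complete bipartite graph has too, so both reversals continue from the same data.\<close>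

lemma embeds_half_graph:
  assumes emb: "embeds V E W F G" and G: "G \<in> Sets M" and W: "\<forall>z. z \<in> W"
    and F: "\<And>n m. n \<preceq> m \<Longrightarrow> pr (n \<oplus> n) (sc (m \<oplus> m)) \<in> F"
  shows "\<exists>g. half_graph E g"
proof -
  from emb W have "\<forall>x. \<exists>u. pr x u \<in> G" by (simp add: embeds_def)
  then obtain g where g: "\<And>x. pr x (g x) \<in> G" by metis
  from emb have uniq: "\<And>x u v. pr x u \<in> G \<Longrightarrow> pr x v \<in> G \<Longrightarrow> u = v"
    and inj: "\<And>x y u. pr x u \<in> G \<Longrightarrow> pr y u \<in> G \<Longrightarrow> x = y"
    and edge: "\<And>x y u v. pr x y \<in> F \<Longrightarrow> pr x u \<in> G \<Longrightarrow> pr y v \<in> G \<Longrightarrow> pr u v \<in> E"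
    unfolding embeds_def by blast+
  have "inj g" using inj g by (metis injI)
  moreover have "\<forall>x u. pr x u \<in> G \<longleftrightarrow> u = g x" using uniq g by blast
  ultimately show ?thesis unfolding half_graph_def using G edge[OF F g g] by blast
qed

lemma has_A_half_graph: "has_A V E \<Longrightarrow> \<exists>g. half_graph E g"
  unfolding has_A_def is_A_def
  by (elim bexE conjE, rule embeds_half_graph, assumption+) (auto simp: le_def)

lemma has_K_half_graph: "has_K V E \<Longrightarrow> \<exists>g. half_graph E g"
  unfolding has_K_def is_K_def
  by (elim bexE conjE, rule embeds_half_graph, assumption+) auto

end

section \<open>The reversal\<close>

context rca
begin

text \<open>A pigeonhole argument for nonstandard bounds. If all values from \<open>n\<close> on
  were below \<open>k\<close>, the set of these values would exist by bounded comprehension, and by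
  collection each would be taken before some \<open>b\<close>; the value at
  \<open>n \<oplus> b\<close> would then be repeated.\<close>

lemma injection_unbounded:
  assumes D: "Df2 R" and R: "\<And>m w. R m w \<longleftrightarrow> w = h m" and h: "inj h"
  shows "\<exists>m. n \<preceq> m \<and> k \<preceq> h m"
proof (rule ccontr)
  assume "\<nexists>m. n \<preceq> m \<and> k \<preceq> h m"
  then have below: "h m \<prec> k" if "n \<preceq> m" for m using that N.not_le by blast
  let ?S = "{i. i \<prec> k \<and> (\<exists>m. n \<preceq> m \<and> R m i)}"
  have S: "?S \<in> Sets M"
    by (rule bounded_Sigma1_comprehension) (intro D0_ints D0_app2[OF D])
  have "\<exists>m. i \<in> ?S \<longrightarrow> n \<preceq> m \<and> R m i" for i by blast
  then obtain b where b: "\<And>i. i \<prec> k \<Longrightarrow> \<exists>m. m \<prec> b \<and> (i \<in> ?S \<longrightarrow> n \<preceq> m \<and> R m i)"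
    using Sigma1_collection[of "\<lambda>i m. i \<in> ?S \<longrightarrow> n \<preceq> m \<and> R m i" k,
        OF D0_imp[OF D0_mem[OF T0_var S] D0_conj[OF D0_le[OF T0_const T0_var] D0_app2[OF D T0_var T0_var]]]]
    by blast
  have nb: "n \<preceq> n \<oplus> b" "b \<preceq> n \<oplus> b" by (auto simp: le_iff' add_commute')
  have lt: "h (n \<oplus> b) \<prec> k" using below nb(1) by blast
  then have "h (n \<oplus> b) \<in> ?S" using nb(1) R by blast
  then obtain m where "m \<prec> b" "h m = h (n \<oplus> b)" using b[OF lt] R by metis
  then have "n \<oplus> b \<prec> b" using h by (simp add: inj_eq)
  then show False using nb(2) by (meson N.not_less)
qed

text \<open>
  Enumerate the projection of \<open>Z\<close>: stage \<open>t = pr x y\<close> has value \<open>x\<close> if \<open>y\<close> is the first witness for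
  \<open>x\<close>, and every other stage \<open>t\<close> has value \<open>t\<close>. Two stages are adjacent if the least value between
  them is attained at one of them. Thus adjacency is comparability in a tree order, which excludes
  chordless 4-paths, and a stage has infinitely many neighbours only if no later value is smaller.
\<close>

definition event :: "'a set \<Rightarrow> 'a \<Rightarrow> 'a \<Rightarrow> bool" where
  "event Z t x \<longleftrightarrow> (\<exists>y. y \<preceq> t \<and> t = pr x y \<and> t \<in> Z \<and> (\<forall>y'. y' \<prec> y \<longrightarrow> pr x y' \<notin> Z))"

definition is_val :: "'a set \<Rightarrow> 'a \<Rightarrow> 'a \<Rightarrow> bool" where
  "is_val Z t w \<longleftrightarrow> event Z t w \<or> (w = t \<and> \<not> (\<exists>x. x \<preceq> t \<and> event Z t x))"

lemma is_val_D0: "Z \<in> Sets M \<Longrightarrow> Df2 (is_val Z)"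
  unfolding is_val_def event_def by (intro D0_ints)

lemma event_le: "event Z t x \<Longrightarrow> x \<preceq> t"
  using le_pr1 by (auto simp: event_def)

lemma is_val_ex1: "\<exists>!w. is_val Z t w"
proof (cases "\<exists>x. event Z t x")
  case True
  then obtain x where x: "event Z t x" by blast
  then have "is_val Z t x" by (simp add: is_val_def)
  moreover have "w = x" if "is_val Z t w" for w
  proof -
    have "event Z t w" using that x event_le[OF x] by (auto simp: is_val_def)
    with x show ?thesis by (auto simp: event_def)
  qed
  ultimately show ?thesis by blast
next
  case False
  then show ?thesis by (simp add: is_val_def)
qed

definition val :: "'a set \<Rightarrow> 'a \<Rightarrow> 'a" where
  "val Z t = (THE w. is_val Z t w)"

lemma is_val_iff: "is_val Z t w \<longleftrightarrow> w = val Z t"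
  unfolding val_def using is_val_ex1[of Z t] by (metis theI')

lemma val_le: "val Z t \<preceq> t"
  using is_val_iff[of Z t "val Z t"] event_le by (auto simp: is_val_def)

text \<open>Values never exceed their stages, so eliminating the function \<open>val\<close> costs
  bounded quantifiers only.\<close>

lemma val_le_D0:
  assumes "Z \<in> Sets M"
  shows "D0 (\<lambda>e. val Z (e 0) \<preceq> val Z (e 1))" (is "D0 ?P")
proof -
  have eq: "?P = (\<lambda>e. \<exists>a. a \<preceq> e 0 \<and> (\<exists>b. b \<preceq> e 1 \<and> is_val Z (e 0) a \<and> is_val Z (e 1) b \<and> a \<preceq> b))"
    using val_le by (auto simp: is_val_iff fun_eq_iff)
  show ?thesis unfolding eq by (intro D0_ints D0_app2[OF is_val_D0[OF assms]])
qed

lemma less_val_D0: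
  assumes "Z \<in> Sets M"
  shows "D0 (\<lambda>e. e 0 \<prec> val Z (e 1))" (is "D0 ?P")
proof -
  have eq: "?P = (\<lambda>e. \<exists>b. b \<preceq> e 1 \<and> is_val Z (e 1) b \<and> e 0 \<prec> b)"
    using val_le by (auto simp: is_val_iff fun_eq_iff)
  show ?thesis unfolding eq by (intro D0_ints D0_app2[OF is_val_D0[OF assms]])
qed

definition btw :: "'a \<Rightarrow> 'a \<Rightarrow> 'a \<Rightarrow> bool" where
  "btw a u b \<longleftrightarrow> (a \<preceq> u \<and> u \<preceq> b) \<or> (b \<preceq> u \<and> u \<preceq> a)"

definition dom :: "'a set \<Rightarrow> 'a \<Rightarrow> 'a \<Rightarrow> bool" where
  "dom Z a b \<longleftrightarrow> (\<forall>u. btw a u b \<longrightarrow> val Z a \<preceq> val Z u)"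

lemma btw_split: "btw a u c \<Longrightarrow> btw a u b \<or> btw b u c"
  using N.linear[of u b] unfolding btw_def by blast

lemma btw_sym: "btw a u b \<longleftrightarrow> btw b u a"
  by (auto simp: btw_def)

lemma btw_ends: "btw a a b" "btw a b b"
  using N.linear[of a b] by (auto simp: btw_def)

lemma dom_trans:
  assumes "dom Z a b" "dom Z b c" shows "dom Z a c"
  unfolding dom_def
proof (intro allI impI)
  fix u assume "btw a u c"
  then have "btw a u b \<or> btw b u c" by (rule btw_split)
  moreover have "val Z a \<preceq> val Z b" using assms(1) btw_ends by (simp add: dom_def)
  ultimately show "val Z a \<preceq> val Z u" using assms unfolding dom_def by (meson N.order_trans)
qed

text \<open>The segment from \<open>a\<close> to \<open>c\<close> is covered by the segments from
  \<open>a\<close> and from \<open>c\<close> to \<open>b\<close>. On these the values are bounded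
  below by those of \<open>a\<close> and \<open>c\<close>, so whichever of the two has the smaller
  value dominates the other.\<close>

lemma dom_tree:
  assumes "dom Z a b" "dom Z c b" shows "dom Z a c \<or> dom Z c a"
proof -
  have *: "dom Z a c" if "dom Z a b" "dom Z c b" "val Z a \<preceq> val Z c" for a c
    unfolding dom_def
  proof (intro allI impI)
    fix u assume "btw a u c"
    then have "btw a u b \<or> btw c u b" using btw_split btw_sym by blast
    then show "val Z a \<preceq> val Z u" using that unfolding dom_def by (meson N.order_trans)
  qed
  show ?thesis using *[OF assms] *[OF assms(2,1)] N.linear by blast
qed

lemma dom_D0:
  assumes "Z \<in> Sets M"
  shows "Df2 (dom Z)" (is "D0 ?P")
proof -
  have eq: "?P = (\<lambda>e. \<forall>u. u \<preceq> e 0 \<oplus> e 1 \<longrightarrow> (e 0 \<preceq> u \<and> u \<preceq> e 1 \<or> e 1 \<preceq> u \<and> u \<preceq> e 0) \<longrightarrow> val Z (e 0) \<preceq> val Z u)"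
  proof -
    have "u \<preceq> a \<oplus> b" if "btw a u b" for a u b
      using that unfolding btw_def by (metis N.order_trans add_commute' le_iff')
    then show ?thesis unfolding dom_def btw_def by (intro ext) blast
  qed
  show ?thesis unfolding eq by (intro D0_ints D0_app2[OF val_le_D0[OF assms]])
qed

definition tree_edges :: "'a set \<Rightarrow> 'a set" where
  "tree_edges Z = {z. \<exists>x. x \<preceq> z \<and> (\<exists>y. y \<preceq> z \<and> z = pr x y \<and> x \<noteq> y \<and> (dom Z x y \<or> dom Z y x))}"

lemma tree_edges_Sets: "Z \<in> Sets M \<Longrightarrow> tree_edges Z \<in> Sets M"
  unfolding tree_edges_def by (rule D0_comprehension) (intro D0_ints D0_app2[OF dom_D0])

lemma tree_edges_iff: "pr x y \<in> tree_edges Z \<longleftrightarrow> x \<noteq> y \<and> (dom Z x y \<or> dom Z y x)"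
  using le_pr1[of x y] le_pr2[of y x] by (auto simp: tree_edges_def)

lemma UNIV_Sets: "UNIV \<in> Sets M"
  using D0_comprehension[of "\<lambda>_. True"] D0_triv[of True] by simp

text \<open>The identity is a trace: no third stage lies between \<open>i\<close> and
  \<open>sc i\<close>, so the one with the smaller value dominates.\<close>

lemma tree_traceable: "traceable UNIV (tree_edges Z)"
  unfolding traceable_def
proof (intro conjI bexI)
  show "graph_on UNIV (tree_edges Z)"
    unfolding graph_on_def by (auto simp: tree_edges_iff) (auto simp: tree_edges_def)
  show "unbounded UNIV" unfolding unbounded_def by (metis N.less_irrefl UNIV_I)
  show "{z. \<exists>i. i \<preceq> z \<and> z = pr i i} \<in> Sets M"
    by (rule D0_comprehension) (intro D0_ints)
  have "i \<noteq> sc i \<and> (dom Z i (sc i) \<or> dom Z (sc i) i)" for i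
  proof -
    have "u = i \<or> u = sc i" if "btw i u (sc i)" for u
    proof -
      have "i \<preceq> sc i" by (simp add: one_le_iff le_iff')
      then have "i \<preceq> u" "u \<preceq> sc i" using that unfolding btw_def by (metis N.order_trans)+
      then show ?thesis by (metis N.less_le one_le_iff N.order_antisym)
    qed
    then have "dom Z i (sc i) \<or> dom Z (sc i) i"
      unfolding dom_def using N.linear[of "val Z i" "val Z (sc i)"] btw_sym N.order_refl by metis
    then show ?thesis using basic(3)[of i] add_left_cancel'[of i \<one> \<zero>] by simp
  qed
  then have "pr i (sc i) \<in> tree_edges Z" for i by (simp add: tree_edges_iff)
  then show "traces UNIV (tree_edges Z) {z. \<exists>i. i \<preceq> z \<and> z = pr i i}"
    unfolding traces_def using le_pr1 by auto
qed

text \<open>The middle edge decides. If \<open>b\<close> dominates \<open>c\<close>, the edge from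
  \<open>c\<close> to \<open>d\<close> makes \<open>b\<close> and \<open>d\<close> comparable, by
  transitivity or by the tree property; if \<open>c\<close> dominates \<open>b\<close>, the same
  happens to \<open>c\<close> and \<open>a\<close>.\<close>

lemma tree_no_chordless_4_path: "\<not> has_chordless four V (tree_edges Z)"
proof
  assume "has_chordless four V (tree_edges Z)"
  then obtain P where P: "chordless_path four V (tree_edges Z) P" by (auto simp: has_chordless_def)
  have "\<forall>i. i \<prec> four \<longleftrightarrow> (\<exists>x. pr i x \<in> P)"
    using P unfolding chordless_path_def by (elim conjE)
  then have dm: "\<And>i. i \<prec> four \<Longrightarrow> \<exists>x. pr i x \<in> P" by simp
  have "\<forall>i j x. pr i x \<in> P \<and> pr j x \<in> P \<longrightarrow> i = j"
    using P unfolding chordless_path_def by (elim conjE)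
  then have inj: "\<And>i j x. pr i x \<in> P \<Longrightarrow> pr j x \<in> P \<Longrightarrow> i = j" by blast
  have "\<forall>i j x y. pr i x \<in> P \<and> pr j y \<in> P \<longrightarrow> (pr x y \<in> tree_edges Z \<longleftrightarrow> i = sc j \<or> j = sc i)"
    using P unfolding chordless_path_def by (elim conjE)
  then have ch: "\<And>i j x y. pr i x \<in> P \<Longrightarrow> pr j y \<in> P \<Longrightarrow> pr x y \<in> tree_edges Z \<longleftrightarrow> i = sc j \<or> j = sc i"
    by blast
  have lt: "\<zero> \<prec> four" "\<one> \<prec> four" "sc \<one> \<prec> four" "sc (sc \<one>) \<prec> four"
    by (auto simp: basic(8) N.zero_less_one)
  obtain a b c d where v: "pr \<zero> a \<in> P" "pr \<one> b \<in> P" "pr (sc \<one>) c \<in> P" "pr (sc (sc \<one>)) d \<in> P"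
    using dm[OF lt(1)] dm[OF lt(2)] dm[OF lt(3)] dm[OF lt(4)] by blast
  have n02: "\<zero> \<noteq> sc \<one>" "\<zero> \<noteq> sc (sc \<one>)" "sc \<one> \<noteq> sc \<zero>"
    using basic(1)[of \<one>] basic(1)[of "sc \<one>"] basic(2)[of \<one> \<zero>] N.zero_neq_one by auto
  then have n13: "\<one> \<noteq> sc (sc \<one>)" "\<one> \<noteq> sc (sc (sc \<one>))" "sc (sc \<one>) \<noteq> sc \<one>"
    using basic(2)[of \<zero> "sc \<one>"] basic(2)[of \<zero> "sc (sc \<one>)"] basic(2)[of "sc \<one>" \<one>]
    by (auto simp: N.add_0_left)
  have ne: "a \<noteq> c" "b \<noteq> d" using inj[of \<zero> a "sc \<one>"] inj[of \<one> b "sc (sc \<one>)"] v n02 n13 by blast+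
  have e: "pr a b \<in> tree_edges Z" "pr b c \<in> tree_edges Z" "pr c d \<in> tree_edges Z"
    using ch[OF v(1,2)] ch[OF v(2,3)] ch[OF v(3,4)] by (simp_all add: N.add_0_left)
  have "pr a c \<notin> tree_edges Z" using ch[OF v(1,3)] n02 by simp
  moreover have "pr b d \<notin> tree_edges Z" using ch[OF v(2,4)] n13 by blast
  ultimately have nc: "\<not> dom Z a c" "\<not> dom Z c a" "\<not> dom Z b d" "\<not> dom Z d b"
    using ne by (auto simp: tree_edges_iff)
  from e(2) consider "dom Z b c" | "dom Z c b" by (auto simp: tree_edges_iff)
  then show False
  proof cases
    case 1
    from e(3) consider "dom Z c d" | "dom Z d c" by (auto simp: tree_edges_iff)
    then show False using dom_trans[OF 1] dom_tree[OF 1] nc by cases blast+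
  next
    case 2
    from e(1) consider "dom Z b a" | "dom Z a b" by (auto simp: tree_edges_iff)
    then show False using dom_trans[OF 2] dom_tree[OF 2] nc by cases blast+
  qed
qed

section \<open>True stages and the recovery of the projection\<close>

text \<open>A number \<open>x\<close> up to \<open>n\<close> is enumerated only at its first
  witness. Collection bounds these witnesses by \<open>b\<close>, so all such stages come before
  \<open>pr (sc n) b\<close>; the idle stages from there on have themselves as values and exceed
  \<open>n\<close>.\<close>

lemma val_unbounded:
  assumes Z: "Z \<in> Sets M"
  shows "\<exists>b. \<forall>u. b \<preceq> u \<longrightarrow> n \<prec> val Z u"
proof -
  let ?S = "{x. x \<prec> sc n \<and> (\<exists>y. pr x y \<in> Z)}"
  have S: "?S \<in> Sets M"
    by (rule bounded_Sigma1_comprehension) (intro D0_ints Z)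
  have "\<exists>y. x \<in> ?S \<longrightarrow> pr x y \<in> Z" for x by blast
  then obtain b where b: "\<And>x. x \<prec> sc n \<Longrightarrow> \<exists>y. y \<prec> b \<and> (x \<in> ?S \<longrightarrow> pr x y \<in> Z)"
    using Sigma1_collection[of "\<lambda>x y. x \<in> ?S \<longrightarrow> pr x y \<in> Z" "sc n",
        OF D0_imp[OF D0_mem[OF T0_var S] D0_mem[OF T0_pr[OF T0_var T0_var] Z]]]
    by blast
  have "n \<prec> val Z u" if u: "pr (sc n) b \<preceq> u" for u
  proof (rule ccontr)
    assume "\<not> n \<prec> val Z u"
    then have le: "val Z u \<prec> sc n" by (simp add: less_one_iff N.not_less)
    have "is_val Z u (val Z u)" by (simp add: is_val_iff)
    moreover have "val Z u \<noteq> u"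
      using le u le_pr1[of "sc n" b] by (metis N.le_less_trans N.less_irrefl N.order_trans)
    ultimately have "event Z u (val Z u)" by (auto simp: is_val_def)
    then obtain y where y: "u = pr (val Z u) y" "u \<in> Z" "\<forall>y'. y' \<prec> y \<longrightarrow> pr (val Z u) y' \<notin> Z"
      by (auto simp: event_def)
    then have "val Z u \<in> ?S" using le by auto metis
    then obtain y' where "y' \<prec> b" "pr (val Z u) y' \<in> Z" using b[OF le] by blast
    then have "y \<prec> b" using y(3) by (metis N.not_less N.le_less_trans)
    then have "u \<prec> pr (sc n) b" using le y(1) pr_less N.add_strict_mono by metis
    then show False using u by simp
  qed
  then show ?thesis by blast
qed

lemma projection_from_half_graph:
  assumes Z: "Z \<in> Sets M" and g: "half_graph (tree_edges Z) g"
  shows "{x. \<exists>y. pr x y \<in> Z} \<in> Sets M"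
proof -
  obtain G where G: "G \<in> Sets M" "\<And>x u. pr x u \<in> G \<longleftrightarrow> u = g x"
    using g by (auto simp: half_graph_def)
  have inj: "inj g" and edge: "\<And>n m. n \<preceq> m \<Longrightarrow> pr (g (n \<oplus> n)) (g (sc (m \<oplus> m))) \<in> tree_edges Z"
    using g by (auto simp: half_graph_def)
  have unb1: "\<exists>m. n \<preceq> m \<and> k \<preceq> g (sc (m \<oplus> m))" for n k
  proof (rule injection_unbounded[where R = "\<lambda>m w. pr (sc (m \<oplus> m)) w \<in> G"])
    show "D0 (\<lambda>e. pr (sc (e 0 \<oplus> e 0)) (e 1) \<in> G)" by (intro D0_ints G)
    show "inj (\<lambda>m. g (sc (m \<oplus> m)))"
      by (rule injI, rule double_inject, rule iffD1[OF basic(2)], rule injD[OF inj])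
  qed (rule G)
  have unb2: "\<exists>m. n \<preceq> m \<and> k \<preceq> g (m \<oplus> m)" for n k
  proof (rule injection_unbounded[where R = "\<lambda>m w. pr (m \<oplus> m) w \<in> G"])
    show "D0 (\<lambda>e. pr (e 0 \<oplus> e 0) (e 1) \<in> G)" by (intro D0_ints G)
    show "inj (\<lambda>m. g (m \<oplus> m))"
      by (rule injI, rule double_inject, rule injD[OF inj])
  qed (rule G)
  \<comment> \<open>A late neighbour \<open>?b\<close> has too large a value to dominate
    \<open>?a\<close>. So \<open>?a\<close> dominates it, and the values of all stages in between
    are at least that of \<open>?a\<close>.\<close>
  have true: "val Z (g (n \<oplus> n)) \<preceq> val Z u" if u: "g (n \<oplus> n) \<preceq> u" for n u
  proof -
    let ?a = "g (n \<oplus> n)"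
    obtain B where B: "\<And>v. B \<preceq> v \<Longrightarrow> val Z ?a \<prec> val Z v" using val_unbounded[OF Z] by blast
    obtain m where m: "n \<preceq> m" "u \<oplus> B \<preceq> g (sc (m \<oplus> m))" using unb1 by blast
    let ?b = "g (sc (m \<oplus> m))"
    have ub: "u \<preceq> ?b" "B \<preceq> ?b" using m(2) by (metis N.order_trans add_commute' le_iff')+
    have "dom Z ?a ?b \<or> dom Z ?b ?a" using edge[OF m(1)] by (simp add: tree_edges_iff)
    moreover have "\<not> dom Z ?b ?a" using B[OF ub(2)] btw_ends(2) unfolding dom_def by (meson N.not_less)
    ultimately have "dom Z ?a ?b" by blast
    moreover have "btw ?a u ?b" using u ub by (simp add: btw_def)
    ultimately show ?thesis by (simp add: dom_def)
  qed
  have ex_true: "\<exists>n. x \<prec> val Z (g (n \<oplus> n))" for x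
    using val_unbounded[OF Z, of x] unb2 by blast
  \<comment> \<open>The stage of the first witness has value \<open>x\<close>, so it must precede
    any true stage of larger value.\<close>
  have early: "\<exists>y. y \<preceq> g (n \<oplus> n) \<and> pr x y \<in> Z" if n: "x \<prec> val Z (g (n \<oplus> n))" and x: "\<exists>y. pr x y \<in> Z" for n x
  proof -
    obtain y0 where "pr x y0 \<in> Z" using x by blast
    moreover have "D0 (\<lambda>e. pr x (e 0) \<in> Z)" by (intro D0_ints Z)
    ultimately obtain y where y: "pr x y \<in> Z" "\<And>y'. y' \<prec> y \<Longrightarrow> pr x y' \<notin> Z"
      using D0_least[of "\<lambda>y. pr x y \<in> Z" y0] by metis
    then have "is_val Z (pr x y) x" using le_pr2 by (auto simp: is_val_def event_def)
    then have "val Z (pr x y) = x" by (simp add: is_val_iff)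
    then have "\<not> g (n \<oplus> n) \<preceq> pr x y" using true n by (metis N.not_less)
    then have "y \<preceq> g (n \<oplus> n)" using le_pr2[of y x] by (meson N.linear N.order_trans)
    then show ?thesis using y(1) by blast
  qed
  \<comment> \<open>Any true stage with value above \<open>x\<close> decides membership of
    \<open>x\<close>, so asking for some or for every such stage gives the same answer. The number
    \<open>w\<close> codes the index together with its vertex, since a single unbounded variable is
    allowed.\<close>
  let ?R = "\<lambda>x w. \<exists>n. n \<preceq> w \<and> (\<exists>a. a \<preceq> w \<and> w = pr n a \<and> pr (n \<oplus> n) a \<in> G \<and> x \<prec> val Z a \<and>
    (\<exists>y. y \<preceq> a \<and> pr x y \<in> Z))"
  let ?R' = "\<lambda>x w. \<forall>n. n \<preceq> w \<longrightarrow> (\<forall>a. a \<preceq> w \<longrightarrow> w = pr n a \<and> pr (n \<oplus> n) a \<in> G \<and> x \<prec> val Z a \<longrightarrow>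
    (\<exists>y. y \<preceq> a \<and> pr x y \<in> Z))"
  have R: "(\<exists>w. ?R x w) \<longleftrightarrow> (\<exists>y. pr x y \<in> Z)" for x
  proof
    assume x: "\<exists>y. pr x y \<in> Z"
    obtain n where n: "x \<prec> val Z (g (n \<oplus> n))" using ex_true by blast
    have "?R x (pr n (g (n \<oplus> n)))"
      using n early[OF n x] le_pr1[of n "g (n \<oplus> n)"] le_pr2[of "g (n \<oplus> n)" n] G(2) by blast
    then show "\<exists>w. ?R x w" by blast
  qed blast
  moreover have "(\<forall>w. ?R' x w) \<longleftrightarrow> (\<exists>y. pr x y \<in> Z)" for x
  proof
    assume *: "\<forall>w. ?R' x w"
    obtain n where n: "x \<prec> val Z (g (n \<oplus> n))" using ex_true by blast
    show "\<exists>y. pr x y \<in> Z"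
      using *[rule_format, of n "pr n (g (n \<oplus> n))" "g (n \<oplus> n)"] n G(2)
        le_pr1[of n "g (n \<oplus> n)"] le_pr2[of "g (n \<oplus> n)" n] by blast
  next
    assume x: "\<exists>y. pr x y \<in> Z"
    show "\<forall>w. ?R' x w" using early[OF _ x] by (auto simp: G(2))
  qed
  ultimately have eq: "(\<exists>w. ?R x w) \<longleftrightarrow> (\<forall>w. ?R' x w)" for x by simp
  have "{x. \<exists>w. ?R x w} \<in> Sets M"
    by (rule Delta1_comprehension[of ?R ?R', OF _ _ eq]; intro D0_ints G D0_app2[OF less_val_D0[OF Z]] Z)
  then show ?thesis by (simp only: R)
qed

lemma reversal:
  assumes "\<And>Z. Z \<in> Sets M \<Longrightarrow> \<exists>g. half_graph (tree_edges Z) g"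
  shows proj_closed
  using assms projection_from_half_graph unfolding proj_closed_def by blast

text \<open>In the tree graph the alternative of long chordless paths already fails at length four,
  so a copy of \<open>A\<close> remains.\<close>

lemma long_paths_or_A_imp: "M \<Turnstile> long_paths_or_A \<Longrightarrow> proj_closed"
  unfolding holds_long_paths_or_A
  by (rule reversal) (meson UNIV_Sets has_A_half_graph tree_edges_Sets tree_no_chordless_4_path tree_traceable)

lemma no_4_path_implies_K_imp: "M \<Turnstile> no_4_path_implies_K \<Longrightarrow> proj_closed"
  unfolding holds_no_4_path_implies_K
  by (rule reversal) (meson UNIV_Sets has_K_half_graph tree_edges_Sets tree_no_chordless_4_path tree_traceable)

end

section \<open>Definable functions in models of arithmetical comprehension\<close>

locale aca = rca +
  assumes pc: proj_closed
begin

text \<open>Functions with definable graph. By \<open>DA_subst\<close> they may replace variables in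
  any definable relation, so \<open>intro\<close> treats them like basic terms.\<close>

definition Fn :: "((nat \<Rightarrow> 'a) \<Rightarrow> 'a) \<Rightarrow> bool" where
  "Fn t \<longleftrightarrow> D0 (\<lambda>e. e 0 = t (\<lambda>i. e (Suc i)))"

lemmas DA_ex = D0_ex[OF pc]
lemmas DA_all = D0_all[OF pc]

lemma Fn_T0: "T0 t \<Longrightarrow> Fn t"
  unfolding Fn_def by (intro D0_eq T0_var T0_shift)

lemma Fn_var: "Fn (\<lambda>e. e i)"
  by (intro Fn_T0 T0_var)

lemma Fn_const: "Fn (\<lambda>e. c)"
  by (intro Fn_T0 T0_const)

lemma Fn_shift:
  assumes "Fn t" shows "Fn (\<lambda>e. t (\<lambda>i. e (Suc i)))"
proof -
  have "D0 (\<lambda>e. (\<lambda>e. e 0 = t (\<lambda>i. e (Suc i))) (cons (e 0) (\<lambda>i. e (Suc (Suc i)))))"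
    using assms unfolding Fn_def by (rule D0_subst) (intro T0_cons T0_var)
  then show ?thesis by (simp add: Fn_def)
qed

lemma D0_shift:
  assumes "D0 P" shows "D0 (\<lambda>e. P (\<lambda>i. e (Suc i)))"
  using assms by (rule D0_subst) (rule T0_var)

lemma DA_env:
  assumes D: "D0 (\<lambda>e. R (e 0) (\<lambda>i. e (Suc i)))" and t: "Fn t"
  shows "D0 (\<lambda>e. R (t e) e)"
proof -
  have eq: "(\<lambda>e. R (t e) e) = (\<lambda>e. \<exists>a. a = t e \<and> R a e)" by simp
  show ?thesis unfolding eq
    by (rule DA_ex[where Q = "\<lambda>a e. a = t e \<and> R a e"], rule D0_conj, rule t[unfolded Fn_def], rule D)
qed

text \<open>Finitely many arguments matter, and they are replaced one at a time. The inserted terms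
  read their own arguments shifted by \<open>n\<close>, out of reach of the slots still being
  replaced; reading index \<open>i - n\<close> at the end undoes the shift.\<close>

lemma DA_subst:
  assumes D: "D0 Q" and f: "\<And>i. Fn (\<lambda>e. f e i)"
  shows "D0 (\<lambda>e. Q (f e))"
proof -
  obtain n where n: "dep n Q" using D0_dep[OF D] by blast
  have "k \<le> n \<Longrightarrow> D0 (\<lambda>e. Q (\<lambda>i. if i < k then f (\<lambda>j. e (n + j)) i else e i))" for k
  proof (induction k)
    case 0
    show ?case using D by simp
  next
    case (Suc k)
    let ?g = "\<lambda>e i. if i = k then e 0 else e (Suc i)"
    let ?R = "\<lambda>a e. Q (\<lambda>i. if i < k then f (\<lambda>j. e (n + j)) i else if i = k then a else e i)"
    have k: "D0 (\<lambda>e. Q (\<lambda>i. if i < k then f (\<lambda>j. e (n + j)) i else e i))"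
      using Suc by simp
    have "D0 (\<lambda>e. (\<lambda>e. Q (\<lambda>i. if i < k then f (\<lambda>j. e (n + j)) i else e i)) (?g e))"
      using k by (rule D0_subst) (intro T0_if T0_var)
    also have "(\<lambda>e. (\<lambda>e. Q (\<lambda>i. if i < k then f (\<lambda>j. e (n + j)) i else e i)) (?g e)) =
        (\<lambda>e. ?R (e 0) (\<lambda>i. e (Suc i)))"
    proof
      fix e
      have "f (\<lambda>j. ?g e (n + j)) = f (\<lambda>j. e (Suc (n + j)))"
        using Suc.prems by (intro arg_cong[of _ _ f]) auto
      then show "Q (\<lambda>i. if i < k then f (\<lambda>j. ?g e (n + j)) i else ?g e i) = ?R (e 0) (\<lambda>i. e (Suc i))"
        by (intro arg_cong[of _ _ Q]) (auto simp: fun_eq_iff)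
    qed
    finally have R: "D0 (\<lambda>e. ?R (e 0) (\<lambda>i. e (Suc i)))" .
    have "D0 (\<lambda>E. (\<lambda>e. e 0 = f (\<lambda>i. e (Suc i)) k) (cons (E 0) (\<lambda>j. E (Suc (n + j)))))"
      using f[of k] unfolding Fn_def by (rule D0_subst) (intro T0_cons T0_var)
    then have t: "Fn (\<lambda>e. f (\<lambda>j. e (n + j)) k)"
      by (simp add: Fn_def)
    have "D0 (\<lambda>e. ?R (f (\<lambda>j. e (n + j)) k) e)"
      by (rule DA_env[of ?R, OF R t])
    also have "(\<lambda>e. ?R (f (\<lambda>j. e (n + j)) k) e) =
        (\<lambda>e. Q (\<lambda>i. if i < Suc k then f (\<lambda>j. e (n + j)) i else e i))"
      by (intro ext arg_cong[of _ _ Q]) (auto simp: fun_eq_iff less_Suc_eq)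
    finally show ?case .
  qed
  from this[OF order_refl]
  have "D0 (\<lambda>e. (\<lambda>e. Q (\<lambda>i. if i < n then f (\<lambda>j. e (n + j)) i else e i)) (\<lambda>i. e (i - n)))"
    by (rule D0_subst) (rule T0_var)
  also have "(\<lambda>e. (\<lambda>e. Q (\<lambda>i. if i < n then f (\<lambda>j. e (n + j)) i else e i)) (\<lambda>i. e (i - n))) = (\<lambda>e. Q (f e))"
    using n by (auto simp: fun_eq_iff dep_def)
  finally show ?thesis .
qed

lemma Fn_if0: "Fn t \<Longrightarrow> Fn u \<Longrightarrow> Fn (\<lambda>e. if b then t e else u e)"
  by (cases b) auto

lemma DA_app1: "Df1 P \<Longrightarrow> Fn t \<Longrightarrow> D0 (\<lambda>e. P (t e))"
  using DA_subst[of "\<lambda>e. P (e 0)" "\<lambda>e i. t e"] by simp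

lemma DA_app2: "Df2 P \<Longrightarrow> Fn t \<Longrightarrow> Fn u \<Longrightarrow> D0 (\<lambda>e. P (t e) (u e))"
  using DA_subst[of "\<lambda>e. P (e 0) (e 1)" "\<lambda>e i. if i = 0 then t e else u e"] by (simp add: Fn_if0)

lemma DA_app3:
  "D0 (\<lambda>e. P (e 0) (e 1) (e 2)) \<Longrightarrow> Fn t \<Longrightarrow> Fn u \<Longrightarrow> Fn v \<Longrightarrow> D0 (\<lambda>e. P (t e) (u e) (v e))"
  using DA_subst[of "\<lambda>e. P (e 0) (e 1) (e 2)" "\<lambda>e i. if i = 0 then t e else if i = 1 then u e else v e"]
  by (simp add: Fn_if0)

lemma DA_app4:
  "D0 (\<lambda>e. P (e 0) (e 1) (e 2) (e 3)) \<Longrightarrow> Fn t \<Longrightarrow> Fn u \<Longrightarrow> Fn v \<Longrightarrow> Fn w \<Longrightarrow>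
   D0 (\<lambda>e. P (t e) (u e) (v e) (w e))"
  using DA_subst[of "\<lambda>e. P (e 0) (e 1) (e 2) (e 3)"
      "\<lambda>e i. if i = 0 then t e else if i = 1 then u e else if i = 2 then v e else w e"]
  by (simp add: Fn_if0)

lemma Fn_app1: "D0 (\<lambda>e. e 0 = h (e 1)) \<Longrightarrow> Fn t \<Longrightarrow> Fn (\<lambda>e. h (t e))"
  unfolding Fn_def[of "\<lambda>e. h (t e)"]
  by (rule DA_app2[of "\<lambda>a b. a = h b"]) (auto intro: Fn_var Fn_shift)

lemma Fn_app2: "D0 (\<lambda>e. e 0 = h (e 1) (e 2)) \<Longrightarrow> Fn t \<Longrightarrow> Fn u \<Longrightarrow> Fn (\<lambda>e. h (t e) (u e))"
  unfolding Fn_def[of "\<lambda>e. h (t e) (u e)"]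
  by (rule DA_app3[of "\<lambda>a b c. a = h b c"]) (auto intro: Fn_var Fn_shift)

lemma Fn_app3:
  "D0 (\<lambda>e. e 0 = h (e 1) (e 2) (e 3)) \<Longrightarrow> Fn t \<Longrightarrow> Fn u \<Longrightarrow> Fn v \<Longrightarrow> Fn (\<lambda>e. h (t e) (u e) (v e))"
  unfolding Fn_def[of "\<lambda>e. h (t e) (u e) (v e)"]
  by (rule DA_app4[of "\<lambda>a b c d. a = h b c d"]) (auto intro: Fn_var Fn_shift)

lemma DA_eq: "Fn t \<Longrightarrow> Fn u \<Longrightarrow> D0 (\<lambda>e. t e = u e)"
  by (rule DA_app2[of "(=)"]) (intro D0_ints)

lemma DA_less: "Fn t \<Longrightarrow> Fn u \<Longrightarrow> D0 (\<lambda>e. t e \<prec> u e)"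
  by (rule DA_app2[of "(\<prec>)"]) (intro D0_ints)

lemma DA_le: "Fn t \<Longrightarrow> Fn u \<Longrightarrow> D0 (\<lambda>e. t e \<preceq> u e)"
  by (rule DA_app2[of "(\<preceq>)"]) (intro D0_ints)

lemma DA_mem: "Fn t \<Longrightarrow> A \<in> Sets M \<Longrightarrow> D0 (\<lambda>e. t e \<in> A)"
  by (rule DA_app1[of "\<lambda>a. a \<in> A"]) (intro D0_ints)

lemma Fn_add: "Fn t \<Longrightarrow> Fn u \<Longrightarrow> Fn (\<lambda>e. t e \<oplus> u e)"
  by (rule Fn_app2) (intro D0_ints)

lemma Fn_mul: "Fn t \<Longrightarrow> Fn u \<Longrightarrow> Fn (\<lambda>e. t e \<otimes> u e)"
  by (rule Fn_app2) (intro D0_ints)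

lemma Fn_pr: "Fn t \<Longrightarrow> Fn u \<Longrightarrow> Fn (\<lambda>e. pr (t e) (u e))"
  by (rule Fn_app2) (intro D0_ints)

lemma Fn_if:
  assumes "D0 P" "Fn t" "Fn u"
  shows "Fn (\<lambda>e. if P e then t e else u e)"
proof -
  have eq: "(\<lambda>e :: nat \<Rightarrow> 'a. e 0 = (if P (\<lambda>i. e (Suc i)) then t (\<lambda>i. e (Suc i)) else u (\<lambda>i. e (Suc i)))) =
    (\<lambda>e. (P (\<lambda>i. e (Suc i)) \<and> e 0 = t (\<lambda>i. e (Suc i))) \<or> (\<not> P (\<lambda>i. e (Suc i)) \<and> e 0 = u (\<lambda>i. e (Suc i))))"
    by auto
  show ?thesis unfolding Fn_def eq
    using assms(2,3)[unfolded Fn_def] D0_shift[OF assms(1)] by (intro D0_disj D0_conj D0_not)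
qed

lemma DA_El: "Fn t \<Longrightarrow> Fn u \<Longrightarrow> Fn v \<Longrightarrow> D0 (\<lambda>e. El (t e) (u e) (v e))"
  by (rule DA_app3[OF El_D0])

text \<open>Minimisation as definable choice; the default zero makes it total.\<close>

definition Lst :: "('a \<Rightarrow> bool) \<Rightarrow> 'a" where
  "Lst P = (if \<exists>c. P c then THE c. P c \<and> (\<forall>d. d \<prec> c \<longrightarrow> \<not> P d) else \<zero>)"

lemma Lst_eq: "P c \<Longrightarrow> (\<And>d. d \<prec> c \<Longrightarrow> \<not> P d) \<Longrightarrow> Lst P = c"
  unfolding Lst_def using less_linear' by (auto intro!: the_equality)

lemma Lst_props:
  assumes "Df1 P" "\<exists>c. P c"
  shows "P (Lst P)" "d \<prec> Lst P \<Longrightarrow> \<not> P d"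
proof -
  obtain c where c: "P c" "\<And>d. d \<prec> c \<Longrightarrow> \<not> P d"
    using assms(2) D0_least[OF assms(1)] by metis
  then show "P (Lst P)" "d \<prec> Lst P \<Longrightarrow> \<not> P d" using Lst_eq[of P c] by auto
qed

lemma Fn_Lst:
  assumes D: "D0 (\<lambda>e. Q (e 0) (\<lambda>i. e (Suc i)))"
  shows "Fn (\<lambda>e. Lst (\<lambda>a. Q a e))"
proof -
  have inst: "D0 (\<lambda>e'. Q (e' 0) e)" for e
    using D0_subst[OF D, of "\<lambda>e'. cons (e' 0) e"] by (simp add: T0_cons T0_var T0_const)
  have *: "w = Lst (\<lambda>a. Q a e) \<longleftrightarrow> (Q w e \<and> (\<forall>d. d \<prec> w \<longrightarrow> \<not> Q d e)) \<or> (w = \<zero> \<and> \<not> (\<exists>a. Q a e))" for w e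
  proof (cases "\<exists>a. Q a e")
    case True
    note p = Lst_props[OF inst[of e] True]
    show ?thesis
    proof
      assume "w = Lst (\<lambda>a. Q a e)"
      then show "(Q w e \<and> (\<forall>d. d \<prec> w \<longrightarrow> \<not> Q d e)) \<or> (w = \<zero> \<and> \<not> (\<exists>a. Q a e))"
        using p by blast
    next
      assume "(Q w e \<and> (\<forall>d. d \<prec> w \<longrightarrow> \<not> Q d e)) \<or> (w = \<zero> \<and> \<not> (\<exists>a. Q a e))"
      with True have "Q w e \<and> (\<forall>d. d \<prec> w \<longrightarrow> \<not> Q d e)" by blast
      then show "w = Lst (\<lambda>a. Q a e)" by (intro Lst_eq[symmetric]) blast+
    qed
  qed (simp add: Lst_def)
  have D': "D0 (\<lambda>e. Q (e 0) (\<lambda>i. e (Suc (Suc i))))"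
    using D0_subst[OF D, of "\<lambda>e. cons (e 0) (\<lambda>i. e (Suc (Suc i)))"] by (simp add: T0_cons T0_var)
  show ?thesis unfolding Fn_def *
    by (intro D0_disj D0_conj D0_not DA_eq DA_less Fn_var Fn_const D0_imp DA_all DA_ex D D')
qed

lemmas DA_intros = Fn_var Fn_const Fn_add Fn_mul Fn_pr Fn_if Fn_Lst DA_eq DA_less DA_le DA_mem DA_El
  D0_not D0_conj D0_disj D0_imp D0_iff DA_ex DA_all

end

context aca
begin

abbreviation Fd1 :: "('a \<Rightarrow> 'a) \<Rightarrow> bool" where "Fd1 f \<equiv> D0 (\<lambda>e. e 0 = f (e 1))"

lemma Fd1I: "Fn (\<lambda>e. f (e 0)) \<Longrightarrow> Fd1 f"
  by (simp add: Fn_def)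

text \<open>A common threshold for \<open>k\<close> eventual statements, \<open>k\<close> possibly
  nonstandard. Collection applies since the universal statement over \<open>z\<close> is itself
  definable in this locale.\<close>

lemma eventually_collect:
  assumes D: "Df2 R" and R: "\<And>i. i \<prec> k \<Longrightarrow> \<exists>y. \<forall>z. y \<preceq> z \<longrightarrow> R i z"
  shows "\<exists>y. \<forall>z. y \<preceq> z \<longrightarrow> (\<forall>i. i \<prec> k \<longrightarrow> R i z)"
proof -
  have D': "Df2 (\<lambda>i y. \<forall>z. y \<preceq> z \<longrightarrow> R i z)" by (intro DA_intros DA_app2[OF D])
  obtain b where b: "\<And>i. i \<prec> k \<Longrightarrow> \<exists>y. y \<prec> b \<and> (\<forall>z. y \<preceq> z \<longrightarrow> R i z)"
    by (rule Sigma1_collection[OF D', of k]) (rule R, assumption, rule that)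
  have "R i z" if bz: "b \<preceq> z" and ik: "i \<prec> k" for i z
  proof -
    obtain y where y: "y \<prec> b" "\<forall>z. y \<preceq> z \<longrightarrow> R i z" using b[OF ik] by blast
    have "y \<preceq> z" using y(1) bz by order
    with y(2) show ?thesis by blast
  qed
  then show ?thesis by blast
qed

subsection \<open>Codes of finite sequences and recursion\<close>

text \<open>Every number is a sequence: a pair of \<open>c\<close> and \<open>m\<close> codes a set
  by divisibility, and the set is read as a function through its least values, zero being the
  default.\<close>

definition dec :: "'a \<Rightarrow> 'a \<Rightarrow> 'a" where
  "dec z i = Lst (\<lambda>y. \<exists>c m. z = pr c m \<and> El c m (pr i y))"

lemma Fn_dec: "Fn t \<Longrightarrow> Fn u \<Longrightarrow> Fn (\<lambda>e. dec (t e) (u e))"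
proof (rule Fn_app2[of dec])
  have "Fn (\<lambda>e. dec (e 0) (e 1))" unfolding dec_def by (intro DA_intros)
  then show "D0 (\<lambda>e. e 0 = dec (e 1) (e 2))" by (simp add: Fn_def numeral_2_eq_2)
qed

text \<open>Collection bounds the graph of \<open>f\<close> up to \<open>k\<close>, so it has a
  code. The code is exact below \<open>K\<close>, hence no number smaller than \<open>f i\<close> is
  decoded by accident.\<close>

lemma code_exists:
  assumes f: "Fd1 f"
  shows "\<exists>z. \<forall>i. i \<preceq> k \<longrightarrow> dec z i = f i"
proof -
  have D: "Df2 (\<lambda>i w. w = pr i (f i))" by (intro DA_intros Fn_app1[OF f])
  obtain K where K: "\<And>i. i \<prec> sc k \<Longrightarrow> \<exists>y. y \<prec> K \<and> y = pr i (f i)"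
    by (rule Sigma1_collection[OF D, of "sc k"]) (blast, rule that)
  have "Df2 (\<lambda>w y. \<exists>i. i \<preceq> k \<and> w = pr i (f i))" by (intro DA_intros Fn_app1[OF f])
  then obtain c m where cm: "\<forall>w. w \<prec> K \<longrightarrow> (El c m w \<longleftrightarrow> (\<exists>y::'a. \<exists>i. i \<preceq> k \<and> w = pr i (f i)))"
    using bounded_coding[of "\<lambda>w y. \<exists>i. i \<preceq> k \<and> w = pr i (f i)" K] by blast
  have "dec (pr c m) i = f i" if i: "i \<preceq> k" for i
  proof -
    have lt: "pr i (f i) \<prec> K" using K[of i] i by (simp add: less_one_iff)
    have eq: "dec (pr c m) i = Lst (\<lambda>y. El c m (pr i y))" by (simp add: dec_def)
    show ?thesis unfolding eq
    proof (rule Lst_eq)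
      show "El c m (pr i (f i))" using cm lt i by blast
      fix d assume d: "d \<prec> f i"
      then have "pr i d \<prec> K" using pr_mono[OF d, of i] lt by order
      moreover have "\<not> (\<exists>j. j \<preceq> k \<and> pr i d = pr j (f j))" using d by auto
      ultimately show "\<not> El c m (pr i d)" using cm by blast
    qed
  qed
  then show ?thesis by blast
qed

text \<open>Taking the least successor turns the choice into a recursion. Its finite approximations
  are coded sequences, which exist by induction and agree where they overlap, and \<open>f\<close>
  reads its values from the least ones.\<close>

lemma dependent_choice:
  assumes S: "Df1 S" and P: "Df2 P" and a: "S a"
    and step: "\<And>a. S a \<Longrightarrow> \<exists>b. S b \<and> P a b"
  shows "\<exists>f. Fd1 f \<and> f \<zero> = a \<and> (\<forall>i. S (f i) \<and> P (f i) (f (sc i)))"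
proof -
  define F where "F a = Lst (\<lambda>b. S b \<and> P a b)" for a
  have "Fn (\<lambda>e. F (e 0))" unfolding F_def by (intro DA_intros DA_app1[OF S] DA_app2[OF P])
  then have FF: "Fd1 F" by (rule Fd1I)
  have F: "S (F b) \<and> P b (F b)" if "S b" for b
  proof -
    have "Df1 (\<lambda>c. S c \<and> P b c)" by (intro DA_intros DA_app1[OF S] DA_app2[OF P])
    from Lst_props(1)[OF this step[OF that]] show ?thesis by (simp add: F_def)
  qed
  define seq where "seq z k \<longleftrightarrow> dec z \<zero> = a \<and> (\<forall>i. i \<prec> k \<longrightarrow> dec z (sc i) = F (dec z i))" for z k
  have seqD: "Df2 seq" unfolding seq_def by (intro DA_intros Fn_dec Fn_app1[OF FF])
  have ex: "\<exists>z. seq z k" (is "?H k") for k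
  proof (rule D0_induct[of ?H])
    show "Df1 ?H" by (intro DA_intros DA_app2[OF seqD])
    have "Fd1 (\<lambda>_. a)" by (intro Fd1I DA_intros)
    then obtain z where "\<forall>i. i \<preceq> \<zero> \<longrightarrow> dec z i = a" using code_exists[of "\<lambda>_. a"] by blast
    then show "\<exists>z. seq z \<zero>" by (auto simp: seq_def)
    fix k assume "\<exists>z. seq z k"
    then obtain z where z: "seq z k" by blast
    let ?h = "\<lambda>i. if i \<preceq> k then dec z i else F (dec z k)"
    have "Fd1 ?h" by (intro Fd1I DA_intros Fn_dec Fn_app1[OF FF])
    then obtain z' where z': "\<And>i. i \<preceq> sc k \<Longrightarrow> dec z' i = ?h i" using code_exists[of ?h "sc k"] by blast
    have "dec z' (sc i) = F (dec z' i)" if i: "i \<prec> sc k" for i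
    proof -
      have ik: "i \<preceq> k" using i by (simp add: less_one_iff)
      have d: "dec z' i = dec z i" using z'[of i] i ik by (simp add: N.less_imp_le)
      have d1: "dec z' (sc i) = ?h (sc i)" using z' ik by simp
      show ?thesis
      proof (cases "i = k")
        case True
        have "\<not> sc k \<preceq> k" by (simp add: one_le_iff)
        then show ?thesis using d d1 True by simp
      next
        case False
        then have "i \<prec> k" using ik by order
        then show ?thesis using d d1 z by (simp add: seq_def one_le_iff)
      qed
    qed
    moreover have "dec z' \<zero> = a" using z'[of \<zero>] z by (simp add: seq_def)
    ultimately show "\<exists>z. seq z (sc k)" unfolding seq_def by blast
  qed
  have uniq: "i \<preceq> k \<longrightarrow> i \<preceq> k' \<longrightarrow> dec z i = dec z' i" (is "?H i") if "seq z k" "seq z' k'" for i z k z' k'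
  proof (rule D0_induct[of ?H])
    show "Df1 ?H" by (intro DA_intros Fn_dec)
    show "\<zero> \<preceq> k \<longrightarrow> \<zero> \<preceq> k' \<longrightarrow> dec z \<zero> = dec z' \<zero>" using that by (simp add: seq_def)
    fix i assume "i \<preceq> k \<longrightarrow> i \<preceq> k' \<longrightarrow> dec z i = dec z' i"
    then show "sc i \<preceq> k \<longrightarrow> sc i \<preceq> k' \<longrightarrow> dec z (sc i) = dec z' (sc i)"
      using that by (simp add: seq_def one_le_iff N.less_imp_le)
  qed
  define f where "f i = dec (Lst (\<lambda>z. seq z i)) i" for i
  have "Fn (\<lambda>e. f (e 0))" unfolding f_def by (intro Fn_dec DA_intros DA_app2[OF seqD])
  then have fF: "Fd1 f" by (rule Fd1I)
  have L: "seq (Lst (\<lambda>z. seq z i)) i" for i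
    by (rule Lst_props(1)[OF _ ex]) (intro DA_app2[OF seqD] DA_intros)
  have f0: "f \<zero> = a" using L[of \<zero>] by (simp add: f_def seq_def)
  have f1: "f (sc i) = F (f i)" for i
  proof -
    let ?z = "Lst (\<lambda>z. seq z (sc i))"
    have "dec ?z (sc i) = F (dec ?z i)" using L[of "sc i"] by (simp add: seq_def less_one_iff)
    moreover have "dec ?z i = f i"
      using uniq[OF L[of "sc i"] L[of i], of i] by (simp add: f_def)
    ultimately show ?thesis by (simp add: f_def)
  qed
  have Sf: "S (f i)" for i
  proof (rule D0_induct[where P = "\<lambda>i. S (f i)"])
    show "Df1 (\<lambda>i. S (f i))" by (intro DA_app1[OF S] Fn_app1[OF fF] DA_intros)
  qed (use f0 f1 a F in simp_all)
  have "P (f i) (f (sc i))" for i using F[OF Sf, of i] by (simp add: f1)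
  then show ?thesis using fF f0 Sf by blast
qed

lemma increasing:
  assumes f: "Fd1 f" "\<And>i. f i \<prec> f (sc i)"
  shows "i \<prec> j \<Longrightarrow> f i \<prec> f j" "i \<preceq> f i" "inj f"
proof -
  have "i \<prec> j \<longrightarrow> f i \<prec> f j" (is "?H j") for i j
  proof (rule D0_induct[of ?H])
    show "Df1 ?H" by (intro DA_intros Fn_app1[OF f(1)])
    fix j assume "i \<prec> j \<longrightarrow> f i \<prec> f j"
    then show "i \<prec> sc j \<longrightarrow> f i \<prec> f (sc j)" using f(2)[of j] by (auto simp: basic(8))
  qed simp
  then have mono: "f i \<prec> f j" if "i \<prec> j" for i j using that by blast
  show "i \<prec> j \<Longrightarrow> f i \<prec> f j" by (rule mono)
  show "inj f" using mono less_linear' by (metis injI N.less_irrefl)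
  show "i \<preceq> f i" (is "?H i")
  proof (rule D0_induct[of ?H])
    show "Df1 ?H" by (intro DA_intros Fn_app1[OF f(1)])
    fix i assume "i \<preceq> f i"
    then show "sc i \<preceq> f (sc i)" using f(2)[of i] unfolding one_le_iff by order
  qed simp
qed

definition unb :: "('a \<Rightarrow> bool) \<Rightarrow> bool" where
  "unb P \<longleftrightarrow> (\<forall>k. \<exists>x. k \<preceq> x \<and> P x)"

subsection \<open>Cohesive sets\<close>

text \<open>
  Every set of a given definable sequence of sets almost contains or is almost disjoint from \<open>C'\<close>.
  The next element of \<open>C'\<close> agrees with the current one on the first \<open>k\<close> of the sets and does so
  together with infinitely many elements of \<open>C\<close>.
\<close>

lemma cohesive:
  assumes R: "Df2 R" and C: "Df1 C" "unb C"
  shows "\<exists>C'. Df1 C' \<and> unb C' \<and> (\<forall>x. C' x \<longrightarrow> C x) \<and>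
    (\<forall>j. (\<exists>b. \<forall>x. b \<preceq> x \<longrightarrow> C' x \<longrightarrow> R j x) \<or> (\<exists>b. \<forall>x. b \<preceq> x \<longrightarrow> C' x \<longrightarrow> \<not> R j x))"
proof -
  define agree where "agree k y y' \<longleftrightarrow> (\<forall>j. j \<prec> k \<longrightarrow> (R j y' \<longleftrightarrow> R j y))" for k y y'
  have agD: "D0 (\<lambda>e. agree (e 0) (e 1) (e 2))" unfolding agree_def by (intro DA_intros DA_app2[OF R])
  define I where "I k y \<longleftrightarrow> (\<forall>m. \<exists>y'. m \<preceq> y' \<and> C y' \<and> agree k y y')" for k y
  have ID: "Df2 I" unfolding I_def by (intro DA_intros DA_app1[OF C(1)] DA_app3[OF agD])
  have step: "\<exists>y'. y \<prec> y' \<and> C y' \<and> agree k y y' \<and> I (sc k) y'" if Iky: "I k y" for k y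
  proof -
    have *: "I (sc k) y'" if ag: "agree k y y'"
      and inf: "\<And>m. \<exists>y''. m \<preceq> y'' \<and> C y'' \<and> agree k y y'' \<and> (R k y'' \<longleftrightarrow> R k y')" for y'
      unfolding I_def
    proof
      fix m
      obtain y'' where "m \<preceq> y''" "C y''" "agree k y y''" "R k y'' \<longleftrightarrow> R k y'" using inf by blast
      then have "m \<preceq> y'' \<and> C y'' \<and> agree (sc k) y' y''"
        using ag by (auto simp: agree_def basic(8))
      then show "\<exists>y''. m \<preceq> y'' \<and> C y'' \<and> agree (sc k) y' y''" by blast
    qed
    \<comment> \<open>Splitting an unbounded set of candidates by the \<open>k\<close>-th set leaves
      at least one side unbounded.\<close>
    have "\<exists>B. \<forall>m. \<exists>y'. m \<preceq> y' \<and> C y' \<and> agree k y y' \<and> (R k y' \<longleftrightarrow> B)"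
    proof (cases "\<forall>m. \<exists>y'. m \<preceq> y' \<and> C y' \<and> agree k y y' \<and> R k y'")
      case False
      then obtain m0 where m0: "\<And>y'. m0 \<preceq> y' \<Longrightarrow> C y' \<Longrightarrow> agree k y y' \<Longrightarrow> \<not> R k y'" by blast
      have "\<exists>y'. m \<preceq> y' \<and> C y' \<and> agree k y y' \<and> \<not> R k y'" for m
      proof -
        obtain y' where y': "m \<oplus> m0 \<preceq> y'" "C y'" "agree k y y'" using Iky unfolding I_def by blast
        have "m \<preceq> m \<oplus> m0" "m0 \<preceq> m \<oplus> m0" by (auto simp: le_iff' add_commute')
        then have "m \<preceq> y'" "m0 \<preceq> y'" using y'(1) by order+
        then show ?thesis using y' m0 by blast
      qed
      then show ?thesis by (intro exI[of _ False]) simp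
    qed (intro exI[of _ True], simp)
    then obtain B where B: "\<And>m. \<exists>y'. m \<preceq> y' \<and> C y' \<and> agree k y y' \<and> (R k y' \<longleftrightarrow> B)" by blast
    obtain y' where y': "sc y \<preceq> y'" "C y'" "agree k y y'" "R k y' \<longleftrightarrow> B" using B by blast
    have "I (sc k) y'" using *[OF y'(3)] B y'(4) by simp
    then show ?thesis using y' by (auto simp: one_le_iff)
  qed
  obtain y0 where y0: "C y0" using C(2) by (auto simp: unb_def)
  have I0: "I \<zero> y0" using C(2) by (auto simp: I_def agree_def unb_def)
  let ?S = "\<lambda>s. \<exists>k y. s = pr k y \<and> C y \<and> I k y"
  let ?P = "\<lambda>s s'. \<exists>k y y'. s = pr k y \<and> s' = pr (sc k) y' \<and> y \<prec> y' \<and> agree k y y'"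
  have SD: "Df1 ?S" by (intro DA_intros DA_app1[OF C(1)] DA_app2[OF ID])
  have PD: "Df2 ?P" by (intro DA_intros DA_app3[OF agD])
  have "?S (pr \<zero> y0)" using y0 I0 by blast
  moreover have "\<exists>s'. ?S s' \<and> ?P s s'" if "?S s" for s
  proof -
    obtain k y where s: "s = pr k y" "C y" "I k y" using \<open>?S s\<close> by blast
    obtain y' where "y \<prec> y'" "C y'" "agree k y y'" "I (sc k) y'" using step[OF s(3)] by blast
    then have "?S (pr (sc k) y') \<and> ?P s (pr (sc k) y')" using s(1) by blast
    then show ?thesis by blast
  qed
  ultimately obtain f where f: "Fd1 f" "f \<zero> = pr \<zero> y0" "\<forall>i. ?S (f i) \<and> ?P (f i) (f (sc i))"
    using dependent_choice[OF SD PD] by blast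
  have fi: "\<exists>v. f i = pr i v" (is "?H i") for i
  proof (rule D0_induct[of ?H])
    show "Df1 ?H" by (intro DA_intros Fn_app1[OF f(1)])
    fix i assume "\<exists>v. f i = pr i v"
    moreover have "?P (f i) (f (sc i))" using f(3) by blast
    ultimately show "\<exists>v. f (sc i) = pr (sc i) v" by auto
  qed (use f(2) in blast)
  define y where "y i = Lst (\<lambda>v. f i = pr i v)" for i
  have "Fn (\<lambda>e. y (e 0))" unfolding y_def by (intro DA_intros Fn_app1[OF f(1)])
  then have yF: "Fd1 y" by (rule Fd1I)
  have fy: "f i = pr i (y i)" for i
    unfolding y_def by (rule Lst_props(1)[OF _ fi]) (intro DA_intros)
  have Cy: "C (y i)" for i
  proof -
    have "?S (f i)" using f(3) by blast
    then show ?thesis by (auto simp: fy)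
  qed
  have yy: "y i \<prec> y (sc i) \<and> agree i (y i) (y (sc i))" for i
  proof -
    have "?P (f i) (f (sc i))" using f(3) by blast
    then show ?thesis by (auto simp: fy)
  qed
  note mono = increasing[OF yF conjunct1[OF yy]]
  \<comment> \<open>Step \<open>i\<close> respects the sets with index below \<open>i\<close>, so
    membership in the \<open>j\<close>-th set is frozen only from \<open>y (sc j)\<close>
    on.\<close>
  have const: "sc j \<preceq> i \<longrightarrow> (R j (y i) \<longleftrightarrow> R j (y (sc j)))" for i j
  proof (rule D0_induct[where P = "\<lambda>i. sc j \<preceq> i \<longrightarrow> (R j (y i) \<longleftrightarrow> R j (y (sc j)))"])
    show "Df1 (\<lambda>i. sc j \<preceq> i \<longrightarrow> (R j (y i) \<longleftrightarrow> R j (y (sc j))))"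
      by (intro DA_intros DA_app2[OF R] Fn_app1[OF yF])
    show "sc j \<preceq> \<zero> \<longrightarrow> (R j (y \<zero>) \<longleftrightarrow> R j (y (sc j)))" by (simp add: one_le_iff)
    fix i assume IH: "sc j \<preceq> i \<longrightarrow> (R j (y i) \<longleftrightarrow> R j (y (sc j)))"
    show "sc j \<preceq> sc i \<longrightarrow> (R j (y (sc i)) \<longleftrightarrow> R j (y (sc j)))"
    proof (cases "j = i")
      case False
      show ?thesis
      proof
        assume "sc j \<preceq> sc i"
        then have "j \<prec> i" using False by (simp add: one_le_iff basic(8))
        then show "R j (y (sc i)) \<longleftrightarrow> R j (y (sc j))"
          using IH yy[of i] by (simp add: one_le_iff agree_def)
      qed
    qed simp
  qed
  let ?C = "\<lambda>x. \<exists>i. x = y i"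
  have "Df1 ?C" by (intro DA_intros Fn_app1[OF yF])
  moreover have "unb ?C" unfolding unb_def using mono(2) by blast
  moreover have "(\<exists>b. \<forall>x. b \<preceq> x \<longrightarrow> ?C x \<longrightarrow> R j x) \<or> (\<exists>b. \<forall>x. b \<preceq> x \<longrightarrow> ?C x \<longrightarrow> \<not> R j x)" for j
  proof -
    have ge: "sc j \<preceq> i" if "y (sc j) \<preceq> y i" for i
      using that mono(1)[of i "sc j"] by (meson N.not_le)
    show ?thesis
    proof (cases "R j (y (sc j))")
      case True
      then have "\<forall>x. y (sc j) \<preceq> x \<longrightarrow> ?C x \<longrightarrow> R j x" using const ge by blast
      then show ?thesis by blast
    next
      case False
      then have "\<forall>x. y (sc j) \<preceq> x \<longrightarrow> ?C x \<longrightarrow> \<not> R j x" using const ge by blast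
      then show ?thesis by blast
    qed
  qed
  ultimately show ?thesis using Cy by (intro exI[of _ ?C]) blast
qed

end

context aca
begin

section \<open>Shortest paths\<close>

definition chordless_seq :: "('a \<Rightarrow> 'a \<Rightarrow> bool) \<Rightarrow> ('a \<Rightarrow> 'a) \<Rightarrow> 'a \<Rightarrow> bool" where
  "chordless_seq adj w n \<longleftrightarrow> (\<forall>i j. i \<prec> n \<longrightarrow> j \<prec> n \<longrightarrow>
     (adj (w i) (w j) \<longleftrightarrow> i = sc j \<or> j = sc i) \<and> (w i = w j \<longrightarrow> i = j))"

lemma chordless_seq_mono:
  assumes "chordless_seq adj w n" "m \<preceq> n" shows "chordless_seq adj w m"
proof -
  have "i \<prec> n" if "i \<prec> m" for i using that assms(2) by order
  then show ?thesis using assms(1) unfolding chordless_seq_def by simp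
qed

end

locale definable_graph = aca +
  fixes adj :: "'a \<Rightarrow> 'a \<Rightarrow> bool"
  assumes adjD: "Df2 adj" and adj_sym: "adj u v \<Longrightarrow> adj v u" and adj_irrefl: "\<not> adj u u"
begin

definition walk :: "('a \<Rightarrow> bool) \<Rightarrow> 'a \<Rightarrow> ('a \<Rightarrow> 'a) \<Rightarrow> 'a \<Rightarrow> 'a \<Rightarrow> bool" where
  "walk U x f l v \<longleftrightarrow> f \<zero> = x \<and> f l = v \<and> (\<forall>i. i \<prec> l \<longrightarrow> adj (f i) (f (sc i))) \<and> (\<forall>i. i \<preceq> l \<longrightarrow> U (f i))"

lemma walk_cong:
  assumes "walk U x f l v" "\<And>i. i \<preceq> l \<Longrightarrow> g i = f i"
  shows "walk U x g l v"
  using assms by (simp add: walk_def N.less_imp_le one_le_iff)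

lemma walk_code:
  assumes "walk U x f l v" "Fd1 f"
  shows "\<exists>z. walk U x (dec z) l v"
  using code_exists[OF assms(2), of l] walk_cong[OF assms(1)] by blast

text \<open>Cuts \<open>d\<close> positions out of the walk after \<open>i\<close>. The last
  assumption is for a cut that reaches the end, where no edge leaves \<open>i\<close> any
  more.\<close>

lemma walk_splice:
  assumes f: "walk U x f (l \<oplus> d) v" and i: "i \<preceq> l"
    and 1: "i \<prec> l \<Longrightarrow> adj (f i) (f (sc i \<oplus> d))" and 2: "i = l \<Longrightarrow> f i = f (i \<oplus> d)"
  shows "walk U x (\<lambda>t. if t \<preceq> i then f t else f (t \<oplus> d)) l v"
  unfolding walk_def
proof (intro conjI allI impI)
  let ?g = "\<lambda>t. if t \<preceq> i then f t else f (t \<oplus> d)"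
  have f0: "f \<zero> = x" and fl: "f (l \<oplus> d) = v" and fa: "\<And>i. i \<prec> l \<oplus> d \<Longrightarrow> adj (f i) (f (sc i))"
    and fU: "\<And>i. i \<preceq> l \<oplus> d \<Longrightarrow> U (f i)"
    using f by (simp_all add: walk_def)
  have ld: "l \<preceq> l \<oplus> d" by (auto simp: le_iff')
  show "?g \<zero> = x" using f0 by simp
  show "?g l = v"
  proof (cases "l = i")
    case True then show ?thesis using 2 fl by simp
  next
    case False
    then have "\<not> l \<preceq> i" using i by order
    then show ?thesis using fl by simp
  qed
  show "U (?g t)" if t: "t \<preceq> l" for t
  proof -
    have "t \<preceq> l \<oplus> d" using t ld by order
    moreover have "t \<oplus> d \<preceq> l \<oplus> d" using t by (rule N.add_right_mono)
    ultimately show ?thesis using fU by simp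
  qed
  show "adj (?g t) (?g (sc t))" if t: "t \<prec> l" for t
  proof -
    have tl: "t \<prec> l \<oplus> d" "t \<oplus> d \<prec> l \<oplus> d" using t ld by (order, simp)
    consider "t \<prec> i" | "t = i" | "i \<prec> t" using less_linear' by blast
    then show ?thesis
    proof cases
      case 1
      then show ?thesis using fa[OF tl(1)] by (simp add: one_le_iff N.less_imp_le)
    next
      case 2
      then show ?thesis using assms(3) t by (simp add: one_le_iff)
    next
      case 3
      have "sc (t \<oplus> d) = sc t \<oplus> d" by (simp add: ac_simps)
      moreover have "\<not> t \<preceq> i" "\<not> sc t \<preceq> i" using 3 by (simp_all add: one_le_iff N.less_imp_le N.not_le N.not_less)
      ultimately show ?thesis using fa[OF tl(2)] by simp
    qed
  qed
qed

text \<open>Connectedness is assumed as a closure property of definable sets; applied to the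
  vertices reached by coded walks it yields a walk to \<open>y\<close>. A shortest one has neither
  chords nor repetitions, as \<open>walk_splice\<close> would shorten it.\<close>

lemma shortest_path:
  assumes U: "Df1 U" "U x"
    and conn: "\<And>S. Df1 S \<Longrightarrow> S x \<Longrightarrow> (\<And>u v. S u \<Longrightarrow> U v \<Longrightarrow> adj u v \<Longrightarrow> S v) \<Longrightarrow> S y"
  shows "\<exists>w l. Fd1 w \<and> w \<zero> = x \<and> w l = y \<and> (\<forall>i. i \<preceq> l \<longrightarrow> U (w i)) \<and> chordless_seq adj w (sc l)"
proof -
  let ?W = "\<lambda>l v. \<exists>z. walk U x (dec z) l v"
  have WD: "Df2 ?W" unfolding walk_def
    by (intro DA_intros DA_app1[OF U(1)] DA_app2[OF adjD] Fn_dec)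
  have "\<exists>l. ?W l y"
  proof (rule conn[of "\<lambda>v. \<exists>l. ?W l v"])
    show "Df1 (\<lambda>v. \<exists>l. ?W l v)" by (intro DA_intros DA_app2[OF WD])
    have "walk U x (\<lambda>_. x) \<zero> x" using U(2) by (simp add: walk_def)
    moreover have "Fd1 (\<lambda>_. x)" by (intro Fd1I DA_intros)
    ultimately show "\<exists>l. ?W l x" using walk_code[of U x "\<lambda>_. x"] by blast
  next
    fix u v assume "\<exists>l. ?W l u" and v: "U v" "adj u v"
    then obtain l z where z: "walk U x (dec z) l u" by blast
    let ?h = "\<lambda>i. if i \<preceq> l then dec z i else v"
    have h1: "\<not> sc l \<preceq> l" by (simp add: one_le_iff)
    have "walk U x ?h (sc l) v"
      unfolding walk_def
    proof (intro conjI allI impI)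
      show "?h \<zero> = x" using z by (simp add: walk_def)
      show "?h (sc l) = v" using h1 by simp
      show "U (?h i)" for i using z v by (simp add: walk_def)
      show "adj (?h i) (?h (sc i))" if i: "i \<prec> sc l" for i
      proof (cases "i = l")
        case True then show ?thesis using z v h1 by (simp add: walk_def)
      next
        case False
        then have "i \<prec> l" using i by (simp add: basic(8))
        then show ?thesis using z by (simp add: walk_def one_le_iff N.less_imp_le)
      qed
    qed
    moreover have "Fd1 ?h" by (intro Fd1I DA_intros Fn_dec)
    ultimately show "\<exists>l. ?W l v" using walk_code by blast
  qed
  then obtain l0 where l0: "?W l0 y" by blast
  have "Df1 (\<lambda>l. ?W l y)" by (intro DA_app2[OF WD] DA_intros)
  then obtain l where l: "?W l y" "\<And>l'. l' \<prec> l \<Longrightarrow> \<not> ?W l' y"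
    using D0_least[of "\<lambda>l. ?W l y" l0] l0 by metis
  then obtain z where z: "walk U x (dec z) l y" by blast
  let ?w = "dec z"
  have wF: "Fd1 ?w" by (intro Fd1I DA_intros Fn_dec)
  have short: False
    if lt: "l = l' \<oplus> d" "d \<noteq> \<zero>" "i \<preceq> l'"
      "i \<prec> l' \<Longrightarrow> adj (?w i) (?w (sc i \<oplus> d))" "i = l' \<Longrightarrow> ?w i = ?w (i \<oplus> d)" for l' d i
  proof -
    let ?g = "\<lambda>t. if t \<preceq> i then ?w t else ?w (t \<oplus> d)"
    have "walk U x ?g l' y" using walk_splice[OF z[unfolded lt(1)] lt(3,4,5)] .
    moreover have "Fd1 ?g" by (intro Fd1I DA_intros Fn_dec)
    ultimately have "?W l' y" using walk_code[of U x ?g l' y] by blast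
    moreover have "l' \<prec> l" using lt(1,2) zero_less'[of d] by auto
    ultimately show False using l(2) by blast
  qed
  have no_adj: "j = sc i" if ij: "i \<prec> j" "j \<preceq> l" "adj (?w i) (?w j)" for i j
  proof (rule ccontr)
    assume ne: "j \<noteq> sc i"
    obtain d where d: "j = sc i \<oplus> d" using ij(1) one_le_iff le_iff' by metis
    obtain r where "l = j \<oplus> r" using ij(2) le_iff' by blast
    then have "l = (sc i \<oplus> r) \<oplus> d" by (simp add: d ac_simps)
    moreover have lt: "i \<prec> sc i \<oplus> r"
      unfolding less_iff' by (rule exI[of _ r]) (simp add: ac_simps)
    moreover have "d \<noteq> \<zero>" using d ne by auto
    ultimately show False
      using short[of "sc i \<oplus> r" d i] ij(3) d N.less_imp_le[OF lt] N.less_irrefl by metis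
  qed
  have no_eq: False if ij: "i \<prec> j" "j \<preceq> l" "?w i = ?w j" for i j
  proof -
    obtain d where d: "j = i \<oplus> sc d" using ij(1) less_iff' by blast
    obtain r where "l = j \<oplus> r" using ij(2) le_iff' by blast
    then have l': "l = (i \<oplus> r) \<oplus> sc d" by (simp add: d ac_simps)
    have a1: "adj (?w i) (?w (sc i \<oplus> sc d))" if "i \<prec> i \<oplus> r"
    proof -
      have "j \<prec> l" using that by (simp add: d l')
      then have "adj (?w j) (?w (sc j))" using z by (simp add: walk_def)
      moreover have "sc i \<oplus> sc d = sc j" by (simp add: d ac_simps)
      ultimately show ?thesis using ij(3) by simp
    qed
    show False
    proof (rule short[OF l'])
      show "sc d \<noteq> \<zero>" by (rule basic)
      show "i \<preceq> i \<oplus> r" by (auto simp: le_iff')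
      show "i \<prec> i \<oplus> r \<Longrightarrow> adj (?w i) (?w (sc i \<oplus> sc d))" by (rule a1)
      show "?w i = ?w (i \<oplus> sc d)" using ij(3) d by simp
    qed
  qed
  have wz: "?w \<zero> = x" "?w l = y" "\<forall>i. i \<preceq> l \<longrightarrow> U (?w i)" and wa: "\<And>i. i \<prec> l \<Longrightarrow> adj (?w i) (?w (sc i))"
    using z by (simp_all add: walk_def)
  have "chordless_seq adj ?w (sc l)"
    unfolding chordless_seq_def
  proof (intro allI impI conjI)
    fix i j assume ij: "i \<prec> sc l" "j \<prec> sc l"
    then have ij': "i \<preceq> l" "j \<preceq> l" by (simp_all add: less_one_iff)
    show "i = j" if "?w i = ?w j"
      using no_eq[of i j] no_eq[of j i] that ij' less_linear'[of i j] by auto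
    show "adj (?w i) (?w j) \<longleftrightarrow> i = sc j \<or> j = sc i"
    proof
      assume a: "adj (?w i) (?w j)"
      consider "i \<prec> j" | "i = j" | "j \<prec> i" using less_linear' by blast
      then show "i = sc j \<or> j = sc i"
        using no_adj[of i j] no_adj[of j i] a ij' adj_sym adj_irrefl by cases auto
    next
      assume "i = sc j \<or> j = sc i"
      then show "adj (?w i) (?w j)"
      proof
        assume i: "i = sc j"
        then have "j \<prec> l" using ij' by (simp add: one_le_iff)
        from adj_sym[OF wa[OF this]] show ?thesis by (simp add: i)
      next
        assume j: "j = sc i"
        then have "i \<prec> l" using ij' by (simp add: one_le_iff)
        from wa[OF this] show ?thesis by (simp add: j)
      qed
    qed
  qed
  with wF wz show ?thesis by blast
qed

section \<open>Half graphs in traceable graphs\<close>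

text \<open>The interleaved growth makes all these vertices distinct, as \<open>half_seqD\<close>
  extracts.\<close>

definition half_seq :: "('a \<Rightarrow> 'a) \<Rightarrow> ('a \<Rightarrow> 'a) \<Rightarrow> bool" where
  "half_seq a b \<longleftrightarrow> Fd1 a \<and> Fd1 b \<and> (\<forall>i. a i \<prec> b i \<and> b i \<prec> a (sc i)) \<and>
     (\<forall>i j. i \<preceq> j \<longrightarrow> adj (a i) (b j))"

text \<open>Each \<open>b i\<close> is a common neighbour of all members of \<open>X\<close> up to
  \<open>a i\<close>. The next \<open>a\<close> is taken beyond the whole code of the current pair,
  hence beyond \<open>b i\<close>.\<close>

lemma half_seq_from_common_neighbours:
  assumes X: "Df1 X" "unb X"
    and common: "\<And>v. \<exists>w. v \<prec> w \<and> (\<forall>u. X u \<longrightarrow> u \<preceq> v \<longrightarrow> adj u w)"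
  shows "\<exists>a b. half_seq a b"
proof -
  let ?S = "\<lambda>s. \<exists>v w. s = pr v w \<and> X v \<and> v \<prec> w \<and> (\<forall>u. X u \<longrightarrow> u \<preceq> v \<longrightarrow> adj u w)"
  let ?P = "\<lambda>s s'. \<exists>v w. s' = pr v w \<and> s \<prec> v"
  have SD: "Df1 ?S" by (intro DA_intros DA_app1[OF X(1)] DA_app2[OF adjD])
  have PD: "Df2 ?P" by (intro DA_intros)
  have step: "\<exists>s'. ?S s' \<and> ?P s s'" for s
  proof -
    obtain v where v: "sc s \<preceq> v" "X v" using X(2) unfolding unb_def by blast
    obtain w where w: "v \<prec> w" "\<forall>u. X u \<longrightarrow> u \<preceq> v \<longrightarrow> adj u w" using common by blast
    have "s \<prec> v" using v(1) by (simp add: one_le_iff)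
    then have "?S (pr v w) \<and> ?P s (pr v w)" using v(2) w by blast
    then show ?thesis by blast
  qed
  obtain s0 where "?S s0" using step[of \<zero>] by blast
  then obtain f where f: "Fd1 f" "\<forall>i. ?S (f i) \<and> ?P (f i) (f (sc i))"
    using dependent_choice[of ?S ?P s0, OF SD PD _ step] by blast
  define a where "a i = Lst (\<lambda>v. \<exists>w. f i = pr v w)" for i
  define b where "b i = Lst (\<lambda>w. \<exists>v. f i = pr v w)" for i
  have aF: "Fd1 a" and bF: "Fd1 b"
    by (intro Fd1I; unfold a_def b_def; intro DA_intros Fn_app1[OF f(1)])+
  have fab: "f i = pr (a i) (b i)" for i
  proof -
    obtain v w where vw: "f i = pr v w" using f(2) by blast
    then have "a i = v" "b i = w" unfolding a_def b_def by (auto intro!: Lst_eq)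
    with vw show ?thesis by simp
  qed
  have Xa: "X (a i)" and ab: "a i \<prec> b i" and nb: "\<And>u. X u \<Longrightarrow> u \<preceq> a i \<Longrightarrow> adj u (b i)" for i
  proof -
    have "?S (f i)" using f(2) by blast
    then show "X (a i)" "a i \<prec> b i" "\<And>u. X u \<Longrightarrow> u \<preceq> a i \<Longrightarrow> adj u (b i)" by (auto simp: fab)
  qed
  have ba: "b i \<prec> a (sc i)" for i
  proof -
    have "?P (f i) (f (sc i))" using f(2) by blast
    then have "f i \<prec> a (sc i)" by (auto simp: fab)
    then show ?thesis using le_pr2[of "b i" "a i"] fab[of i] by order
  qed
  have "a i \<prec> a (sc i)" for i using ab[of i] ba[of i] by order
  note mono = increasing(1)[OF aF this]
  have "adj (a i) (b j)" if "i \<preceq> j" for i j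
    using nb[OF Xa] mono[of i j] that by (cases "i = j") (auto simp: le_def)
  then show ?thesis unfolding half_seq_def using aF bF ab ba by blast
qed

lemma half_seqD:
  assumes "half_seq a b"
  shows "Fd1 a" "Fd1 b" "i \<preceq> j \<Longrightarrow> adj (a i) (b j)" "i \<prec> j \<Longrightarrow> a i \<prec> a j" "i \<prec> j \<Longrightarrow> b i \<prec> b j"
    "inj a" "inj b" "a i \<noteq> b j"
proof -
  have ab: "\<And>i. a i \<prec> b i" "\<And>i. b i \<prec> a (sc i)"
    and adj: "\<And>i j. i \<preceq> j \<Longrightarrow> adj (a i) (b j)"
    using assms unfolding half_seq_def by auto
  show F: "Fd1 a" "Fd1 b" using assms unfolding half_seq_def by auto
  show "i \<preceq> j \<Longrightarrow> adj (a i) (b j)" by (rule adj)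
  have a1: "a i \<prec> a (sc i)" and b1: "b i \<prec> b (sc i)" for i
    using ab(1)[of i] ab(2)[of i] ab(1)[of "sc i"] by order+
  note amono = increasing(1)[OF F(1) a1] and bmono = increasing(1)[OF F(2) b1]
  show "i \<prec> j \<Longrightarrow> a i \<prec> a j" "i \<prec> j \<Longrightarrow> b i \<prec> b j" by (rule amono bmono, assumption)+
  show "inj a" "inj b" by (rule increasing(3)[OF F(1) a1] increasing(3)[OF F(2) b1])+
  show "a i \<noteq> b j"
  proof (cases "i \<preceq> j")
    case True
    then have "a i \<preceq> a j" using amono[of i j] unfolding le_def by blast
    then show ?thesis using ab(1)[of j] by (metis N.not_le)
  next
    case False
    then have "sc j \<preceq> i" by (simp add: one_le_iff N.not_le)
    then have "a (sc j) \<preceq> a i" using amono[of "sc j" i] unfolding le_def by blast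
    then show ?thesis using ab(2)[of j] by (metis N.not_le)
  qed
qed

lemma unb_ge3: "unb P \<Longrightarrow> \<exists>x. P x \<and> a \<preceq> x \<and> b \<preceq> x \<and> c \<preceq> x"
proof -
  assume "unb P"
  then obtain x where x: "a \<oplus> (b \<oplus> c) \<preceq> x" "P x" unfolding unb_def by blast
  have "a \<preceq> a \<oplus> (b \<oplus> c)" "b \<preceq> b \<oplus> c" "c \<preceq> b \<oplus> c" "b \<oplus> c \<preceq> a \<oplus> (b \<oplus> c)"
    by (auto simp: le_iff' add_commute' intro: exI[of _ a] exI[of _ b])
  then have "a \<preceq> x" "b \<preceq> x" "c \<preceq> x" using x(1) by order+
  then show ?thesis using x(2) by blast
qed

end

text \<open>
  The vertices are numbered along the trace. A fixed \<open>n\<close> bounds the length of chordless paths, so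
  any \<open>x \<preceq> y\<close> are joined inside the interval from \<open>x\<close> to \<open>y\<close> by a path with fewer than \<open>n\<close> edges,
  whose vertices are \<open>q x y b\<close> for \<open>b \<prec> n\<close>.
\<close>

locale short_paths = definable_graph +
  fixes n :: 'a
  assumes adj_succ: "adj i (sc i)"
    and short: "\<And>w. Fd1 w \<Longrightarrow> \<not> chordless_seq adj w n"
begin

text \<open>The entries after position \<open>l\<close> must lie between \<open>x\<close> and
  \<open>y\<close> too, so that \<open>q x y b\<close> can be used for every
  \<open>b \<prec> n\<close>, whatever the length of the path.\<close>

definition is_link :: "'a \<Rightarrow> 'a \<Rightarrow> 'a \<Rightarrow> bool" where
  "is_link x y z \<longleftrightarrow> dec z \<zero> = x \<and>
     (\<exists>l. l \<prec> n \<and> dec z l = y \<and> (\<forall>i. i \<prec> l \<longrightarrow> adj (dec z i) (dec z (sc i)))) \<and>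
     (\<forall>i. i \<prec> n \<longrightarrow> x \<preceq> dec z i \<and> dec z i \<preceq> y)"

lemma is_link_D0: "D0 (\<lambda>e. is_link (e 0) (e 1) (e 2))"
  unfolding is_link_def by (intro DA_intros DA_app2[OF adjD] Fn_dec)

text \<open>The interval is connected through consecutive numbers, and a shortest path in it is
  chordless, hence short. The code is padded with \<open>y\<close>.\<close>

lemma is_link_exists:
  assumes "x \<preceq> y" shows "\<exists>z. is_link x y z"
proof -
  let ?U = "\<lambda>u. x \<preceq> u \<and> u \<preceq> y"
  have U: "Df1 ?U" by (intro DA_intros)
  have "S y" if S: "Df1 S" "S x" and cl: "\<And>u v. S u \<Longrightarrow> ?U v \<Longrightarrow> adj u v \<Longrightarrow> S v" for S
  proof -
    have "x \<preceq> t \<longrightarrow> t \<preceq> y \<longrightarrow> S t" (is "?H t") for t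
    proof (rule D0_induct[of ?H])
      show "Df1 ?H" by (intro DA_intros DA_app1[OF S(1)])
      show "x \<preceq> \<zero> \<longrightarrow> \<zero> \<preceq> y \<longrightarrow> S \<zero>" using S(2) by (auto simp: le_def)
      fix t assume IH: "x \<preceq> t \<longrightarrow> t \<preceq> y \<longrightarrow> S t"
      show "x \<preceq> sc t \<longrightarrow> sc t \<preceq> y \<longrightarrow> S (sc t)"
      proof (intro impI)
        assume t: "x \<preceq> sc t" "sc t \<preceq> y"
        show "S (sc t)"
        proof (cases "x = sc t")
          case False
          then have "x \<prec> sc t" using t(1) by order
          then have "x \<preceq> t" by (simp add: less_one_iff)
          moreover have "t \<preceq> y" using t(2) by (simp add: one_le_iff N.less_imp_le)
          ultimately show ?thesis using IH cl[of t "sc t"] t adj_succ by blast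
        qed (use S(2) in simp)
      qed
    qed
    then show ?thesis using assms by blast
  qed
  then obtain w l where w: "Fd1 w" "w \<zero> = x" "w l = y" "\<forall>i. i \<preceq> l \<longrightarrow> ?U (w i)"
    "chordless_seq adj w (sc l)"
    using shortest_path[of ?U x y, OF U] assms by blast
  have ln: "l \<prec> n"
  proof (rule ccontr)
    assume "\<not> l \<prec> n"
    then have "n \<preceq> sc l" by (meson N.not_less N.less_imp_le less_one_iff)
    then show False using chordless_seq_mono[OF w(5)] short[OF w(1)] by blast
  qed
  let ?h = "\<lambda>i. if i \<preceq> l then w i else y"
  have "Fd1 ?h" by (intro Fd1I DA_intros Fn_app1[OF w(1)])
  then obtain z where z: "\<And>i. i \<preceq> n \<Longrightarrow> dec z i = ?h i" using code_exists[of ?h n] by blast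
  have "is_link x y z" unfolding is_link_def
  proof (intro conjI exI[of _ l] allI impI)
    show "dec z \<zero> = x" using z w(2) by simp
    show "l \<prec> n" by (rule ln)
    show "dec z l = y" using z ln w(3) by (simp add: N.less_imp_le)
    show "adj (dec z i) (dec z (sc i))" if i: "i \<prec> l" for i
    proof -
      have "i \<preceq> n" "sc i \<preceq> n" using i ln unfolding one_le_iff by order+
      then have "dec z i = w i" "dec z (sc i) = w (sc i)"
        using z i by (simp_all add: one_le_iff N.less_imp_le)
      moreover have "i \<prec> sc l" "sc i \<prec> sc l" using i by (simp_all add: less_one_iff one_le_iff N.less_imp_le)
      ultimately show ?thesis using w(5) unfolding chordless_seq_def by metis
    qed
    show "x \<preceq> dec z i" "dec z i \<preceq> y" if i: "i \<prec> n" for i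
      using z[of i] i w(4) assms by (auto simp: N.less_imp_le)
  qed
  then show ?thesis by blast
qed

definition q :: "'a \<Rightarrow> 'a \<Rightarrow> 'a \<Rightarrow> 'a" where
  "q x y = dec (Lst (is_link x y))"

lemma Fn_q: "Fn t \<Longrightarrow> Fn u \<Longrightarrow> Fn v \<Longrightarrow> Fn (\<lambda>e. q (t e) (u e) (v e))"
proof (rule Fn_app3[of q])
  have "Fn (\<lambda>e. dec (Lst (\<lambda>z. is_link (e 0) (e 1) z)) (e 2))"
    by (intro Fn_dec DA_intros DA_app3[OF is_link_D0])
  then show "D0 (\<lambda>e. e 0 = q (e 1) (e 2) (e 3))"
    by (simp add: Fn_def q_def numeral_2_eq_2 numeral_3_eq_3)
qed

lemma q_link:
  assumes "x \<preceq> y"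
  shows "q x y \<zero> = x" "\<exists>l. l \<prec> n \<and> q x y l = y \<and> (\<forall>i. i \<prec> l \<longrightarrow> adj (q x y i) (q x y (sc i)))"
    "b \<prec> n \<Longrightarrow> x \<preceq> q x y b" "b \<prec> n \<Longrightarrow> q x y b \<preceq> y"
proof -
  have "Df1 (is_link x y)" by (intro DA_app3[OF is_link_D0] DA_intros)
  from Lst_props(1)[OF this is_link_exists[OF assms]]
  have *: "is_link x y (Lst (is_link x y))" .
  show "q x y \<zero> = x" "\<exists>l. l \<prec> n \<and> q x y l = y \<and> (\<forall>i. i \<prec> l \<longrightarrow> adj (q x y i) (q x y (sc i)))"
    "b \<prec> n \<Longrightarrow> x \<preceq> q x y b" "b \<prec> n \<Longrightarrow> q x y b \<preceq> y"
    using * by (simp_all add: is_link_def q_def)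
qed

lemma n_pos: "\<zero> \<prec> n"
  using q_link(2)[of \<zero> \<zero>] by (metis N.order_refl N.le_less_trans zero_le)

text \<open>
  If no later link has neighbours in an earlier one beyond the adjacent link, the union of the links
  still contains a chordless path, and this path is long since it visits all links.
\<close>

lemma long_chain_contradiction:
  assumes f: "Fd1 f" "\<And>i. f i \<prec> f (sc i)"
    and far: "\<And>i j b c. sc i \<prec> j \<Longrightarrow> b \<prec> n \<Longrightarrow> c \<prec> n \<Longrightarrow>
      \<not> adj (q (f i) (f (sc i)) b) (q (f j) (f (sc j)) c)"
  shows False
proof -
  note mono = increasing(1)[OF f]
  have fle: "f i \<preceq> f (sc i)" for i using f(2)[of i] by (rule N.less_imp_le)
  define In where "In i v \<longleftrightarrow> (\<exists>b. b \<prec> n \<and> v = q (f i) (f (sc i)) b)" for i v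
  have InD: "Df2 In" unfolding In_def by (intro DA_intros Fn_q Fn_app1[OF f(1)])
  let ?U = "\<lambda>v. \<exists>i. i \<preceq> n \<and> In i v"
  have UD: "Df1 ?U" by (intro DA_intros DA_app2[OF InD])
  have In0: "In i (f i)" for i using q_link(1)[OF fle[of i]] n_pos unfolding In_def by metis
  have U0: "?U (f \<zero>)" using In0[of \<zero>] zero_le by blast
  have "S (f (sc n))" if S: "Df1 S" "S (f \<zero>)" and cl: "\<And>u v. S u \<Longrightarrow> ?U v \<Longrightarrow> adj u v \<Longrightarrow> S v" for S
  proof -
    have "i \<preceq> sc n \<longrightarrow> S (f i)" (is "?H i") for i
    proof (rule D0_induct[of ?H])
      show "Df1 ?H" by (intro DA_intros DA_app1[OF S(1)] Fn_app1[OF f(1)])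
      show "\<zero> \<preceq> sc n \<longrightarrow> S (f \<zero>)" using S(2) by simp
      fix i assume IH: "i \<preceq> sc n \<longrightarrow> S (f i)"
      show "sc i \<preceq> sc n \<longrightarrow> S (f (sc i))"
      proof
        assume "sc i \<preceq> sc n"
        then have i: "i \<preceq> n" by simp
        then have Si: "S (f i)" using IH by (simp add: N.less_imp_le less_one_iff)
        obtain l where l: "l \<prec> n" "q (f i) (f (sc i)) l = f (sc i)"
          "\<forall>j. j \<prec> l \<longrightarrow> adj (q (f i) (f (sc i)) j) (q (f i) (f (sc i)) (sc j))"
          using q_link(2)[OF fle[of i]] by blast
        let ?q = "q (f i) (f (sc i))"
        have "j \<preceq> l \<longrightarrow> S (?q j)" (is "?H j") for j
        proof (rule D0_induct[of ?H])
          show "Df1 ?H" by (intro DA_intros DA_app1[OF S(1)] Fn_q)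
          show "\<zero> \<preceq> l \<longrightarrow> S (?q \<zero>)" using Si q_link(1)[OF fle[of i]] by simp
          fix j assume IHj: "j \<preceq> l \<longrightarrow> S (?q j)"
          show "sc j \<preceq> l \<longrightarrow> S (?q (sc j))"
          proof
            assume jl: "sc j \<preceq> l"
            then have j: "j \<prec> l" by (simp add: one_le_iff)
            have "sc j \<prec> n" using jl l(1) by order
            then have "?U (?q (sc j))" using i unfolding In_def by blast
            moreover have "S (?q j)" using IHj j by (simp add: N.less_imp_le)
            ultimately show "S (?q (sc j))" using cl l(3) j by blast
          qed
        qed
        then show "S (f (sc i))" using l(2) by (metis N.order_refl)
      qed
    qed
    then show ?thesis by simp
  qed
  then obtain w l where w: "Fd1 w" "w \<zero> = f \<zero>" "w l = f (sc n)" "\<forall>i. i \<preceq> l \<longrightarrow> ?U (w i)"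
    "chordless_seq adj w (sc l)"
    using shortest_path[of ?U "f \<zero>" "f (sc n)", OF UD U0] by blast
  have near: "j \<preceq> sc i" if "In i u" "In j v" "adj u v" for i j u v
    using far[of i j] that unfolding In_def by (metis N.not_less)
  \<comment> \<open>One edge advances by at most one link, so after \<open>t\<close> edges a link
    with index at most \<open>t\<close> has been reached.\<close>
  have "t \<preceq> l \<longrightarrow> (\<exists>i. i \<preceq> t \<and> In i (w t))" (is "?H t") for t
  proof (rule D0_induct[of ?H])
    show "Df1 ?H"
      by (intro DA_intros DA_app2[OF InD] Fn_app1[OF w(1)])
    show "\<zero> \<preceq> l \<longrightarrow> (\<exists>i. i \<preceq> \<zero> \<and> In i (w \<zero>))" using In0[of \<zero>] w(2) by (metis N.order_refl)
    fix t assume IH: "t \<preceq> l \<longrightarrow> (\<exists>i. i \<preceq> t \<and> In i (w t))"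
    show "sc t \<preceq> l \<longrightarrow> (\<exists>i. i \<preceq> sc t \<and> In i (w (sc t)))"
    proof
      assume t1: "sc t \<preceq> l"
      then have t: "t \<prec> l" by (simp add: one_le_iff)
      then obtain i where i: "i \<preceq> t" "In i (w t)" using IH N.less_imp_le by blast
      obtain j where j: "In j (w (sc t))" using w(4) t1 by blast
      have "t \<prec> sc l" "sc t \<prec> sc l" using t by (simp_all add: less_one_iff one_le_iff N.less_imp_le)
      then have "adj (w t) (w (sc t))" using w(5) unfolding chordless_seq_def by metis
      from near[OF i(2) j this] have "j \<preceq> sc i" .
      moreover have "sc i \<preceq> sc t" using i(1) by simp
      ultimately have "j \<preceq> sc t" by order
      then show "\<exists>i. i \<preceq> sc t \<and> In i (w (sc t))" using j by blast
    qed
  qed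
  then obtain i where i: "i \<preceq> l" "In i (f (sc n))" using w(3) by (metis N.order_refl)
  \<comment> \<open>Link \<open>i\<close> ends at \<open>f (sc i)\<close>, so it can contain
    \<open>f (sc n)\<close> only if \<open>i\<close> is at least \<open>n\<close>; then the path has
    at least \<open>n\<close> edges.\<close>
  then have "f (sc n) \<preceq> f (sc i)" unfolding In_def using q_link(4)[OF fle] by metis
  then have "sc n \<preceq> sc i" using mono[of "sc i" "sc n"] by (meson N.not_less)
  then have "n \<preceq> l" using i(1) by simp
  then have "n \<preceq> sc l" by (simp add: less_one_iff N.less_imp_le)
  then show False using chordless_seq_mono[OF w(5)] short[OF w(1)] by blast
qed

theorem half_seq_exists: "\<exists>a b. half_seq a b"
proof -
  \<comment> \<open>The index \<open>j\<close> codes \<open>v\<close>, \<open>b\<close> and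
    \<open>x\<close>, so cohesiveness of \<open>C1\<close> settles for each such triple whether
    \<open>v\<close> is adjacent to \<open>q x y b\<close> for almost all \<open>y\<close>.\<close>
  let ?R = "\<lambda>j y. \<exists>v b x. j = pr (pr v b) x \<and> adj v (q x y b)"
  have RD: "Df2 ?R" by (intro DA_intros DA_app2[OF adjD] Fn_q)
  have "Df1 (\<lambda>x. \<zero> = \<zero>)" "unb (\<lambda>x. \<zero> = \<zero>)" by (intro DA_intros) (auto simp: unb_def)
  from cohesive[of ?R, OF RD this]
  obtain C1 where C1: "Df1 C1" "unb C1"
    and coh1: "\<forall>j. (\<exists>b. \<forall>x. b \<preceq> x \<longrightarrow> C1 x \<longrightarrow> ?R j x) \<or> (\<exists>b. \<forall>x. b \<preceq> x \<longrightarrow> C1 x \<longrightarrow> \<not> ?R j x)"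
    by blast
  define L where "L v b x \<longleftrightarrow> (\<exists>c. \<forall>y. c \<preceq> y \<longrightarrow> C1 y \<longrightarrow> adj v (q x y b))" for v b x
  have LD: "D0 (\<lambda>e. L (e 0) (e 1) (e 2))"
    unfolding L_def by (intro DA_intros DA_app1[OF C1(1)] DA_app2[OF adjD] Fn_q)
  have notL: "\<exists>c. \<forall>y. c \<preceq> y \<longrightarrow> C1 y \<longrightarrow> \<not> adj v (q x y b)" if "\<not> L v b x" for v b x
  proof -
    have "?R (pr (pr v b) x) y \<longleftrightarrow> adj v (q x y b)" for y by auto
    then show ?thesis using coh1[rule_format, of "pr (pr v b) x"] that unfolding L_def by simp
  qed
  \<comment> \<open>The second limit, now in \<open>x\<close>. Since \<open>C2\<close> lies inside
    \<open>C1\<close>, the limits in \<open>y\<close> remain valid along it.\<close>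
  let ?R2 = "\<lambda>j x. \<exists>v b. j = pr v b \<and> L v b x"
  have R2D: "Df2 ?R2" by (intro DA_intros DA_app3[OF LD])
  from cohesive[of ?R2, OF R2D C1]
  obtain C2 where C2: "Df1 C2" "unb C2" and C21: "\<And>x. C2 x \<Longrightarrow> C1 x"
    and coh2: "\<forall>j. (\<exists>b. \<forall>x. b \<preceq> x \<longrightarrow> C2 x \<longrightarrow> ?R2 j x) \<or> (\<exists>b. \<forall>x. b \<preceq> x \<longrightarrow> C2 x \<longrightarrow> \<not> ?R2 j x)"
    by blast
  define L2 where "L2 v b \<longleftrightarrow> (\<exists>c. \<forall>x. c \<preceq> x \<longrightarrow> C2 x \<longrightarrow> L v b x)" for v b
  have L2D: "Df2 L2" unfolding L2_def by (intro DA_intros DA_app1[OF C2(1)] DA_app3[OF LD])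
  note defs = DA_intros DA_app1[OF C1(1)] DA_app1[OF C2(1)] DA_app2[OF adjD] DA_app3[OF LD] DA_app2[OF L2D] Fn_q
  have notL2: "\<exists>c. \<forall>x. c \<preceq> x \<longrightarrow> C2 x \<longrightarrow> \<not> L v b x" if "\<not> L2 v b" for v b
  proof -
    have "?R2 (pr v b) x \<longleftrightarrow> L v b x" for x by auto
    then show ?thesis using coh2[rule_format, of "pr v b"] that unfolding L2_def by simp
  qed
  show ?thesis
  proof (cases "\<exists>b. b \<prec> n \<and> unb (\<lambda>v. L2 v b)")
    case True
    then obtain b where b: "b \<prec> n" "unb (\<lambda>v. L2 v b)" by blast
    show ?thesis
    proof (rule half_seq_from_common_neighbours[of "\<lambda>v. L2 v b"])
      show "Df1 (\<lambda>v. L2 v b)" by (intro DA_app2[OF L2D] DA_intros)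
      show "unb (\<lambda>v. L2 v b)" by (rule b)
      fix v
      \<comment> \<open>First \<open>x\<close> passes the thresholds of all relevant
        \<open>u\<close> up to \<open>v\<close>, then \<open>y\<close> passes those belonging to
        this \<open>x\<close>. The vertex \<open>q x y b\<close> is then a common neighbour, and it
        exceeds \<open>v\<close> because \<open>x\<close> does.\<close>
      have "\<exists>c. \<forall>x. c \<preceq> x \<longrightarrow> (\<forall>u. u \<prec> sc v \<longrightarrow> L2 u b \<longrightarrow> C2 x \<longrightarrow> L u b x)"
      proof (rule eventually_collect)
        show "Df2 (\<lambda>u x. L2 u b \<longrightarrow> C2 x \<longrightarrow> L u b x)" by (intro defs)
        fix u
        show "\<exists>c. \<forall>x. c \<preceq> x \<longrightarrow> L2 u b \<longrightarrow> C2 x \<longrightarrow> L u b x"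
          by (cases "L2 u b") (unfold L2_def, blast+)
      qed
      then obtain c where c: "\<And>x u. c \<preceq> x \<Longrightarrow> u \<prec> sc v \<Longrightarrow> L2 u b \<Longrightarrow> C2 x \<Longrightarrow> L u b x" by blast
      obtain x where x: "C2 x" "c \<preceq> x" "sc v \<preceq> x" using unb_ge3[OF C2(2)] by blast
      have "\<exists>c. \<forall>y. c \<preceq> y \<longrightarrow> (\<forall>u. u \<prec> sc v \<longrightarrow> L u b x \<longrightarrow> C1 y \<longrightarrow> adj u (q x y b))"
      proof (rule eventually_collect)
        show "Df2 (\<lambda>u y. L u b x \<longrightarrow> C1 y \<longrightarrow> adj u (q x y b))" by (intro defs)
        fix u
        show "\<exists>c. \<forall>y. c \<preceq> y \<longrightarrow> L u b x \<longrightarrow> C1 y \<longrightarrow> adj u (q x y b)"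
          by (cases "L u b x") (unfold L_def, blast+)
      qed
      then obtain d where d: "\<And>y u. d \<preceq> y \<Longrightarrow> u \<prec> sc v \<Longrightarrow> L u b x \<Longrightarrow> C1 y \<Longrightarrow> adj u (q x y b)" by blast
      obtain y where y: "C1 y" "d \<preceq> y" "x \<preceq> y" using unb_ge3[OF C1(2)] by blast
      have "v \<prec> q x y b" using q_link(3)[OF y(3) b(1)] x(3) unfolding one_le_iff by order
      moreover have "adj u (q x y b)" if "L2 u b" "u \<preceq> v" for u
        using d[OF y(2) _ c[OF x(2) _ that(1) x(1)] y(1)] that(2) by (simp add: less_one_iff)
      ultimately show "\<exists>w. v \<prec> w \<and> (\<forall>u. L2 u b \<longrightarrow> u \<preceq> v \<longrightarrow> adj u w)" by blast
    qed
  next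
    case False
    have "\<exists>s. \<forall>v. s \<preceq> v \<longrightarrow> (\<forall>b. b \<prec> n \<longrightarrow> \<not> L2 v b)"
    proof (rule eventually_collect)
      show "Df2 (\<lambda>b v. \<not> L2 v b)" by (intro defs)
    qed (use False in \<open>auto simp: unb_def\<close>)
    then obtain s where s: "\<And>v b. s \<preceq> v \<Longrightarrow> b \<prec> n \<Longrightarrow> \<not> L2 v b" by blast
    \<comment> \<open>The second clause makes \<open>L\<close> fail for old vertices at all later
      left ends. The third makes the link from \<open>h\<close> to \<open>h'\<close> avoid the
      vertices for which \<open>L\<close> fails at \<open>h\<close>. A vertex of link
      \<open>i\<close> is old at \<open>f (sc i)\<close>, so it is excluded from link
      \<open>j\<close> once \<open>sc (sc i)\<close> is at most \<open>j\<close>.\<close>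
    let ?P = "\<lambda>h h'. h \<prec> h' \<and>
      (\<forall>v. v \<preceq> h \<longrightarrow> s \<preceq> v \<longrightarrow> (\<forall>b. b \<prec> n \<longrightarrow> (\<forall>x. h' \<preceq> x \<longrightarrow> C2 x \<longrightarrow> \<not> L v b x))) \<and>
      (\<forall>v. v \<preceq> h \<longrightarrow> (\<forall>b. b \<prec> n \<longrightarrow> \<not> L v b h \<longrightarrow> \<not> adj v (q h h' b)))"
    have PD: "Df2 ?P" by (intro defs)
    have step: "\<exists>h'. C2 h' \<and> ?P h h'" for h
    proof -
      have "\<exists>c. \<forall>x. c \<preceq> x \<longrightarrow> (\<forall>v. v \<prec> sc h \<longrightarrow> s \<preceq> v \<longrightarrow> (\<forall>b. b \<prec> n \<longrightarrow> C2 x \<longrightarrow> \<not> L v b x))"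
      proof (rule eventually_collect)
        show "Df2 (\<lambda>v x. s \<preceq> v \<longrightarrow> (\<forall>b. b \<prec> n \<longrightarrow> C2 x \<longrightarrow> \<not> L v b x))" by (intro defs)
        fix v
        have "\<exists>c. \<forall>x. c \<preceq> x \<longrightarrow> (\<forall>b. b \<prec> n \<longrightarrow> C2 x \<longrightarrow> \<not> L v b x)" if v: "s \<preceq> v"
        proof (rule eventually_collect)
          show "Df2 (\<lambda>b x. C2 x \<longrightarrow> \<not> L v b x)" by (intro defs)
        qed (rule notL2, rule s[OF v])
        then show "\<exists>c. \<forall>x. c \<preceq> x \<longrightarrow> s \<preceq> v \<longrightarrow> (\<forall>b. b \<prec> n \<longrightarrow> C2 x \<longrightarrow> \<not> L v b x)" by blast
      qed
      then obtain c where c: "\<And>x v b. c \<preceq> x \<Longrightarrow> v \<prec> sc h \<Longrightarrow> s \<preceq> v \<Longrightarrow> b \<prec> n \<Longrightarrow> C2 x \<Longrightarrow> \<not> L v b x"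
        by blast
      have "\<exists>c. \<forall>y. c \<preceq> y \<longrightarrow> (\<forall>v. v \<prec> sc h \<longrightarrow> (\<forall>b. b \<prec> n \<longrightarrow> \<not> L v b h \<longrightarrow> C1 y \<longrightarrow> \<not> adj v (q h y b)))"
      proof (rule eventually_collect)
        show "Df2 (\<lambda>v y. \<forall>b. b \<prec> n \<longrightarrow> \<not> L v b h \<longrightarrow> C1 y \<longrightarrow> \<not> adj v (q h y b))" by (intro defs)
        fix v
        show "\<exists>c. \<forall>y. c \<preceq> y \<longrightarrow> (\<forall>b. b \<prec> n \<longrightarrow> \<not> L v b h \<longrightarrow> C1 y \<longrightarrow> \<not> adj v (q h y b))"
        proof (rule eventually_collect)
          show "Df2 (\<lambda>b y. \<not> L v b h \<longrightarrow> C1 y \<longrightarrow> \<not> adj v (q h y b))" by (intro defs)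
          fix b
          show "\<exists>c. \<forall>y. c \<preceq> y \<longrightarrow> \<not> L v b h \<longrightarrow> C1 y \<longrightarrow> \<not> adj v (q h y b)"
            using notL[of v b h] by blast
        qed
      qed
      then obtain d where d: "\<And>y v b. d \<preceq> y \<Longrightarrow> v \<prec> sc h \<Longrightarrow> b \<prec> n \<Longrightarrow> \<not> L v b h \<Longrightarrow> C1 y \<Longrightarrow> \<not> adj v (q h y b)"
        by blast
      obtain h' where h': "C2 h'" "c \<preceq> h'" "d \<preceq> h'" "sc h \<preceq> h'" using unb_ge3[OF C2(2)] by blast
      have "\<not> L v b x" if v: "v \<preceq> h" "s \<preceq> v" "b \<prec> n" "h' \<preceq> x" "C2 x" for v b x
      proof (rule c[OF _ _ v(2,3,5)])
        show "c \<preceq> x" using h'(2) v(4) by order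
        show "v \<prec> sc h" using v(1) by (simp add: less_one_iff)
      qed
      moreover have "\<not> adj v (q h h' b)" if v: "v \<preceq> h" "b \<prec> n" "\<not> L v b h" for v b
        using d[OF h'(3) _ v(2,3) C21[OF h'(1)]] v(1) by (simp add: less_one_iff)
      moreover have "h \<prec> h'" using h'(4) by (simp add: one_le_iff)
      ultimately show ?thesis using h'(1) by blast
    qed
    obtain h0 where h0: "s \<preceq> h0" "C2 h0" using C2(2) unfolding unb_def by blast
    obtain f where f: "Fd1 f" "f \<zero> = h0" "\<forall>i. C2 (f i) \<and> ?P (f i) (f (sc i))"
      using dependent_choice[of C2 ?P h0, OF C2(1) PD h0(2) step] by blast
    have f1: "f i \<prec> f (sc i)" for i using f(3) by blast
    have f2: "\<not> L v b x" if "v \<preceq> f i" "s \<preceq> v" "b \<prec> n" "f (sc i) \<preceq> x" "C2 x" for i v b x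
      using f(3) that by blast
    have f3: "\<not> adj v (q (f i) (f (sc i)) b)" if "v \<preceq> f i" "b \<prec> n" "\<not> L v b (f i)" for i v b
      using f(3) that by blast
    note mono = increasing(1)[OF f(1) f1]
    have mono': "f i \<preceq> f j" if "i \<preceq> j" for i j
      using mono[of i j] that unfolding le_def by blast
    have fle: "f i \<preceq> f (sc i)" for i using f1[of i] by (rule N.less_imp_le)
    have "\<not> adj (q (f i) (f (sc i)) b) (q (f j) (f (sc j)) c)"
      if ij: "sc i \<prec> j" and bc: "b \<prec> n" "c \<prec> n" for i j b c
    proof (rule f3[OF _ bc(2)])
      let ?v = "q (f i) (f (sc i)) b"
      have v: "f i \<preceq> ?v" "?v \<preceq> f (sc i)" using q_link(3,4)[OF fle bc(1)] by blast+
      have "sc i \<preceq> j" "sc (sc i) \<preceq> j"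
        using ij one_le_iff[of "sc i" j] N.less_imp_le by blast+
      then have m: "f (sc i) \<preceq> f j" "f (sc (sc i)) \<preceq> f j" by (simp_all only: mono')
      show "?v \<preceq> f j" using v(2) m(1) by order
      have "s \<preceq> ?v" using h0(1) v(1) mono'[OF zero_le[of i]] unfolding f(2) by order
      then show "\<not> L ?v c (f j)" using f2[OF v(2) _ bc(2) m(2)] f(3) by blast
    qed
    then show ?thesis using long_chain_contradiction[OF f(1) f1] by blast
  qed
qed

end

section \<open>Complete bipartite graphs\<close>

context definable_graph
begin

text \<open>A limit form of Ramsey's theorem for pairs. In a cohesive set each \<open>x\<close> is
  related to almost all or to almost no elements. If unboundedly many are of the first kind, a
  homogeneous sequence can be picked greedily; otherwise a final segment consists of the second
  kind.\<close>

lemma sparse_subset: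
  assumes R: "Df2 R" and C: "Df1 C" "unb C"
    and nh: "\<And>k. Fd1 k \<Longrightarrow> (\<And>i. k i \<prec> k (sc i)) \<Longrightarrow> (\<And>i j. i \<prec> j \<Longrightarrow> R (k i) (k j)) \<Longrightarrow> False"
  obtains C' where "Df1 C'" "unb C'" "\<And>x. C' x \<Longrightarrow> C x"
    "\<And>x. C' x \<Longrightarrow> \<exists>b. \<forall>y. b \<preceq> y \<longrightarrow> C' y \<longrightarrow> \<not> R x y"
proof -
  obtain C' where C': "Df1 C'" "unb C'" "\<And>x. C' x \<Longrightarrow> C x"
    and coh: "\<And>j. (\<exists>b. \<forall>x. b \<preceq> x \<longrightarrow> C' x \<longrightarrow> R j x) \<or> (\<exists>b. \<forall>x. b \<preceq> x \<longrightarrow> C' x \<longrightarrow> \<not> R j x)"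
    using cohesive[OF R C] by blast
  define X where "X x \<longleftrightarrow> C' x \<and> (\<exists>b. \<forall>y. b \<preceq> y \<longrightarrow> C' y \<longrightarrow> R x y)" for x
  have XD: "Df1 X" unfolding X_def by (intro DA_intros DA_app1[OF C'(1)] DA_app2[OF R])
  show ?thesis
  proof (cases "unb X")
    case True
    \<comment> \<open>The new element is related to every member of \<open>X\<close> up to
      \<open>u\<close>, so single steps already make the whole sequence homogeneous.\<close>
    let ?P = "\<lambda>u v. u \<prec> v \<and> (\<forall>x. x \<preceq> u \<longrightarrow> X x \<longrightarrow> R x v)"
    have PD: "Df2 ?P" by (intro DA_intros DA_app1[OF XD] DA_app2[OF R])
    have step: "\<exists>v. X v \<and> ?P u v" for u
    proof -
      have "\<exists>b. \<forall>y. b \<preceq> y \<longrightarrow> (\<forall>x. x \<prec> sc u \<longrightarrow> X x \<longrightarrow> C' y \<longrightarrow> R x y)"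
      proof (rule eventually_collect)
        show "Df2 (\<lambda>x y. X x \<longrightarrow> C' y \<longrightarrow> R x y)"
          by (intro DA_intros DA_app1[OF XD] DA_app1[OF C'(1)] DA_app2[OF R])
        fix x
        show "\<exists>b. \<forall>y. b \<preceq> y \<longrightarrow> X x \<longrightarrow> C' y \<longrightarrow> R x y"
          by (cases "X x") (unfold X_def, blast+)
      qed
      then obtain b where b: "\<And>x y. b \<preceq> y \<Longrightarrow> x \<prec> sc u \<Longrightarrow> X x \<Longrightarrow> C' y \<Longrightarrow> R x y" by blast
      obtain v where v: "X v" "b \<preceq> v" "sc u \<preceq> v" using unb_ge3[OF True] by blast
      then have "C' v" by (simp add: X_def)
      then have "?P u v" using b[OF v(2)] v(3) by (simp add: less_one_iff one_le_iff)
      then show ?thesis using v(1) by blast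
    qed
    obtain x0 where "X x0" using True unfolding unb_def by blast
    then obtain k where k: "Fd1 k" "\<forall>i. X (k i) \<and> ?P (k i) (k (sc i))"
      using dependent_choice[of X ?P x0, OF XD PD _ step] by blast
    have k1: "k i \<prec> k (sc i)" for i using k(2) by blast
    note mono = increasing(1)[OF k(1) k1]
    have "R (k i) (k j)" if ij: "i \<prec> j" for i j
    proof -
      obtain d where d: "j = sc (i \<oplus> d)" using ij unfolding less_iff' by (metis add_assoc')
      have "k i \<preceq> k (i \<oplus> d)" using mono[of i "i \<oplus> d"] zero_less'[of d] by (auto simp: le_def)
      then show ?thesis using k(2) unfolding d by blast
    qed
    then show ?thesis using nh[OF k(1) k1] by blast
  next
    case False
    then obtain s where s: "\<And>x. s \<preceq> x \<Longrightarrow> \<not> X x" unfolding unb_def by blast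
    let ?C = "\<lambda>x. C' x \<and> s \<preceq> x"
    show ?thesis
    proof (rule that)
      show "Df1 ?C" by (intro DA_intros DA_app1[OF C'(1)])
      show "unb ?C" unfolding unb_def using unb_ge3[OF C'(2)] by blast
      show "C x" if "?C x" for x using C'(3) that by blast
      show "\<exists>b. \<forall>y. b \<preceq> y \<longrightarrow> ?C y \<longrightarrow> \<not> R x y" if "?C x" for x
        using coh[of x] s[of x] that unfolding X_def by blast
    qed
  qed
qed

text \<open>The two ranges are automatically disjoint, since adjacency is irreflexive.\<close>

definition bip_seq :: "('a \<Rightarrow> 'a) \<Rightarrow> ('a \<Rightarrow> 'a) \<Rightarrow> bool" where
  "bip_seq c d \<longleftrightarrow> Fd1 c \<and> Fd1 d \<and> inj c \<and> inj d \<and> (\<forall>i j. adj (c i) (d j))"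

text \<open>An infinite clique is split into its even and its odd positions.\<close>

lemma bip_seq_from_clique:
  assumes a: "Fd1 a" "inj a" and k: "Fd1 k" "\<And>i. k i \<prec> k (sc i)"
    and adj: "\<And>i j. i \<prec> j \<Longrightarrow> adj (a (k i)) (a (k j))"
  shows "\<exists>c d. bip_seq c d"
proof -
  note kinj = injD[OF increasing(3)[OF k]]
  have any: "adj (a (k i)) (a (k j))" if "i \<noteq> j" for i j
    using that adj[of i j] adj_sym[OF adj[of j i]] less_linear'[of i j] by blast
  have "Fd1 (\<lambda>i. a (k (i \<oplus> i)))" "Fd1 (\<lambda>i. a (k (sc (i \<oplus> i))))"
    by (intro Fd1I DA_intros Fn_app1[OF a(1)] Fn_app1[OF k(1)])+
  moreover have "inj (\<lambda>i. a (k (i \<oplus> i)))"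
    by (rule injI, rule double_inject, rule kinj, rule injD[OF a(2)])
  moreover have "inj (\<lambda>i. a (k (sc (i \<oplus> i))))"
    by (rule injI, rule double_inject, rule iffD1[OF basic(2)], rule kinj, rule injD[OF a(2)])
  moreover have "adj (a (k (i \<oplus> i))) (a (k (sc (j \<oplus> j))))" for i j
    by (rule any) (rule even_neq_odd)
  ultimately have "bip_seq (\<lambda>i. a (k (i \<oplus> i))) (\<lambda>i. a (k (sc (i \<oplus> i))))"
    unfolding bip_seq_def by blast
  then show ?thesis by blast
qed

text \<open>
  If none of the relations homogenised below is dense, then for suitable indices \<open>x \<prec> y\<close> the path
  \<open>a y, b y, a x, b x\<close> is chordless.
\<close>

lemma bip_seq_exists:
  assumes h: "half_seq a b"
    and no4: "\<And>u v w z. adj u v \<Longrightarrow> adj v w \<Longrightarrow> adj w z \<Longrightarrow> u \<noteq> w \<Longrightarrow> v \<noteq> z \<Longrightarrow> u \<noteq> z \<Longrightarrow>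
      adj u w \<or> adj v z \<or> adj u z"
  shows "\<exists>c d. bip_seq c d"
proof (rule ccontr)
  assume no: "\<nexists>c d. bip_seq c d"
  note aF = half_seqD(1)[OF h] and bF = half_seqD(2)[OF h] and adj = half_seqD(3)[OF h]
    and amono = half_seqD(4)[OF h] and bmono = half_seqD(5)[OF h]
    and ainj = half_seqD(6)[OF h] and binj = half_seqD(7)[OF h]
  have D: "Df2 (\<lambda>i j. adj (a i) (a j))" "Df2 (\<lambda>i j. adj (b i) (b j))" "Df2 (\<lambda>i j. adj (b i) (a j))"
    by (intro DA_app2[OF adjD] Fn_app1[OF aF] Fn_app1[OF bF] DA_intros)+
  have "Df1 (\<lambda>x. \<zero> = \<zero>)" "unb (\<lambda>x. \<zero> = \<zero>)" by (intro DA_intros) (auto simp: unb_def)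
  then obtain C1 where C1: "Df1 C1" "unb C1" "\<And>x. C1 x \<Longrightarrow> \<exists>c. \<forall>y. c \<preceq> y \<longrightarrow> C1 y \<longrightarrow> \<not> adj (a x) (a y)"
  proof (rule sparse_subset[OF D(1)])
    fix k assume k: "Fd1 k" "\<And>i. k i \<prec> k (sc i)" "\<And>i j. i \<prec> j \<Longrightarrow> adj (a (k i)) (a (k j))"
    have "\<exists>c d. bip_seq c d" by (rule bip_seq_from_clique[OF aF ainj k(1,2)]) (rule k(3))
    then show False by (rule notE[OF no])
  qed (rule that, assumption, assumption, blast)
  obtain C2 where C2: "Df1 C2" "unb C2" "\<And>x. C2 x \<Longrightarrow> C1 x"
    "\<And>x. C2 x \<Longrightarrow> \<exists>c. \<forall>y. c \<preceq> y \<longrightarrow> C2 y \<longrightarrow> \<not> adj (b x) (b y)"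
  proof (rule sparse_subset[OF D(2) C1(1,2)])
    fix k assume k: "Fd1 k" "\<And>i. k i \<prec> k (sc i)" "\<And>i j. i \<prec> j \<Longrightarrow> adj (b (k i)) (b (k j))"
    have "\<exists>c d. bip_seq c d" by (rule bip_seq_from_clique[OF bF binj k(1,2)]) (rule k(3))
    then show False by (rule notE[OF no])
  qed (rule that)
  obtain C3 where C3: "Df1 C3" "unb C3" "\<And>x. C3 x \<Longrightarrow> C2 x"
    "\<And>x. C3 x \<Longrightarrow> \<exists>c. \<forall>y. c \<preceq> y \<longrightarrow> C3 y \<longrightarrow> \<not> adj (b x) (a y)"
  proof (rule sparse_subset[OF D(3) C2(1,2)])
    fix k assume k: "Fd1 k" "\<And>i. k i \<prec> k (sc i)" "\<And>i j. i \<prec> j \<Longrightarrow> adj (b (k i)) (a (k j))"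
    note kmono = increasing(1)[OF k(1,2)]
    note kinj = injD[OF increasing(3)[OF k(1,2)]]
    \<comment> \<open>The half graph supplies the edges with \<open>i \<preceq> j\<close>, the
      homogeneous sequence those with \<open>j \<prec> i\<close>.\<close>
    have "adj (a (k i)) (b (k j))" for i j
    proof (cases "j \<prec> i")
      case True
      then show ?thesis using adj_sym[OF k(3)] by blast
    next
      case False
      then have "i \<preceq> j" by (simp add: N.not_less)
      then have "k i \<preceq> k j" using kmono[of i j] unfolding le_def by blast
      then show ?thesis by (rule adj)
    qed
    moreover have "Fd1 (\<lambda>i. a (k i))" "Fd1 (\<lambda>i. b (k i))"
      by (intro Fd1I DA_intros Fn_app1[OF aF] Fn_app1[OF bF] Fn_app1[OF k(1)])+
    moreover have "inj (\<lambda>i. a (k i))" by (rule injI, rule kinj, rule injD[OF ainj])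
    moreover have "inj (\<lambda>i. b (k i))" by (rule injI, rule kinj, rule injD[OF binj])
    ultimately have "bip_seq (\<lambda>i. a (k i)) (\<lambda>i. b (k i))" unfolding bip_seq_def by blast
    then show False using no by blast
  qed (rule that)
  obtain x where x: "C3 x" using C3(2) unfolding unb_def by blast
  obtain c1 where c1: "\<And>y. c1 \<preceq> y \<Longrightarrow> C1 y \<Longrightarrow> \<not> adj (a x) (a y)" using C1(3) C2(3) C3(3) x by blast
  obtain c2 where c2: "\<And>y. c2 \<preceq> y \<Longrightarrow> C2 y \<Longrightarrow> \<not> adj (b x) (b y)" using C2(4) C3(3) x by blast
  obtain c3 where c3: "\<And>y. c3 \<preceq> y \<Longrightarrow> C3 y \<Longrightarrow> \<not> adj (b x) (a y)" using C3(4) x by blast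
  obtain y0 where y0: "C3 y0" "c1 \<preceq> y0" "c2 \<preceq> y0" "c3 \<oplus> sc x \<preceq> y0" using unb_ge3[OF C3(2)] by blast
  have "c3 \<preceq> c3 \<oplus> sc x" "sc x \<preceq> c3 \<oplus> sc x" by (simp_all add: le_iff' exI[of _ c3] add_commute'[of c3])
  then have ge: "c3 \<preceq> y0" "sc x \<preceq> y0" using y0(4) by order+
  then have xy: "x \<prec> y0" by (simp add: one_le_iff)
  have "\<not> adj (a y0) (a x)" using c1[OF y0(2) C2(3)[OF C3(3)[OF y0(1)]]] adj_sym by blast
  moreover have "\<not> adj (b y0) (b x)" using c2[OF y0(3) C3(3)[OF y0(1)]] adj_sym by blast
  moreover have "\<not> adj (a y0) (b x)" using c3[OF ge(1) y0(1)] adj_sym by blast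
  moreover have "adj (a y0) (b y0)" by (rule adj) simp
  moreover have "adj (b y0) (a x)" by (rule adj_sym, rule adj) (use xy in \<open>simp add: N.less_imp_le\<close>)
  moreover have "adj (a x) (b x)" by (rule adj) simp
  moreover have "a y0 \<noteq> a x" "b y0 \<noteq> b x" using amono[OF xy] bmono[OF xy] by auto
  moreover have "a y0 \<noteq> b x" by (rule half_seqD(8)[OF h])
  ultimately show False using no4[of "a y0" "b y0" "a x" "b x"] by blast
qed

end

section \<open>From sequences to subgraphs\<close>

context aca
begin

lemma even_or_odd: "\<exists>m. x = m \<oplus> m \<or> x = sc (m \<oplus> m)"
proof (rule D0_induct[where P = "\<lambda>x. \<exists>m. x = m \<oplus> m \<or> x = sc (m \<oplus> m)"])
  show "Df1 (\<lambda>x. \<exists>m. x = m \<oplus> m \<or> x = sc (m \<oplus> m))" by (intro DA_intros)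
  show "\<exists>m. \<zero> = m \<oplus> m \<or> \<zero> = sc (m \<oplus> m)" by (rule exI[of _ \<zero>]) simp
  fix x assume "\<exists>m. x = m \<oplus> m \<or> x = sc (m \<oplus> m)"
  then obtain m where "x = m \<oplus> m \<or> x = sc (m \<oplus> m)" ..
  then have "sc x = sc (m \<oplus> m) \<or> sc x = sc m \<oplus> sc m" by (auto simp: ac_simps)
  then show "\<exists>m. sc x = m \<oplus> m \<or> sc x = sc (m \<oplus> m)" by blast
qed

end

locale traced_graph = aca +
  fixes V E :: "'a set" and T :: "'a \<Rightarrow> 'a"
  assumes E_Sets: "E \<in> Sets M" and graph: "graph_on V E"
    and TF: "Fd1 T" and TV: "\<And>i. T i \<in> V" and Tinj: "inj T" and Tadj: "\<And>i. pr (T i) (T (sc i)) \<in> E"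
begin

abbreviation "tadj i j \<equiv> pr (T i) (T j) \<in> E"

sublocale G: definable_graph M tadj
proof
  show "Df2 tadj" by (intro DA_intros Fn_app1[OF TF] E_Sets)
  show "tadj u v \<Longrightarrow> tadj v u" "\<not> tadj u u" for u v
    using graph by (simp_all add: graph_on_def)
qed

lemma has_chordless_from_seq:
  assumes w: "Fd1 w" "chordless_seq tadj w n"
  shows "has_chordless n V E"
proof -
  let ?P = "{z. \<exists>i. i \<prec> n \<and> z = pr i (T (w i))}"
  have PS: "?P \<in> Sets M"
    by (rule D0_comprehension) (intro DA_intros Fn_app1[OF TF] Fn_app1[OF w(1)])
  have P: "pr i x \<in> ?P \<longleftrightarrow> i \<prec> n \<and> x = T (w i)" for i x by auto
  have D: "Df2 (\<lambda>i z. z = pr i (T (w i)))" by (intro DA_intros Fn_app1[OF TF] Fn_app1[OF w(1)])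
  \<comment> \<open>A path has to be a bounded set; collection bounds its codes.\<close>
  obtain k where "\<And>i. i \<prec> n \<Longrightarrow> \<exists>z. z \<prec> k \<and> z = pr i (T (w i))"
    by (rule Sigma1_collection[OF D, of n]) (blast, rule that)
  then have bd: "\<forall>z. z \<in> ?P \<longrightarrow> z \<prec> k" by blast
  have ch: "\<And>i j. i \<prec> n \<Longrightarrow> j \<prec> n \<Longrightarrow> tadj (w i) (w j) \<longleftrightarrow> i = sc j \<or> j = sc i"
    and winj: "\<And>i j. i \<prec> n \<Longrightarrow> j \<prec> n \<Longrightarrow> w i = w j \<Longrightarrow> i = j"
    using w(2) unfolding chordless_seq_def by blast+
  have "chordless_path n V E ?P"
    unfolding chordless_path_def
  proof (intro conjI)
    show "\<exists>k. \<forall>z. z \<in> ?P \<longrightarrow> z \<prec> k" using bd by blast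
    show "\<forall>z. z \<in> ?P \<longrightarrow> (\<exists>i x. z = pr i x \<and> x \<in> V)" using TV by blast
    show "\<forall>i x y. pr i x \<in> ?P \<and> pr i y \<in> ?P \<longrightarrow> x = y" unfolding P by blast
    show "\<forall>i. i \<prec> n \<longleftrightarrow> (\<exists>x. pr i x \<in> ?P)" unfolding P by blast
    show "\<forall>i j x. pr i x \<in> ?P \<and> pr j x \<in> ?P \<longrightarrow> i = j"
      unfolding P using winj injD[OF Tinj] by blast
    show "\<forall>i x y. pr i x \<in> ?P \<and> pr (sc i) y \<in> ?P \<longrightarrow> pr x y \<in> E"
      unfolding P using ch by blast
    show "\<forall>i j x y. pr i x \<in> ?P \<and> pr j y \<in> ?P \<longrightarrow> (pr x y \<in> E \<longleftrightarrow> i = sc j \<or> j = sc i)"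
      unfolding P using ch by blast
  qed
  then show ?thesis unfolding has_chordless_def using PS by blast
qed

text \<open>The relation \<open>R\<close> covers both targets: the order for \<open>A\<close>, the
  full relation for the complete bipartite graph.\<close>

lemma embeds_from_seqs:
  assumes c: "Fd1 c" "inj c" and d: "Fd1 d" "inj d" and cd: "\<And>i j. c i \<noteq> d j"
    and edge: "\<And>i j. R i j \<Longrightarrow> tadj (c i) (d j)"
    and F: "\<And>z. z \<in> F \<longleftrightarrow> (\<exists>n m. R n m \<and> (z = pr (n \<oplus> n) (sc (m \<oplus> m)) \<or> z = pr (sc (m \<oplus> m)) (n \<oplus> n)))"
  shows "\<exists>G\<in>Sets M. embeds V E UNIV F G"
proof
  let ?G = "{z. \<exists>n. z = pr (n \<oplus> n) (T (c n)) \<or> z = pr (sc (n \<oplus> n)) (T (d n))}"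
  show "?G \<in> Sets M"
    by (rule D0_comprehension) (intro DA_intros Fn_app1[OF TF] Fn_app1[OF c(1)] Fn_app1[OF d(1)])
  have odd_inj: "i = j" if "sc (i \<oplus> i) = sc (j \<oplus> j)" for i j
    by (rule double_inject, rule iffD1[OF basic(2)], rule that)
  have G_iff: "pr x u \<in> ?G \<longleftrightarrow> (\<exists>n. (x = n \<oplus> n \<and> u = T (c n)) \<or> (x = sc (n \<oplus> n) \<and> u = T (d n)))" for x u
    by (simp only: mem_Collect_eq pr_inject)
  have even: "pr (n \<oplus> n) u \<in> ?G \<longleftrightarrow> u = T (c n)" for n u
    unfolding G_iff
  proof
    assume "\<exists>m. (n \<oplus> n = m \<oplus> m \<and> u = T (c m)) \<or> (n \<oplus> n = sc (m \<oplus> m) \<and> u = T (d m))"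
    then obtain m where m: "(n \<oplus> n = m \<oplus> m \<and> u = T (c m)) \<or> (n \<oplus> n = sc (m \<oplus> m) \<and> u = T (d m))" ..
    then have "n \<oplus> n = m \<oplus> m" "u = T (c m)" using even_neq_odd[of n m] by auto
    then show "u = T (c n)" using double_inject[of n m] by simp
  qed blast
  have odd: "pr (sc (n \<oplus> n)) u \<in> ?G \<longleftrightarrow> u = T (d n)" for n u
    unfolding G_iff
  proof
    assume "\<exists>m. (sc (n \<oplus> n) = m \<oplus> m \<and> u = T (c m)) \<or> (sc (n \<oplus> n) = sc (m \<oplus> m) \<and> u = T (d m))"
    then obtain m where m: "(sc (n \<oplus> n) = m \<oplus> m \<and> u = T (c m)) \<or> (sc (n \<oplus> n) = sc (m \<oplus> m) \<and> u = T (d m))" ..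
    then have "sc (n \<oplus> n) = sc (m \<oplus> m)" "u = T (d m)" using even_neq_odd[of m n] by metis+
    then show "u = T (d n)" using odd_inj[of n m] by simp
  qed blast
  have cases: thesis if "\<And>n. x = n \<oplus> n \<Longrightarrow> thesis" "\<And>n. x = sc (n \<oplus> n) \<Longrightarrow> thesis" for x thesis
    using even_or_odd[of x] that by blast
  have sym: "pr x y \<in> E \<Longrightarrow> pr y x \<in> E" for x y using graph by (simp add: graph_on_def)
  show "embeds V E UNIV F ?G"
    unfolding embeds_def
  proof (intro conjI allI impI)
    show "\<exists>x u. z = pr x u \<and> x \<in> UNIV \<and> u \<in> V" if "z \<in> ?G" for z using that TV by blast
    show "\<exists>u. pr x u \<in> ?G" for x by (rule cases[of x]) (use even odd in blast)+
    show "u = v" if uv: "pr x u \<in> ?G \<and> pr x v \<in> ?G" for x u v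
    proof (rule cases[of x])
      fix n assume "x = n \<oplus> n"
      then have "u = T (c n)" "v = T (c n)" using uv even by blast+
      then show "u = v" by simp
    next
      fix n assume "x = sc (n \<oplus> n)"
      then have "u = T (d n)" "v = T (d n)" using uv odd by blast+
      then show "u = v" by simp
    qed
    show "x = y" if "pr x u \<in> ?G \<and> pr y u \<in> ?G" for x y u
      using that unfolding G_iff
      by (elim conjE exE disjE)
         (simp_all add: inj_eq[OF Tinj] inj_eq[OF c(2)] inj_eq[OF d(2)] cd cd[symmetric])
    show "pr u v \<in> E" if xy: "pr x y \<in> F \<and> pr x u \<in> ?G \<and> pr y v \<in> ?G" for x y u v
    proof -
      from xy F obtain n m where nm: "R n m"
        "(x = n \<oplus> n \<and> y = sc (m \<oplus> m)) \<or> (x = sc (m \<oplus> m) \<and> y = n \<oplus> n)" by auto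
      from nm(2) show ?thesis
      proof
        assume "x = n \<oplus> n \<and> y = sc (m \<oplus> m)"
        then have "u = T (c n)" "v = T (d m)" using xy even odd by blast+
        then show ?thesis using edge[OF nm(1)] by simp
      next
        assume "x = sc (m \<oplus> m) \<and> y = n \<oplus> n"
        then have "v = T (c n)" "u = T (d m)" using xy even odd by blast+
        then show ?thesis using sym[OF edge[OF nm(1)]] by simp
      qed
    qed
  qed
qed

lemma half_seq_if_short:
  assumes "\<not> has_chordless n V E"
  shows "\<exists>a b. G.half_seq a b"
proof -
  interpret short_paths M tadj n
  proof
    show "tadj i (sc i)" for i by (rule Tadj)
    show "\<not> chordless_seq tadj w n" if "Fd1 w" for w
      using has_chordless_from_seq[OF that] assms by blast
  qed
  show ?thesis by (rule half_seq_exists)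
qed

lemma has_A_from_half_seq:
  assumes "G.half_seq a b" shows "has_A V E"
proof -
  note h = G.half_seqD[OF assms]
  let ?F = "{z. \<exists>n m. (n \<prec> m \<or> n = m) \<and> (z = pr (n \<oplus> n) (sc (m \<oplus> m)) \<or> z = pr (sc (m \<oplus> m)) (n \<oplus> n))}"
  have F: "?F \<in> Sets M" by (rule D0_comprehension) (intro DA_intros)
  have "\<exists>G\<in>Sets M. embeds V E UNIV ?F G"
    by (rule embeds_from_seqs[OF h(1,6,2,7,8), of "\<lambda>n m. n \<prec> m \<or> n = m"])
       (use h(3) in \<open>auto simp: le_def\<close>)
  moreover have "is_A UNIV ?F" by (simp add: is_A_def)
  ultimately show ?thesis unfolding has_A_def using F UNIV_Sets by blast
qed

lemma has_K_from_bip_seq: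
  assumes "G.bip_seq c d" shows "has_K V E"
proof -
  have cF: "Fd1 c" and dF: "Fd1 d" and inj: "inj c" "inj d" and adj: "\<And>i j. tadj (c i) (d j)"
    using assms unfolding G.bip_seq_def by auto
  have ne: "c i \<noteq> d j" for i j using adj[of i j] G.adj_irrefl by metis
  let ?F = "{z. \<exists>n m. z = pr (n \<oplus> n) (sc (m \<oplus> m)) \<or> z = pr (sc (m \<oplus> m)) (n \<oplus> n)}"
  have F: "?F \<in> Sets M" by (rule D0_comprehension) (intro DA_intros)
  have "\<exists>G\<in>Sets M. embeds V E UNIV ?F G"
    by (rule embeds_from_seqs[OF cF inj(1) dF inj(2) ne, of "\<lambda>n m. True"]) (use adj in auto)
  moreover have "is_K UNIV ?F" by (simp add: is_K_def)
  ultimately show ?thesis unfolding has_K_def using F UNIV_Sets by blast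
qed

lemma no_induced_4_path:
  assumes no: "\<not> has_chordless four V E"
    and adj: "tadj u v" "tadj v w" "tadj w z" and ne: "u \<noteq> w" "v \<noteq> z" "u \<noteq> z"
  shows "tadj u w \<or> tadj v z \<or> tadj u z"
proof (rule ccontr)
  assume nadj: "\<not> (tadj u w \<or> tadj v z \<or> tadj u z)"
  let ?two = "sc \<one>" and ?three = "sc (sc \<one>)"
  let ?w = "\<lambda>i. if i = \<zero> then u else if i = \<one> then v else if i = ?two then w else z"
  have w: "Fd1 ?w" by (intro Fd1I DA_intros)
  have "chordless_seq tadj ?w four"
  proof -
    have dist: "\<zero> \<noteq> \<one>" "\<zero> \<noteq> ?two" "\<zero> \<noteq> ?three" "\<one> \<noteq> ?two" "\<one> \<noteq> ?three" "?two \<noteq> ?three"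
      "\<zero> \<noteq> four" "\<one> \<noteq> four" "?two \<noteq> four" "?three \<noteq> four"
      using basic(1)[of \<zero>] basic(1)[of \<one>] basic(1)[of ?two] basic(1)[of ?three]
        basic(2)[of \<zero> \<one>] basic(2)[of \<zero> ?two] basic(2)[of \<one> ?two] basic(2)[of \<zero> ?three]
        basic(2)[of \<one> ?three] basic(2)[of ?two ?three] by auto
    have irr: "\<not> tadj x x" for x by (rule G.adj_irrefl)
    have vne: "u \<noteq> v" "v \<noteq> w" "w \<noteq> z" using adj irr by auto
    have cs: "i = \<zero> \<or> i = \<one> \<or> i = ?two \<or> i = ?three" if "i \<prec> four" for i
    proof -
      have "i \<prec> sc (sc (sc (sc \<zero>)))" using that by (simp only: N.add_0_left)
      then have "(((i \<prec> \<zero> \<or> i = \<zero>) \<or> i = sc \<zero>) \<or> i = sc (sc \<zero>)) \<or> i = sc (sc (sc \<zero>))"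
        by (simp only: basic(8))
      then show ?thesis by (simp only: basic(7) N.add_0_left) blast
    qed
    have sy: "tadj v u" "tadj w v" "tadj z w" "\<not> tadj w u" "\<not> tadj z v" "\<not> tadj z u"
      using adj nadj G.adj_sym by blast+
    show ?thesis
      unfolding chordless_seq_def
    proof (intro allI impI)
      fix i j assume "i \<prec> four" "j \<prec> four"
      from cs[OF this(1)] cs[OF this(2)]
      show "(tadj (?w i) (?w j) \<longleftrightarrow> i = sc j \<or> j = sc i) \<and> (?w i = ?w j \<longrightarrow> i = j)"
        using dist dist[symmetric] adj nadj sy irr vne vne[symmetric] ne ne[symmetric]
        by (elim disjE) (simp_all add: N.add_0_left)
    qed
  qed
  from has_chordless_from_seq[OF w this] show False by (rule notE[OF no])
qed

end

context aca
begin

section \<open>Both graph statements in models of arithmetical comprehension\<close>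

lemma traceable_traced:
  assumes "traceable V E" "E \<in> Sets M"
  shows "\<exists>T. traced_graph M V E T"
proof -
  obtain S where S: "S \<in> Sets M" "traces V E S" and graph: "graph_on V E"
    using assms(1) unfolding traceable_def by blast
  note tr = S(2)[unfolded traces_def]
  have S1: "\<forall>z. z \<in> S \<longrightarrow> (\<exists>i x. z = pr i x \<and> x \<in> V)" using tr by (elim conjE)
  have S2: "\<forall>i. \<exists>x. pr i x \<in> S" using tr by (elim conjE)
  have S3: "\<forall>i x y. pr i x \<in> S \<and> pr i y \<in> S \<longrightarrow> x = y" using tr by (elim conjE)
  have S4: "\<forall>i j x. pr i x \<in> S \<and> pr j x \<in> S \<longrightarrow> i = j" using tr by (elim conjE)
  have S5: "\<forall>i x y. pr i x \<in> S \<and> pr (sc i) y \<in> S \<longrightarrow> pr x y \<in> E" using tr by (elim conjE)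
  from S2 obtain T where T: "\<And>i. pr i (T i) \<in> S" by metis
  have iff: "x = T i \<longleftrightarrow> pr i x \<in> S" for x i using T S3 by blast
  have "traced_graph M V E T"
  proof
    show "E \<in> Sets M" "graph_on V E" by fact+
    show "Fd1 T" unfolding iff by (intro DA_intros S(1))
    show "T i \<in> V" for i using S1 T[of i] by auto
    show "inj T" using S4 T by (metis injI)
    show "pr (T i) (T (sc i)) \<in> E" for i using S5 T by blast
  qed
  then show ?thesis by (rule exI[of _ T])
qed

lemma long_paths_or_A_holds: "M \<Turnstile> long_paths_or_A"
  unfolding holds_long_paths_or_A
proof (intro ballI impI)
  fix V E assume "E \<in> Sets M" "traceable V E"
  then obtain T where "traced_graph M V E T" using traceable_traced by blast
  then interpret traced_graph M V E T .
  show "(\<forall>n. has_chordless n V E) \<or> has_A V E"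
    using half_seq_if_short has_A_from_half_seq by blast
qed

lemma no_4_path_implies_K_holds: "M \<Turnstile> no_4_path_implies_K"
  unfolding holds_no_4_path_implies_K
proof (intro ballI impI)
  fix V E assume "E \<in> Sets M" and tr: "traceable V E \<and> \<not> has_chordless four V E"
  then obtain T where "traced_graph M V E T" using traceable_traced by blast
  then interpret traced_graph M V E T .
  \<comment> \<open>The half graph comes from the general argument with length bound
    \<open>four\<close>.\<close>
  obtain a b where "G.half_seq a b" using half_seq_if_short tr by blast
  then obtain c d where "G.bip_seq c d"
    using G.bip_seq_exists[of a b] no_induced_4_path tr by blast
  then show "has_K V E" by (rule has_K_from_bip_seq)
qed

end

theorem theorem2p13:
  fixes M :: "'a l2_structure"
  assumes "M \<Turnstile>\<^sub>T RCA0"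
  shows "(M \<Turnstile> long_paths_or_A \<longleftrightarrow> M \<Turnstile> no_4_path_implies_K)
       \<and> (M \<Turnstile> no_4_path_implies_K \<longleftrightarrow> M \<Turnstile>\<^sub>T ACA0)"
proof -
  interpret rca M by unfold_locales (rule assms)
  have *: "M \<Turnstile> long_paths_or_A" "M \<Turnstile> no_4_path_implies_K" if proj_closed
  proof -
    interpret aca M by unfold_locales (rule that)
    show "M \<Turnstile> long_paths_or_A" "M \<Turnstile> no_4_path_implies_K"
      by (rule long_paths_or_A_holds no_4_path_implies_K_holds)+
  qed
  show ?thesis
    using * long_paths_or_A_imp no_4_path_implies_K_imp proj_closed_imp_ACA0 ACA0_imp_proj_closed
    by blast
qed

end
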